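(* Let $G$ be a group, let $k$ be a commutative $G$-ring, let $n$ be a natural number and let $\varepsilon\in k$ be invertible. Let $G\mathcal{R}_n(\varepsilon)$ be the $G$-rook algebra over $k$, and let $G^n\rtimes\Sigma_n$ be the semi-direct product in which the symmetric group $\Sigma_n$ acts on $G^n$ by permuting the factors. Then there exists an isomorphism of graded $k$-modules $$\mathrm{Tor}_{\star}^{G\mathcal{R}_n(\varepsilon)}(\mathbf{1},\mathbf{1})\cong \mathrm{Tor}_{\star}^{k[G^n\rtimes\Sigma_n]}(\mathbf{1},\mathbf{1})=H_{\star}(G^n\rtimes\Sigma_n,k).$$
   Context: A commutative $G$-ring is a unital commutative ring $k$ together with a group homomorphism $G\to\mathrm{Aut}(k)$ to the group of ring automorphisms of $k$. A $G$-rook $n$-diagram is a graph on two columns (left and right) of $n$ nodes in which each node is connected to at most one other node by an edge, every edge joins a left node to a right node, and each edge is labelled by an element of $G$. The $G$-rook algebra $G\mathcal{R}_n(\varepsilon)$ consists of formal $k$-linear combinations of $G$-rook $n$-diagrams. The product $x\cdot y$ of two diagrams is the $k$-bilinear extension of: identify the right-hand nodes of $x$ with the left-hand nodes of $y$, forget the middle nodes, label each edge formed by concatenation with the product of the group elements read from left to right, and multiply by a factor $\varepsilon$ for each contractible component lying entirely in the middle, i.e. for each middle node attached to no edge of $x$ and no edge of $y$. An edge which reaches the middle column and is not continued is discarded without a factor, leaving its outer node unconnected. The trivial module $\mathbf{1}$ of $G\mathcal{R}_n(\varepsilon)$ is a copy of $k$ (as a left and as a right module) on which diagrams with no missing edges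 act as $1$ and all other diagrams act as $0$. For the (ordinary, untwisted) group algebra $k[G^n\rtimes\Sigma_n]$, $\mathbf{1}$ is $k$ with every group element acting as $1$. *)

theory Defs
  imports
    "HOL-Algebra.Module" "HOL-Algebra.QuotRing" "HOL-Algebra.Bij"
    "HOL-Algebra.Product_Groups" "HOL-Algebra.Sym_Groups"
begin

section \<open>Free modules, quotient modules and homology\<close>

text \<open>
  The record type of \<^theory>\<open>HOL-Algebra.Module\<close> is used for three kinds of objects, always with
  scalars written on the left of \<open>\<odot>\<close>: modules over the commutative ring \<open>k\<close>
  (the library locale \<^locale>\<open>module\<close>), \<open>k\<close>-algebras \<open>A\<close> (both the
  ring operations and the action of \<open>k\<close> are then meaningful), and left or right modules over a
  possibly noncommutative ring \<open>A\<close>. In a right module, \<open>a \<odot> m\<close> denotes \<open>m\<cdot>a\<close>, so that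
  \<open>(a \<otimes> b) \<odot> m = b \<odot> (a \<odot> m)\<close>. The multiplicative fields of a module that is not an
  algebra carry no information.
\<close>

definition free_module :: "('r, 'z) ring_scheme \<Rightarrow> 's set \<Rightarrow> ('r, 's \<Rightarrow> 'r) module" where
  "free_module R S =
     \<lparr>carrier = {f. range f \<subseteq> carrier R \<and> finite {s. f s \<noteq> \<zero>\<^bsub>R\<^esub>} \<and> {s. f s \<noteq> \<zero>\<^bsub>R\<^esub>} \<subseteq> S},
      monoid.mult = undefined, one = undefined,
      zero = (\<lambda>_. \<zero>\<^bsub>R\<^esub>), add = (\<lambda>f g s. f s \<oplus>\<^bsub>R\<^esub> g s),
      smult = (\<lambda>a f s. a \<otimes>\<^bsub>R\<^esub> f s)\<rparr>"

definition basis_vec :: "('r, 'z) ring_scheme \<Rightarrow> 's \<Rightarrow> 's \<Rightarrow> 'r" where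
  "basis_vec R s = (\<lambda>t. if t = s then \<one>\<^bsub>R\<^esub> else \<zero>\<^bsub>R\<^esub>)"

text \<open>The \<open>R\<close>-linear map from a free module to \<open>N\<close> that sends the basis element \<open>s\<close> to \<open>v s\<close>.\<close>

definition lin_ext ::
  "('r, 'z) ring_scheme \<Rightarrow> ('r, 'n, 'y) module_scheme \<Rightarrow> ('s \<Rightarrow> 'n) \<Rightarrow> ('s \<Rightarrow> 'r) \<Rightarrow> 'n" where
  "lin_ext R N v f = (\<Oplus>\<^bsub>N\<^esub>s\<in>{s. f s \<noteq> \<zero>\<^bsub>R\<^esub>}. f s \<odot>\<^bsub>N\<^esub> v s)"

definition submodule_span ::
  "('k, 'z) ring_scheme \<Rightarrow> ('k, 'm, 'y) module_scheme \<Rightarrow> 'm set \<Rightarrow> 'm set" where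
  "submodule_span k M X = \<Inter>{H. submodule H k M \<and> X \<subseteq> H}"

definition quotient_module :: "('k, 'm, 'y) module_scheme \<Rightarrow> 'm set \<Rightarrow> ('k, 'm set) module" where
  "quotient_module M H =
     \<lparr>carrier = a_rcosets\<^bsub>M\<^esub> H, monoid.mult = undefined, one = undefined,
      zero = H, add = set_add M,
      smult = (\<lambda>c X. \<Union>x\<in>X. H +>\<^bsub>M\<^esub> (c \<odot>\<^bsub>M\<^esub> x))\<rparr>"

text \<open>Homology of a complex \<open>C 0 \<leftarrow> C 1 \<leftarrow> C 2 \<leftarrow> \<dots>\<close> with \<open>\<delta> i : C (i + 1) \<rightarrow> C i\<close>.\<close>

definition cycles ::
  "(nat \<Rightarrow> ('k, 'm, 'y) module_scheme) \<Rightarrow> (nat \<Rightarrow> 'm \<Rightarrow> 'm) \<Rightarrow> nat \<Rightarrow> 'm set" where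
  "cycles C \<delta> i =
     (case i of 0 \<Rightarrow> carrier (C 0)
      | Suc j \<Rightarrow> {x \<in> carrier (C (Suc j)). \<delta> j x = \<zero>\<^bsub>C j\<^esub>})"

definition homology ::
  "(nat \<Rightarrow> ('k, 'm, 'y) module_scheme) \<Rightarrow> (nat \<Rightarrow> 'm \<Rightarrow> 'm) \<Rightarrow> nat \<Rightarrow> ('k, 'm set) module" where
  "homology C \<delta> i =
     quotient_module ((C i)\<lparr>carrier := cycles C \<delta> i\<rparr>) (\<delta> i ` carrier (C (Suc i)))"

definition module_isos ::
  "('k, 'z) ring_scheme \<Rightarrow> ('k, 'm, 'y) module_scheme \<Rightarrow> ('k, 'n, 'x) module_scheme \<Rightarrow> ('m \<Rightarrow> 'n) set"
where
  "module_isos k M N =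
     {h. bij_betw h (carrier M) (carrier N) \<and>
         (\<forall>x\<in>carrier M. \<forall>y\<in>carrier M. h (x \<oplus>\<^bsub>M\<^esub> y) = h x \<oplus>\<^bsub>N\<^esub> h y) \<and>
         (\<forall>c\<in>carrier k. \<forall>x\<in>carrier M. h (c \<odot>\<^bsub>M\<^esub> x) = c \<odot>\<^bsub>N\<^esub> h x)}"

definition graded_module_iso ::
  "('k, 'z) ring_scheme \<Rightarrow> (nat \<Rightarrow> ('k, 'm, 'y) module_scheme) \<Rightarrow>
     (nat \<Rightarrow> ('k, 'n, 'x) module_scheme) \<Rightarrow> bool" where
  "graded_module_iso k M N \<longleftrightarrow> (\<exists>h. \<forall>i. h i \<in> module_isos k (M i) (N i))"


section \<open>Tensor products over a \<open>k\<close>-algebra\<close>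

text \<open>
  For a right \<open>A\<close>-module \<open>M\<close> and a left \<open>A\<close>-module \<open>N\<close>, the \<open>k\<close>-module \<open>M \<otimes>\<^sub>A N\<close> is the free
  \<open>k\<close>-module on \<open>M \<times> N\<close> modulo biadditivity, \<open>A\<close>-balancedness, and the identification of the
  scalar action of \<open>k\<close> with the action of \<open>k\<close> on \<open>M\<close> through \<open>c \<mapsto> c\<cdot>1\<^sub>A\<close>.
\<close>

definition tensor_relations ::
  "('k, 'z) ring_scheme \<Rightarrow> ('k, 'a, 'y) module_scheme \<Rightarrow> ('a, 'm, 'x) module_scheme \<Rightarrow>
     ('a, 'n, 'w) module_scheme \<Rightarrow> ('m \<times> 'n \<Rightarrow> 'k) set" where
  "tensor_relations k A M N =
     (let F = free_module k (carrier M \<times> carrier N); e = (\<lambda>m x. basis_vec k (m, x)) in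
       {e (m \<oplus>\<^bsub>M\<^esub> m') x \<ominus>\<^bsub>F\<^esub> (e m x \<oplus>\<^bsub>F\<^esub> e m' x) | m m' x.
          m \<in> carrier M \<and> m' \<in> carrier M \<and> x \<in> carrier N} \<union>
       {e m (x \<oplus>\<^bsub>N\<^esub> x') \<ominus>\<^bsub>F\<^esub> (e m x \<oplus>\<^bsub>F\<^esub> e m x') | m x x'.
          m \<in> carrier M \<and> x \<in> carrier N \<and> x' \<in> carrier N} \<union>
       {e (a \<odot>\<^bsub>M\<^esub> m) x \<ominus>\<^bsub>F\<^esub> e m (a \<odot>\<^bsub>N\<^esub> x) | a m x.
          a \<in> carrier A \<and> m \<in> carrier M \<and> x \<in> carrier N} \<union>
       {e ((c \<odot>\<^bsub>A\<^esub> \<one>\<^bsub>A\<^esub>) \<odot>\<^bsub>M\<^esub> m) x \<ominus>\<^bsub>F\<^esub> c \<odot>\<^bsub>F\<^esub> e m x | c m x.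
          c \<in> carrier k \<and> m \<in> carrier M \<and> x \<in> carrier N})"

definition tensor_kernel ::
  "('k, 'z) ring_scheme \<Rightarrow> ('k, 'a, 'y) module_scheme \<Rightarrow> ('a, 'm, 'x) module_scheme \<Rightarrow>
     ('a, 'n, 'w) module_scheme \<Rightarrow> ('m \<times> 'n \<Rightarrow> 'k) set" where
  "tensor_kernel k A M N =
     submodule_span k (free_module k (carrier M \<times> carrier N)) (tensor_relations k A M N)"

definition tensor_product ::
  "('k, 'z) ring_scheme \<Rightarrow> ('k, 'a, 'y) module_scheme \<Rightarrow> ('a, 'm, 'x) module_scheme \<Rightarrow>
     ('a, 'n, 'w) module_scheme \<Rightarrow> ('k, ('m \<times> 'n \<Rightarrow> 'k) set) module" where
  "tensor_product k A M N =
     quotient_module (free_module k (carrier M \<times> carrier N)) (tensor_kernel k A M N)"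

text \<open>The map \<open>M \<otimes>\<^sub>A N \<rightarrow> M \<otimes>\<^sub>A N'\<close> induced by a homomorphism \<open>d : N \<rightarrow> N'\<close>.\<close>

definition tensor_map ::
  "('k, 'z) ring_scheme \<Rightarrow> ('k, 'a, 'y) module_scheme \<Rightarrow> ('a, 'm, 'x) module_scheme \<Rightarrow>
     ('a, 'n', 'v) module_scheme \<Rightarrow> ('n \<Rightarrow> 'n') \<Rightarrow> ('m \<times> 'n \<Rightarrow> 'k) set \<Rightarrow> ('m \<times> 'n' \<Rightarrow> 'k) set"
where
  "tensor_map k A M N' d X =
     (let F' = free_module k (carrier M \<times> carrier N') in
       \<Union>f\<in>X. tensor_kernel k A M N' +>\<^bsub>F'\<^esub> lin_ext k F' (\<lambda>(m, x). basis_vec k (m, d x)) f)"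


section \<open>The canonical free resolution and Tor\<close>

text \<open>
  Every left \<open>A\<close>-module \<open>N\<close> has a free resolution \<open>\<dots> \<rightarrow> F 1 \<rightarrow> F 0 \<rightarrow> N\<close> in which \<open>F 0\<close> is free on
  the elements of \<open>N\<close> and \<open>F (i + 1)\<close> is free on the presentations of the elements of the kernel
  of \<open>F i \<rightarrow> F (i - 1)\<close> (with \<open>F (- 1) = N\<close>) as lists of pairs (coefficient, basis element).
  Thus \<open>Gen x\<close> is mapped to \<open>x\<close>, and \<open>Syz l\<close> to the linear combination \<open>l\<close>. Different lists may
  present the same element of the kernel; this does not affect exactness, and it allows the bases
  of all the \<open>F i\<close> to live in one type.
\<close>

datatype ('a, 'n) cell = Gen 'n | Syz "('a \<times> ('a, 'n) cell) list"

primrec cell_augmentation :: "('a, 'n) cell \<Rightarrow> 'n" where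
  "cell_augmentation (Gen x) = x"

fun linear_combination :: "('a, 'z) ring_scheme \<Rightarrow> ('a \<times> 's) list \<Rightarrow> 's \<Rightarrow> 'a" where
  "linear_combination A [] = (\<lambda>_. \<zero>\<^bsub>A\<^esub>)"
| "linear_combination A ((a, s) # l) =
     (\<lambda>t. a \<otimes>\<^bsub>A\<^esub> basis_vec A s t \<oplus>\<^bsub>A\<^esub> linear_combination A l t)"

primrec cell_boundary :: "('a, 'z) ring_scheme \<Rightarrow> ('a, 'n) cell \<Rightarrow> ('a, 'n) cell \<Rightarrow> 'a" where
  "cell_boundary A (Syz l) = linear_combination A l"

fun resolution_cells ::
  "('a, 'z) ring_scheme \<Rightarrow> ('a, 'n, 'y) module_scheme \<Rightarrow> nat \<Rightarrow> ('a, 'n) cell set" where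
  "resolution_cells A N 0 = Gen ` carrier N"
| "resolution_cells A N (Suc 0) =
     {Syz l | l. set l \<subseteq> carrier A \<times> resolution_cells A N 0 \<and>
        lin_ext A N cell_augmentation (linear_combination A l) = \<zero>\<^bsub>N\<^esub>}"
| "resolution_cells A N (Suc (Suc i)) =
     {Syz l | l. set l \<subseteq> carrier A \<times> resolution_cells A N (Suc i) \<and>
        lin_ext A (free_module A (resolution_cells A N i)) (cell_boundary A)
          (linear_combination A l) = \<zero>\<^bsub>free_module A (resolution_cells A N i)\<^esub>}"

definition resolution ::
  "('a, 'z) ring_scheme \<Rightarrow> ('a, 'n, 'y) module_scheme \<Rightarrow> nat \<Rightarrow> ('a, ('a, 'n) cell \<Rightarrow> 'a) module"
where
  "resolution A N i = free_module A (resolution_cells A N i)"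

definition resolution_map ::
  "('a, 'z) ring_scheme \<Rightarrow> ('a, 'n, 'y) module_scheme \<Rightarrow> nat \<Rightarrow>
     (('a, 'n) cell \<Rightarrow> 'a) \<Rightarrow> ('a, 'n) cell \<Rightarrow> 'a" where
  "resolution_map A N i = lin_ext A (resolution A N i) (cell_boundary A)"

definition Tor ::
  "('k, 'z) ring_scheme \<Rightarrow> ('k, 'a, 'y) module_scheme \<Rightarrow> ('a, 'm, 'x) module_scheme \<Rightarrow>
     ('a, 'n, 'w) module_scheme \<Rightarrow> nat \<Rightarrow> ('k, ('m \<times> (('a, 'n) cell \<Rightarrow> 'a) \<Rightarrow> 'k) set set) module"
where
  "Tor k A M N =
     homology (\<lambda>i. tensor_product k A M (resolution A N i))
              (\<lambda>i. tensor_map k A M (resolution A N i) (resolution_map A N i))"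


section \<open>Twisted monoid algebras\<close>

text \<open>
  The \<open>k\<close>-algebra with basis \<open>S\<close> and product the \<open>k\<close>-bilinear extension of
  \<open>(x, y) \<mapsto> \<alpha> x y \<cdot> (x y)\<close>; its unit is the unit of \<open>S\<close> when \<open>\<alpha> 1 x = \<alpha> x 1 = 1\<close>.
\<close>

definition twisted_monoid_algebra ::
  "('k, 'z) ring_scheme \<Rightarrow> ('s, 'y) monoid_scheme \<Rightarrow> ('s \<Rightarrow> 's \<Rightarrow> 'k) \<Rightarrow> ('k, 's \<Rightarrow> 'k) module" where
  "twisted_monoid_algebra k S \<alpha> =
     (let F = free_module k (carrier S) in
       F\<lparr>monoid.mult := (\<lambda>a b. lin_ext k F (\<lambda>x. lin_ext k F
             (\<lambda>y. \<alpha> x y \<odot>\<^bsub>F\<^esub> basis_vec k (x \<otimes>\<^bsub>S\<^esub> y)) b) a),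
         one := basis_vec k \<one>\<^bsub>S\<^esub>\<rparr>)"

definition group_algebra ::
  "('k, 'z) ring_scheme \<Rightarrow> ('g, 'y) monoid_scheme \<Rightarrow> ('k, 'g \<Rightarrow> 'k) module" where
  "group_algebra k \<Gamma> = twisted_monoid_algebra k \<Gamma> (\<lambda>_ _. \<one>\<^bsub>k\<^esub>)"

text \<open>
  The module with underlying \<open>k\<close>-module \<open>k\<close> on which the basis element \<open>s\<close> acts as
  multiplication by \<open>\<chi> s\<close>. As \<open>k\<close> is commutative, it serves as a left and as a right module.
\<close>

definition character_module :: "('k, 'z) ring_scheme \<Rightarrow> ('s \<Rightarrow> 'k) \<Rightarrow> ('s \<Rightarrow> 'k, 'k) module" where
  "character_module k \<chi> =
     \<lparr>carrier = carrier k, monoid.mult = undefined, one = undefined,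
      zero = \<zero>\<^bsub>k\<^esub>, add = add k,
      smult = (\<lambda>a x. (\<Oplus>\<^bsub>k\<^esub>s\<in>{s. a s \<noteq> \<zero>\<^bsub>k\<^esub>}. a s \<otimes>\<^bsub>k\<^esub> \<chi> s) \<otimes>\<^bsub>k\<^esub> x)\<rparr>"

definition group_trivial_module :: "('k, 'z) ring_scheme \<Rightarrow> ('g \<Rightarrow> 'k, 'k) module" where
  "group_trivial_module k = character_module k (\<lambda>_. \<one>\<^bsub>k\<^esub>)"

text \<open>Homology of the group \<open>\<Gamma>\<close> over \<open>k\<close> with coefficients in the left \<open>k[\<Gamma>]\<close>-module \<open>M\<close>.\<close>

definition group_homology ::
  "('k, 'z) ring_scheme \<Rightarrow> ('g, 'y) monoid_scheme \<Rightarrow> ('g \<Rightarrow> 'k, 'm, 'x) module_scheme \<Rightarrow>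
     nat \<Rightarrow> ('k, ('k \<times> (('g \<Rightarrow> 'k, 'm) cell \<Rightarrow> 'g \<Rightarrow> 'k) \<Rightarrow> 'k) set set) module" where
  "group_homology k \<Gamma> M = Tor k (group_algebra k \<Gamma>) (group_trivial_module k) M"


section \<open>Commutative \<open>G\<close>-rings and the group \<open>G\<^sup>n \<rtimes> \<Sigma>\<^sub>n\<close>\<close>

definition ring_aut_group :: "('k, 'z) ring_scheme \<Rightarrow> ('k \<Rightarrow> 'k) monoid" where
  "ring_aut_group k = BijGroup (carrier k) \<lparr>carrier := ring_hom k k \<inter> Bij (carrier k)\<rparr>"

definition commutative_G_ring ::
  "('g, 'y) monoid_scheme \<Rightarrow> ('k, 'z) ring_scheme \<Rightarrow> ('g \<Rightarrow> 'k \<Rightarrow> 'k) \<Rightarrow> bool" where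
  "commutative_G_ring G k \<phi> \<longleftrightarrow> cring k \<and> \<phi> \<in> hom G (ring_aut_group k)"

definition semidirect_product ::
  "('a, 'z) monoid_scheme \<Rightarrow> ('b, 'y) monoid_scheme \<Rightarrow> ('b \<Rightarrow> 'a \<Rightarrow> 'a) \<Rightarrow> ('a \<times> 'b) monoid" where
  "semidirect_product N H \<theta> =
     \<lparr>carrier = carrier N \<times> carrier H,
      monoid.mult = (\<lambda>(a, s) (b, t). (a \<otimes>\<^bsub>N\<^esub> \<theta> s b, s \<otimes>\<^bsub>H\<^esub> t)),
      one = (\<one>\<^bsub>N\<^esub>, \<one>\<^bsub>H\<^esub>)\<rparr>"

definition permute_factors :: "nat \<Rightarrow> (nat \<Rightarrow> nat) \<Rightarrow> (nat \<Rightarrow> 'g) \<Rightarrow> nat \<Rightarrow> 'g" where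
  "permute_factors n \<sigma> g = (\<lambda>i\<in>{1..n}. g (inv_into UNIV \<sigma> i))"

definition power_semidirect_sym ::
  "('g, 'y) monoid_scheme \<Rightarrow> nat \<Rightarrow> ((nat \<Rightarrow> 'g) \<times> (nat \<Rightarrow> nat)) monoid" where
  "power_semidirect_sym G n =
     semidirect_product (product_group {1..n} (\<lambda>_. G)) (sym_group n) (permute_factors n)"


section \<open>The \<open>G\<close>-rook algebra\<close>

text \<open>
  The nodes of each column are \<open>1, \<dots>, n\<close>. A diagram is its set of labelled edges; \<open>(i, g, j)\<close> is
  the edge with label \<open>g\<close> that joins the left node \<open>i\<close> to the right node \<open>j\<close>.
\<close>

type_synonym 'g diagram = "(nat \<times> 'g \<times> nat) set"

definition rook_diagrams :: "('g, 'y) monoid_scheme \<Rightarrow> nat \<Rightarrow> 'g diagram set" where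
  "rook_diagrams G n =
     {D. D \<subseteq> {1..n} \<times> carrier G \<times> {1..n} \<and>
         (\<forall>(i, g, j)\<in>D. \<forall>(i', g', j')\<in>D. (i, g, j) \<noteq> (i', g', j') \<longrightarrow> i \<noteq> i' \<and> j \<noteq> j')}"

definition left_attached :: "'g diagram \<Rightarrow> nat \<Rightarrow> bool" where
  "left_attached D i \<longleftrightarrow> (\<exists>g j. (i, g, j) \<in> D)"

definition right_attached :: "'g diagram \<Rightarrow> nat \<Rightarrow> bool" where
  "right_attached D j \<longleftrightarrow> (\<exists>i g. (i, g, j) \<in> D)"

definition no_missing_edges :: "nat \<Rightarrow> 'g diagram \<Rightarrow> bool" where
  "no_missing_edges n D \<longleftrightarrow> (\<forall>i\<in>{1..n}. left_attached D i \<and> right_attached D i)"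

definition rook_monoid :: "('g, 'y) monoid_scheme \<Rightarrow> nat \<Rightarrow> 'g diagram monoid" where
  "rook_monoid G n =
     \<lparr>carrier = rook_diagrams G n,
      monoid.mult = (\<lambda>D E. {(i, g \<otimes>\<^bsub>G\<^esub> h, l) | i g j h l. (i, g, j) \<in> D \<and> (j, h, l) \<in> E}),
      one = {(i, \<one>\<^bsub>G\<^esub>, i) | i. i \<in> {1..n}}\<rparr>"

definition middle_components :: "nat \<Rightarrow> 'g diagram \<Rightarrow> 'g diagram \<Rightarrow> nat" where
  "middle_components n D E =
     card {j \<in> {1..n}. \<not> right_attached D j \<and> \<not> left_attached E j}"

definition rook_algebra ::
  "('k, 'z) ring_scheme \<Rightarrow> ('g, 'y) monoid_scheme \<Rightarrow> nat \<Rightarrow> 'k \<Rightarrow> ('k, 'g diagram \<Rightarrow> 'k) module"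
where
  "rook_algebra k G n \<epsilon> =
     twisted_monoid_algebra k (rook_monoid G n) (\<lambda>D E. \<epsilon> [^]\<^bsub>k\<^esub> middle_components n D E)"

definition rook_trivial_module ::
  "('k, 'z) ring_scheme \<Rightarrow> nat \<Rightarrow> ('g diagram \<Rightarrow> 'k, 'k) module" where
  "rook_trivial_module k n =
     character_module k (\<lambda>D. if no_missing_edges n D then \<one>\<^bsub>k\<^esub> else \<zero>\<^bsub>k\<^esub>)"

end

theory Submission
  imports Defs
begin

text \<open>
  Since \<open>\<epsilon>\<close> is invertible, the span of the diagrams with missing edges is cut off by a central
  idempotent \<open>e\<close> of the rook algebra \<open>A\<close>: with \<open>e\<^sub>i\<close> the identity diagram without its \<open>i\<close>-th edge,
  \<open>1 - \<epsilon>\<inverse>e\<^sub>i\<close> kills the diagrams that miss the node \<open>i\<close>, and the product of these elements over \<open>i\<close>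
  kills all diagrams with missing edges from one side. A left and a right annihilator of that kind which
  both map to \<open>1\<close> in \<open>B = k[G\<^sup>n \<rtimes> \<Sigma>\<^sub>n]\<close> have to agree, and this forces centrality. So \<open>A = B \<times> I\<close> as a
  ring, with \<open>I\<close> acting by zero on the trivial module.

  The comparison of the two Tor groups needs neither exactness nor choices, because the maps
  between the canonical resolutions can be written down on cells. Replacing the coefficients of a cell by
  their images under \<open>A \<rightarrow> B\<close> (respectively by \<open>e\<close> times their images under \<open>B \<rightarrow> A\<close>) gives
  semilinear chain maps in both directions. One composite is the identity, and the other one is homotopic to it
  by a homotopy that is defined by recursion on cells and maps basis cells to basis cells.
\<close>

section \<open>Modules over noncommutative rings and semilinear maps\<close>

text \<open>The factor \<epsilon> can be scaled away. With rk the number of edges, the number of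
  isolated middle nodes of D and E is (n - rk D) + (n - rk E) - (n - rk DE), so multiplying each D
  by \<epsilon> to the power -(n - rk D) turns the twisted product into plain concatenation. The
  elements \<epsilon>^-1 e_i are the rescaled identity diagrams with one edge removed, which is why
  they are idempotent.

  The obstacle in comparing the resolutions is that A and B are different rings and that the round
  trip from A through B back to A is not the identity on coefficients. Inserting e repairs this:
  although the round trip replaces a by another element, both have the same multiple by e, so the
  composite is A-linear and a homotopy to the identity can be sought among A-linear maps.

  That homotopy can be written down because of the shape of the canonical resolution: every list
  that presents a cycle is itself a basis cell one degree higher. To bound a cycle it is enough to
  exhibit a presentation of it.\<close>

locale left_module = R?: ring R + M?: abelian_group M
  for R :: "('a, 'c) ring_scheme" (structure) and M :: "('a, 'b, 'd) module_scheme" (structure) +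
  assumes smult_closed [simp, intro]:
      "\<lbrakk>a \<in> carrier R; x \<in> carrier M\<rbrakk> \<Longrightarrow> a \<odot>\<^bsub>M\<^esub> x \<in> carrier M"
    and smult_l_distr:
      "\<lbrakk>a \<in> carrier R; b \<in> carrier R; x \<in> carrier M\<rbrakk> \<Longrightarrow>
        (a \<oplus>\<^bsub>R\<^esub> b) \<odot>\<^bsub>M\<^esub> x = a \<odot>\<^bsub>M\<^esub> x \<oplus>\<^bsub>M\<^esub> b \<odot>\<^bsub>M\<^esub> x"
    and smult_r_distr:
      "\<lbrakk>a \<in> carrier R; x \<in> carrier M; y \<in> carrier M\<rbrakk> \<Longrightarrow>
        a \<odot>\<^bsub>M\<^esub> (x \<oplus>\<^bsub>M\<^esub> y) = a \<odot>\<^bsub>M\<^esub> x \<oplus>\<^bsub>M\<^esub> a \<odot>\<^bsub>M\<^esub> y"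
    and smult_assoc1:
      "\<lbrakk>a \<in> carrier R; b \<in> carrier R; x \<in> carrier M\<rbrakk> \<Longrightarrow>
        (a \<otimes>\<^bsub>R\<^esub> b) \<odot>\<^bsub>M\<^esub> x = a \<odot>\<^bsub>M\<^esub> (b \<odot>\<^bsub>M\<^esub> x)"
    and smult_one [simp]: "x \<in> carrier M \<Longrightarrow> \<one>\<^bsub>R\<^esub> \<odot>\<^bsub>M\<^esub> x = x"
begin

lemma smult_l_null [simp]: "x \<in> carrier M \<Longrightarrow> \<zero>\<^bsub>R\<^esub> \<odot>\<^bsub>M\<^esub> x = \<zero>\<^bsub>M\<^esub>"
  by (metis M.add.r_cancel_one' R.r_zero R.zero_closed smult_closed smult_l_distr)

lemma smult_r_null [simp]: "a \<in> carrier R \<Longrightarrow> a \<odot>\<^bsub>M\<^esub> \<zero>\<^bsub>M\<^esub> = \<zero>\<^bsub>M\<^esub>"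
  by (metis M.add.r_cancel_one' M.l_zero M.zero_closed smult_closed smult_r_distr)

lemma smult_l_minus:
  assumes "a \<in> carrier R" "x \<in> carrier M"
  shows "(\<ominus>\<^bsub>R\<^esub> a) \<odot>\<^bsub>M\<^esub> x = \<ominus>\<^bsub>M\<^esub> (a \<odot>\<^bsub>M\<^esub> x)"
proof -
  have "(\<ominus>\<^bsub>R\<^esub> a) \<odot>\<^bsub>M\<^esub> x \<oplus>\<^bsub>M\<^esub> a \<odot>\<^bsub>M\<^esub> x = \<zero>\<^bsub>M\<^esub>"
    using assms smult_l_distr[of "\<ominus>\<^bsub>R\<^esub> a" a x] by (simp add: R.l_neg)
  then show ?thesis
    using assms by (intro M.minus_equality[symmetric]) auto
qed

lemma smult_r_minus:
  assumes "a \<in> carrier R" "x \<in> carrier M"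
  shows "a \<odot>\<^bsub>M\<^esub> (\<ominus>\<^bsub>M\<^esub> x) = \<ominus>\<^bsub>M\<^esub> (a \<odot>\<^bsub>M\<^esub> x)"
proof -
  have "a \<odot>\<^bsub>M\<^esub> (\<ominus>\<^bsub>M\<^esub> x) \<oplus>\<^bsub>M\<^esub> a \<odot>\<^bsub>M\<^esub> x = \<zero>\<^bsub>M\<^esub>"
    using assms smult_r_distr[of a "\<ominus>\<^bsub>M\<^esub> x" x] by (simp add: M.l_neg)
  then show ?thesis
    using assms by (intro M.minus_equality[symmetric]) auto
qed

lemma finsum_smult_ldistr:
  "\<lbrakk>finite A; a \<in> carrier R; f \<in> A \<rightarrow> carrier M\<rbrakk> \<Longrightarrow>
     a \<odot>\<^bsub>M\<^esub> (\<Oplus>\<^bsub>M\<^esub>i\<in>A. f i) = (\<Oplus>\<^bsub>M\<^esub>i\<in>A. a \<odot>\<^bsub>M\<^esub> f i)"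
  by (induct set: finite) (simp_all add: Pi_def smult_r_distr)

end

text \<open>Over a commutative ring the two notions agree, so facts on submodules of a
  \<open>module\<close> apply to the modules over \<open>k\<close>, while \<open>semilinear\<close>
  serves them and the modules over \<open>A\<close> and \<open>B\<close> alike.\<close>

lemma module_iff_left_module: "module k M \<longleftrightarrow> cring k \<and> left_module k M"
proof
  assume "module k M"
  then interpret module k M .
  show "cring k \<and> left_module k M"
    by (intro conjI left_module.intro left_module_axioms.intro cring_axioms abelian_group_axioms)
      (simp_all add: R.ring_axioms M.abelian_group_axioms smult_l_distr smult_r_distr smult_assoc1)
next
  assume a: "cring k \<and> left_module k M"
  then interpret left_module k M by simp
  show "module k M"
    using a by (intro moduleI M.abelian_group_axioms)
      (simp_all add: smult_l_distr smult_r_distr smult_assoc1)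
qed

text \<open>Here \<open>\<rho>\<close> is an arbitrary function on scalars. One notion thus covers
  linear maps, maps along \<open>\<pi>\<close> and \<open>\<iota>\<close>, and a map that is
  semilinear for two different \<open>\<rho>\<close> at once, as happens in
  \<open>qp_F\<close>.\<close>

definition semilinear ::
  "('r, 'z) ring_scheme \<Rightarrow> ('r \<Rightarrow> 't) \<Rightarrow> ('r, 'm, 'y) module_scheme \<Rightarrow>
     ('t, 'n, 'x) module_scheme \<Rightarrow> ('m \<Rightarrow> 'n) \<Rightarrow> bool" where
  "semilinear R \<rho> M N F \<longleftrightarrow>
     F \<in> carrier M \<rightarrow> carrier N \<and>
     (\<forall>x\<in>carrier M. \<forall>y\<in>carrier M. F (x \<oplus>\<^bsub>M\<^esub> y) = F x \<oplus>\<^bsub>N\<^esub> F y) \<and>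
     (\<forall>a\<in>carrier R. \<forall>x\<in>carrier M. F (a \<odot>\<^bsub>M\<^esub> x) = \<rho> a \<odot>\<^bsub>N\<^esub> F x)"

abbreviation linear where "linear R \<equiv> semilinear R (\<lambda>a. a)"

lemma semilinearD:
  assumes "semilinear R \<rho> M N F"
  shows "x \<in> carrier M \<Longrightarrow> F x \<in> carrier N"
    and "x \<in> carrier M \<Longrightarrow> y \<in> carrier M \<Longrightarrow> F (x \<oplus>\<^bsub>M\<^esub> y) = F x \<oplus>\<^bsub>N\<^esub> F y"
    and "a \<in> carrier R \<Longrightarrow> x \<in> carrier M \<Longrightarrow> F (a \<odot>\<^bsub>M\<^esub> x) = \<rho> a \<odot>\<^bsub>N\<^esub> F x"
  using assms by (auto simp: semilinear_def)

lemma additive_zero: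
  assumes "abelian_group M" "abelian_group N" "F \<in> carrier M \<rightarrow> carrier N"
    and "\<And>x y. x \<in> carrier M \<Longrightarrow> y \<in> carrier M \<Longrightarrow> F (x \<oplus>\<^bsub>M\<^esub> y) = F x \<oplus>\<^bsub>N\<^esub> F y"
  shows "F \<zero>\<^bsub>M\<^esub> = \<zero>\<^bsub>N\<^esub>"
    and "x \<in> carrier M \<Longrightarrow> F (\<ominus>\<^bsub>M\<^esub> x) = \<ominus>\<^bsub>N\<^esub> F x"
    and "x \<in> carrier M \<Longrightarrow> y \<in> carrier M \<Longrightarrow> F (x \<ominus>\<^bsub>M\<^esub> y) = F x \<ominus>\<^bsub>N\<^esub> F y"
proof -
  interpret M: abelian_group M by fact
  interpret N: abelian_group N by fact
  interpret abelian_group_hom M N F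
    by (intro abelian_group_homI assms group_hom.intro group_hom_axioms.intro
        M.a_group N.a_group homI) (use assms in auto)
  show "F \<zero>\<^bsub>M\<^esub> = \<zero>\<^bsub>N\<^esub>" by simp
  show "x \<in> carrier M \<Longrightarrow> F (\<ominus>\<^bsub>M\<^esub> x) = \<ominus>\<^bsub>N\<^esub> F x" by simp
  show "x \<in> carrier M \<Longrightarrow> y \<in> carrier M \<Longrightarrow> F (x \<ominus>\<^bsub>M\<^esub> y) = F x \<ominus>\<^bsub>N\<^esub> F y"
    by (simp add: a_minus_def)
qed

lemma semilinear_zero:
  assumes "semilinear R \<rho> M N F" "abelian_group M" "abelian_group N"
  shows "F \<zero>\<^bsub>M\<^esub> = \<zero>\<^bsub>N\<^esub>"
    and "x \<in> carrier M \<Longrightarrow> F (\<ominus>\<^bsub>M\<^esub> x) = \<ominus>\<^bsub>N\<^esub> F x"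
    and "x \<in> carrier M \<Longrightarrow> y \<in> carrier M \<Longrightarrow> F (x \<ominus>\<^bsub>M\<^esub> y) = F x \<ominus>\<^bsub>N\<^esub> F y"
  using assms additive_zero[OF assms(2,3), of F] by (auto simp: semilinear_def)

lemma semilinear_comp:
  assumes "semilinear R \<rho> M N F" "semilinear R' \<rho>' N P F'" "\<rho> \<in> carrier R \<rightarrow> carrier R'"
  shows "semilinear R (\<lambda>a. \<rho>' (\<rho> a)) M P (\<lambda>x. F' (F x))"
  using assms by (auto simp: semilinear_def Pi_def)

lemma semilinear_add:
  assumes "semilinear R \<rho> M N F" "semilinear R \<rho> M N F'" "left_module R' N"
    "\<rho> \<in> carrier R \<rightarrow> carrier R'"
  shows "semilinear R \<rho> M N (\<lambda>x. F x \<oplus>\<^bsub>N\<^esub> F' x)"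
proof -
  interpret left_module R' N by fact
  show ?thesis
    using assms(1,2,4)
    by (auto simp: semilinear_def Pi_def smult_r_distr M.add.m_ac M.add.m_lcomm)
qed

lemma semilinear_uminus:
  assumes "semilinear R \<rho> M N F" "left_module R' N" "\<rho> \<in> carrier R \<rightarrow> carrier R'"
  shows "semilinear R \<rho> M N (\<lambda>x. \<ominus>\<^bsub>N\<^esub> F x)"
proof -
  interpret left_module R' N by fact
  show ?thesis
    using assms(1,3)
    by (auto simp: semilinear_def Pi_def smult_r_minus M.minus_add)
qed

lemma semilinear_diff:
  assumes "semilinear R \<rho> M N F" "semilinear R \<rho> M N F'" "left_module R' N"
    "\<rho> \<in> carrier R \<rightarrow> carrier R'"
  shows "semilinear R \<rho> M N (\<lambda>x. F x \<ominus>\<^bsub>N\<^esub> F' x)"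
  unfolding a_minus_def by (intro semilinear_add[OF _ _ assms(3,4)] semilinear_uminus[OF _ assms(3,4)] assms)

lemma linear_id: "linear R M M (\<lambda>x. x)"
  by (auto simp: semilinear_def)

section \<open>Free modules and their universal property\<close>

lemma free_carrier:
  "f \<in> carrier (free_module R S) \<longleftrightarrow>
     (\<forall>s. f s \<in> carrier R) \<and> finite {s. f s \<noteq> \<zero>\<^bsub>R\<^esub>} \<and> {s. f s \<noteq> \<zero>\<^bsub>R\<^esub>} \<subseteq> S"
  by (auto simp: free_module_def)

lemma free_simps [simp]:
  "\<zero>\<^bsub>free_module R S\<^esub> = (\<lambda>_. \<zero>\<^bsub>R\<^esub>)"
  "f \<oplus>\<^bsub>free_module R S\<^esub> g = (\<lambda>s. f s \<oplus>\<^bsub>R\<^esub> g s)"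
  "a \<odot>\<^bsub>free_module R S\<^esub> f = (\<lambda>s. a \<otimes>\<^bsub>R\<^esub> f s)"
  by (simp_all add: free_module_def)

context ring
begin

lemma left_module_free: "left_module R (free_module R S)"
proof -
  let ?F = "free_module R S"
  have add: "f \<oplus>\<^bsub>?F\<^esub> g \<in> carrier ?F" if "f \<in> carrier ?F" "g \<in> carrier ?F" for f g
  proof -
    have "{s. f s \<oplus> g s \<noteq> \<zero>} \<subseteq> {s. f s \<noteq> \<zero>} \<union> {s. g s \<noteq> \<zero>}" by auto
    then show ?thesis
      using that finite_subset unfolding free_carrier free_simps
      by (smt (verit) Un_subset_iff a_closed finite_UnI subset_trans sup.absorb_iff1 mem_Collect_eq)
  qed
  have sm: "a \<odot>\<^bsub>?F\<^esub> f \<in> carrier ?F" if "a \<in> carrier R" "f \<in> carrier ?F" for a f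
  proof -
    have "{s. a \<otimes> f s \<noteq> \<zero>} \<subseteq> {s. f s \<noteq> \<zero>}" using that by auto
    then show ?thesis
      using that finite_subset unfolding free_carrier free_simps
      by (smt (verit) m_closed subset_trans)
  qed
  show ?thesis
  proof (intro left_module.intro left_module_axioms.intro abelian_groupI add)
    show "\<exists>y\<in>carrier ?F. y \<oplus>\<^bsub>?F\<^esub> f = \<zero>\<^bsub>?F\<^esub>" if f: "f \<in> carrier ?F" for f
      by (rule bexI[of _ "(\<ominus> \<one>) \<odot>\<^bsub>?F\<^esub> f"], use f in \<open>simp add: free_carrier l_minus l_neg\<close>)
        (rule sm[OF _ f], simp)
  qed (use sm ring_axioms in \<open>auto simp: free_carrier l_distr r_distr m_assoc a_ac\<close>)
qed

lemma basis_closed [simp]: "s \<in> S \<Longrightarrow> basis_vec R s \<in> carrier (free_module R S)"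
  by (auto simp: free_carrier basis_vec_def)

text \<open>Finite support allows \<open>f\<close> to be rebuilt from zero by adding multiples of
  basis vectors one at a time. The cases match the clauses of \<open>semilinear\<close>, so no
  finite sums appear in later inductions.\<close>

lemma free_induct [consumes 1, case_names zero basis add smult]:
  assumes "f \<in> carrier (free_module R S)"
    and zero: "P \<zero>\<^bsub>free_module R S\<^esub>"
    and basis: "\<And>s. s \<in> S \<Longrightarrow> P (basis_vec R s)"
    and add: "\<And>f g. \<lbrakk>f \<in> carrier (free_module R S); g \<in> carrier (free_module R S); P f; P g\<rbrakk> \<Longrightarrow>
      P (f \<oplus>\<^bsub>free_module R S\<^esub> g)"
    and smult: "\<And>a f. \<lbrakk>a \<in> carrier R; f \<in> carrier (free_module R S); P f\<rbrakk> \<Longrightarrow>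
      P (a \<odot>\<^bsub>free_module R S\<^esub> f)"
  shows "P f"
proof -
  let ?F = "free_module R S"
  interpret F: left_module R ?F by (rule left_module_free)
  have "finite A \<Longrightarrow> f \<in> carrier ?F \<Longrightarrow> {s. f s \<noteq> \<zero>} = A \<Longrightarrow> P f" for A f
  proof (induct A arbitrary: f rule: finite_induct)
    case empty
    then have "f = (\<lambda>_. \<zero>)" by auto
    then show ?case using zero by simp
  next
    case (insert x A)
    let ?g = "f(x := \<zero>)"
    have fc: "f s \<in> carrier R" for s using insert by (simp add: free_carrier)
    have supp: "{s. ?g s \<noteq> \<zero>} = A" using insert by auto
    have g: "?g \<in> carrier ?F"
      using insert(1,4,5) supp unfolding free_carrier by auto
    have x: "x \<in> S" using insert by (auto simp: free_carrier)
    have "f = ?g \<oplus>\<^bsub>?F\<^esub> (f x \<odot>\<^bsub>?F\<^esub> basis_vec R x)"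
      using fc by (auto simp: basis_vec_def)
    moreover have "P (?g \<oplus>\<^bsub>?F\<^esub> (f x \<odot>\<^bsub>?F\<^esub> basis_vec R x))"
      by (intro add smult basis insert(3)[OF g supp] g x F.smult_closed fc basis_closed)
    ultimately show ?case by simp
  qed
  then show ?thesis using assms(1) by (auto simp: free_carrier)
qed

end

text \<open>Uniqueness in the universal property of free modules. Most identities between maps below
  are reduced to basis vectors by it.\<close>

lemma semilinear_free_eqI:
  assumes R: "ring R" and "abelian_group N"
    and F: "semilinear R \<rho> (free_module R S) N F" and G: "semilinear R \<rho> (free_module R S) N G"
    and "\<And>s. s \<in> S \<Longrightarrow> F (basis_vec R s) = G (basis_vec R s)"
    and f: "f \<in> carrier (free_module R S)"
  shows "F f = G f"
proof -
  interpret ring R by fact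
  interpret F: left_module R "free_module R S" by (rule left_module_free)
  show ?thesis
    using f
  proof (induct rule: free_induct)
    case zero
    then show ?case
      using semilinear_zero(1)[OF F _ assms(2)] semilinear_zero(1)[OF G _ assms(2)] F.M.abelian_group_axioms
      by simp
  next
    case (add f g)
    then show ?case using semilinearD(2)[OF F, of f g] semilinearD(2)[OF G, of f g] by simp
  next
    case (smult a f)
    then show ?case using semilinearD(3)[OF F, of a f] semilinearD(3)[OF G, of a f] by simp
  qed (use assms in auto)
qed

context left_module
begin

text \<open>The sum in \<open>lin_ext\<close> runs over the support of \<open>f\<close>, which
  varies with \<open>f\<close>. Passing to a larger finite set adds only zero terms and lets the
  sums for several \<open>f\<close> share one index set.\<close>

lemma lin_ext_eq:
  assumes "finite T" "{s. f s \<noteq> \<zero>\<^bsub>R\<^esub>} \<subseteq> T" "\<And>s. f s \<in> carrier R" "v \<in> T \<rightarrow> carrier M"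
  shows "lin_ext R M v f = (\<Oplus>\<^bsub>M\<^esub>s\<in>T. f s \<odot>\<^bsub>M\<^esub> v s)"
  unfolding lin_ext_def
  by (rule M.add.finprod_mono_neutral_cong_left) (use assms in \<open>auto simp: Pi_iff\<close>)

lemma linear_lin_ext:
  assumes v: "v \<in> S \<rightarrow> carrier M"
  shows "linear R (free_module R S) M (lin_ext R M v)"
proof -
  let ?F = "free_module R S"
  interpret F: left_module R ?F by (rule R.left_module_free)
  have "lin_ext R M v f \<in> carrier M" if "f \<in> carrier ?F" for f
    unfolding lin_ext_def using that v by (intro M.finsum_closed) (auto simp: free_carrier)
  moreover have "lin_ext R M v (f \<oplus>\<^bsub>?F\<^esub> g) = lin_ext R M v f \<oplus>\<^bsub>M\<^esub> lin_ext R M v g"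
    if fg: "f \<in> carrier ?F" "g \<in> carrier ?F" for f g
  proof -
    let ?T = "{s. f s \<noteq> \<zero>\<^bsub>R\<^esub>} \<union> {s. g s \<noteq> \<zero>\<^bsub>R\<^esub>}"
    have T: "finite ?T" "v \<in> ?T \<rightarrow> carrier M" "\<And>s. f s \<in> carrier R" "\<And>s. g s \<in> carrier R"
      using fg v by (auto simp: free_carrier)
    have s: "\<And>s. s \<in> ?T \<Longrightarrow> v s \<in> carrier M" using T by auto
    have "lin_ext R M v (f \<oplus>\<^bsub>?F\<^esub> g) = (\<Oplus>\<^bsub>M\<^esub>s\<in>?T. (f s \<oplus>\<^bsub>R\<^esub> g s) \<odot>\<^bsub>M\<^esub> v s)"
      using T by (subst lin_ext_eq[of ?T]) auto
    also have "\<dots> = (\<Oplus>\<^bsub>M\<^esub>s\<in>?T. f s \<odot>\<^bsub>M\<^esub> v s \<oplus>\<^bsub>M\<^esub> g s \<odot>\<^bsub>M\<^esub> v s)"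
      using T s by (intro M.finsum_cong') (auto simp: smult_l_distr)
    also have "\<dots> = (\<Oplus>\<^bsub>M\<^esub>s\<in>?T. f s \<odot>\<^bsub>M\<^esub> v s) \<oplus>\<^bsub>M\<^esub> (\<Oplus>\<^bsub>M\<^esub>s\<in>?T. g s \<odot>\<^bsub>M\<^esub> v s)"
      using T s by (intro M.finsum_addf) auto
    also have "\<dots> = lin_ext R M v f \<oplus>\<^bsub>M\<^esub> lin_ext R M v g"
      using T by (subst (1 2) lin_ext_eq[of ?T]) auto
    finally show ?thesis .
  qed
  moreover have "lin_ext R M v (a \<odot>\<^bsub>?F\<^esub> f) = a \<odot>\<^bsub>M\<^esub> lin_ext R M v f"
    if f: "f \<in> carrier ?F" and a: "a \<in> carrier R" for a f
  proof -
    let ?T = "{s. f s \<noteq> \<zero>\<^bsub>R\<^esub>}"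
    have T: "finite ?T" "v \<in> ?T \<rightarrow> carrier M" "\<And>s. f s \<in> carrier R"
      using f v by (auto simp: free_carrier)
    have s: "\<And>s. s \<in> ?T \<Longrightarrow> v s \<in> carrier M" using T by auto
    have "lin_ext R M v (a \<odot>\<^bsub>?F\<^esub> f) = (\<Oplus>\<^bsub>M\<^esub>s\<in>?T. (a \<otimes>\<^bsub>R\<^esub> f s) \<odot>\<^bsub>M\<^esub> v s)"
      using T a by (subst lin_ext_eq[of ?T]) auto
    also have "\<dots> = (\<Oplus>\<^bsub>M\<^esub>s\<in>?T. a \<odot>\<^bsub>M\<^esub> (f s \<odot>\<^bsub>M\<^esub> v s))"
      using T s a by (intro M.finsum_cong') (auto simp: smult_assoc1)
    also have "\<dots> = a \<odot>\<^bsub>M\<^esub> (\<Oplus>\<^bsub>M\<^esub>s\<in>?T. f s \<odot>\<^bsub>M\<^esub> v s)"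
      using T s a by (intro finsum_smult_ldistr[symmetric]) auto
    finally show ?thesis by (simp add: lin_ext_def)
  qed
  ultimately show ?thesis by (auto simp: semilinear_def)
qed

lemma lin_ext_basis:
  assumes "v s \<in> carrier M"
  shows "lin_ext R M v (basis_vec R s) = v s"
proof -
  have "lin_ext R M v (basis_vec R s) = (\<Oplus>\<^bsub>M\<^esub>t\<in>{s}. basis_vec R s t \<odot>\<^bsub>M\<^esub> v t)"
    using assms by (intro lin_ext_eq) (auto simp: basis_vec_def)
  then show ?thesis using assms by (simp add: basis_vec_def)
qed

end

text \<open>The ring \<open>R\<close> is the ring of scalars of the target; \<open>a \<cdot> s\<close> goes to \<open>\<rho> a \<cdot> v s\<close>.\<close>

definition semi_ext ::
  "('t, 'z) ring_scheme \<Rightarrow> ('t, 'n, 'y) module_scheme \<Rightarrow> ('r \<Rightarrow> 't) \<Rightarrow> ('s \<Rightarrow> 'n) \<Rightarrow> ('s \<Rightarrow> 'r) \<Rightarrow> 'n"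
where
  "semi_ext R N \<rho> v f = lin_ext R N v (\<lambda>s. \<rho> (f s))"

text \<open>The map factors: apply \<open>\<rho>\<close> to all coefficients, then extend linearly
  over the target ring. The first map keeps supports finite because a ring homomorphism sends zero
  to zero.\<close>

lemma semilinear_semi_ext:
  assumes "\<rho> \<in> ring_hom R R'" "ring R" "left_module R' N" "v \<in> S \<rightarrow> carrier N"
  shows "semilinear R \<rho> (free_module R S) N (semi_ext R' N \<rho> v)"
proof -
  interpret R: ring R by fact
  interpret N: left_module R' N by fact
  have z: "\<rho> \<zero>\<^bsub>R\<^esub> = \<zero>\<^bsub>R'\<^esub>" using assms(1,2) N.R.ring_axioms by (rule ring_hom_zero)
  have cl: "(\<lambda>s. \<rho> (f s)) \<in> carrier (free_module R' S)" if "f \<in> carrier (free_module R S)" for f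
  proof -
    have "{s. \<rho> (f s) \<noteq> \<zero>\<^bsub>R'\<^esub>} \<subseteq> {s. f s \<noteq> \<zero>\<^bsub>R\<^esub>}" using z by auto
    then show ?thesis
      using that assms(1) finite_subset unfolding free_carrier
      by (metis (no_types, lifting) ring_hom_closed subset_trans)
  qed
  have "semilinear R \<rho> (free_module R S) (free_module R' S) (\<lambda>f s. \<rho> (f s))"
    using cl assms(1) by (auto simp: semilinear_def ring_hom_add ring_hom_mult free_carrier)
  from semilinear_comp[OF this N.linear_lin_ext[OF assms(4)]] show ?thesis
    using assms(1) unfolding semi_ext_def[abs_def] by (auto simp: ring_hom_def)
qed

lemma semi_ext_basis:
  assumes "\<rho> \<in> ring_hom R R'" "ring R" "left_module R' N" "v s \<in> carrier N"
  shows "semi_ext R' N \<rho> v (basis_vec R s) = v s"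
proof -
  interpret N: left_module R' N by fact
  have "(\<lambda>t. \<rho> (basis_vec R s t)) = basis_vec R' s"
    using assms(1) ring_hom_zero[OF assms(1,2) N.R.ring_axioms]
    by (auto simp: basis_vec_def ring_hom_one)
  then show ?thesis unfolding semi_ext_def by (simp add: N.lin_ext_basis assms(4))
qed

section \<open>Quotient modules and homology\<close>

lemma submodule_imp_abelian_subgroup:
  assumes "module k M" "submodule H k M"
  shows "abelian_subgroup H M"
proof -
  interpret module k M by fact
  show ?thesis
    using assms(2) by (intro abelian_subgroupI3 M.abelian_group_axioms additive_subgroupI)
      (simp add: submodule_def)
qed

lemma linear_image_submodule:
  assumes "module k M" "module k N" "linear k M N F"
  shows "submodule (F ` carrier M) k N"
proof -
  interpret M: module k M by fact
  interpret N: module k N by fact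
  note F = semilinearD[OF assms(3)]
    semilinear_zero[OF assms(3) M.M.abelian_group_axioms N.M.abelian_group_axioms]
  show ?thesis
  proof (rule N.submoduleI)
    show "\<zero>\<^bsub>N\<^esub> \<in> F ` carrier M" by (auto simp: F(4)[symmetric])
    show "\<ominus>\<^bsub>N\<^esub> a \<in> F ` carrier M" if "a \<in> F ` carrier M" for a
      using that by (auto simp: F(5)[symmetric])
    show "a \<oplus>\<^bsub>N\<^esub> b \<in> F ` carrier M" if "a \<in> F ` carrier M" "b \<in> F ` carrier M" for a b
      using that by (auto simp: F(2)[symmetric])
    show "c \<odot>\<^bsub>N\<^esub> a \<in> F ` carrier M" if "c \<in> carrier k" "a \<in> F ` carrier M" for a c
      using that by (auto simp: F(3)[symmetric])
  qed (use F in auto)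
qed

lemma linear_vimage_submodule:
  assumes "module k M" "module k N" "linear k M N F" "submodule H k N"
  shows "submodule {x \<in> carrier M. F x \<in> H} k M"
proof -
  interpret M: module k M by fact
  interpret N: module k N by fact
  interpret H: abelian_subgroup H N by (rule submodule_imp_abelian_subgroup) fact+
  note F = semilinearD[OF assms(3)]
    semilinear_zero[OF assms(3) M.M.abelian_group_axioms N.M.abelian_group_axioms]
  show ?thesis
    by (rule M.submoduleI) (use F N.submoduleE[OF assms(4)] H.zero_closed in auto)
qed

lemma linear_kernel_submodule:
  assumes "module k M" "module k N" "linear k M N F"
  shows "submodule {x \<in> carrier M. F x = \<zero>\<^bsub>N\<^esub>} k M"
proof -
  interpret N: module k N by fact
  have "submodule {\<zero>\<^bsub>N\<^esub>} k N"
    by (rule N.submoduleI) auto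
  from linear_vimage_submodule[OF assms this] show ?thesis by simp
qed

section \<open>Maps between quotient modules\<close>

definition quot_map ::
  "('k, 'n, 'y) module_scheme \<Rightarrow> 'n set \<Rightarrow> ('m \<Rightarrow> 'n) \<Rightarrow> 'm set \<Rightarrow> 'n set" where
  "quot_map N H F X = (\<Union>x\<in>X. H +>\<^bsub>N\<^esub> F x)"

lemma quotient_carrier: "carrier (quotient_module M H) = (\<lambda>x. H +>\<^bsub>M\<^esub> x) ` carrier M"
  by (auto simp: quotient_module_def A_RCOSETS_def')

text \<open>Two representatives of a coset differ by an element of \<open>H\<close>, which
  \<open>F\<close> sends into \<open>H'\<close>. Hence all sets in the union that defines
  \<open>quot_map\<close> coincide, and there is at least one of them.\<close>

lemma quot_map_coset:
  assumes "module k M" "submodule H k M" "module k N" "submodule H' k N"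
    "linear k M N F" "F ` H \<subseteq> H'" "x \<in> carrier M"
  shows "quot_map N H' F (H +>\<^bsub>M\<^esub> x) = H' +>\<^bsub>N\<^esub> F x"
proof -
  interpret M: module k M by fact
  interpret N: module k N by fact
  interpret H: abelian_subgroup H M by (rule submodule_imp_abelian_subgroup) fact+
  interpret H': abelian_subgroup H' N by (rule submodule_imp_abelian_subgroup) fact+
  note F = semilinearD[OF assms(5)]
  have "H' +>\<^bsub>N\<^esub> F y = H' +>\<^bsub>N\<^esub> F x" if "y \<in> H +>\<^bsub>M\<^esub> x" for y
  proof -
    from that obtain h where h: "h \<in> H" "y = h \<oplus>\<^bsub>M\<^esub> x" by (auto simp: a_r_coset_def')
    then have "F y = F h \<oplus>\<^bsub>N\<^esub> F x" using F(2) assms(7) H.a_subset by auto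
    moreover have "F h \<in> H'" using h assms(6) by auto
    ultimately have "F y \<in> H' +>\<^bsub>N\<^esub> F x" by (auto simp: a_r_coset_def')
    then show ?thesis
      using H'.a_repr_independence' assms(7) F(1) by metis
  qed
  moreover have "x \<in> H +>\<^bsub>M\<^esub> x" by (rule H.a_rcos_self) fact
  ultimately show ?thesis unfolding quot_map_def by blast
qed

context
  fixes k :: "('k, 'z) ring_scheme" and M :: "('k, 'm, 'y) module_scheme" and H
  assumes M: "module k M" and H: "submodule H k M"
begin

interpretation M: module k M by (rule M)
interpretation H: abelian_subgroup H M by (rule submodule_imp_abelian_subgroup[OF M H])

lemma quotient_add:
  "\<lbrakk>x \<in> carrier M; y \<in> carrier M\<rbrakk> \<Longrightarrow>
    (H +>\<^bsub>M\<^esub> x) \<oplus>\<^bsub>quotient_module M H\<^esub> (H +>\<^bsub>M\<^esub> y) = H +>\<^bsub>M\<^esub> (x \<oplus>\<^bsub>M\<^esub> y)"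
  by (simp add: quotient_module_def H.a_rcos_sum)

lemma quotient_smult:
  assumes "c \<in> carrier k" "x \<in> carrier M"
  shows "c \<odot>\<^bsub>quotient_module M H\<^esub> (H +>\<^bsub>M\<^esub> x) = H +>\<^bsub>M\<^esub> (c \<odot>\<^bsub>M\<^esub> x)"
proof -
  \<comment> \<open>Multiplication by \<open>c\<close> is linear because \<open>k\<close> is
    commutative, and it preserves \<open>H\<close>; the scalar action on the quotient is the map
    that it induces.\<close>
  have "linear k M M (\<lambda>x. c \<odot>\<^bsub>M\<^esub> x)"
    using assms(1)
    by (auto simp: semilinear_def M.smult_r_distr M.smult_assoc1[symmetric] M.R.m_comm)
  from quot_map_coset[OF M H M H this _ assms(2)] show ?thesis
    using assms(1) M.submoduleE(4)[OF H] by (auto simp: quotient_module_def quot_map_def)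
qed

lemma quotient_zero: "\<zero>\<^bsub>quotient_module M H\<^esub> = H +>\<^bsub>M\<^esub> \<zero>\<^bsub>M\<^esub>"
  by (simp add: quotient_module_def H.a_subset)

lemma quotient_coset_eq_iff:
  assumes "x \<in> carrier M" "y \<in> carrier M"
  shows "H +>\<^bsub>M\<^esub> x = H +>\<^bsub>M\<^esub> y \<longleftrightarrow> x \<ominus>\<^bsub>M\<^esub> y \<in> H"
  using assms H.a_rcos_module[of y x] H.a_rcos_self[of x] H.a_repr_independence'[of x y]
  by (auto simp: a_minus_def)

lemma module_quotient: "module k (quotient_module M H)"
proof -
  let ?Q = "quotient_module M H"
  have r: "\<And>X. X \<in> carrier ?Q \<Longrightarrow> \<exists>x\<in>carrier M. X = H +>\<^bsub>M\<^esub> x"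
    by (auto simp: quotient_carrier)
  have c: "\<And>x. x \<in> carrier M \<Longrightarrow> H +>\<^bsub>M\<^esub> x \<in> carrier ?Q" by (auto simp: quotient_carrier)
  note s = quotient_add quotient_smult quotient_zero c
  show ?thesis
  proof (intro moduleI M.R.is_cring abelian_groupI)
    show "\<exists>Y\<in>carrier ?Q. Y \<oplus>\<^bsub>?Q\<^esub> X = \<zero>\<^bsub>?Q\<^esub>" if "X \<in> carrier ?Q" for X
    proof -
      from r[OF that] obtain x where x: "x \<in> carrier M" "X = H +>\<^bsub>M\<^esub> x" by auto
      then show ?thesis by (intro bexI[of _ "H +>\<^bsub>M\<^esub> (\<ominus>\<^bsub>M\<^esub> x)"]) (auto simp: s M.M.l_neg)
    qed
  qed (auto dest!: r simp: s M.M.a_ac M.smult_l_distr M.smult_r_distr M.smult_assoc1)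
qed

end

lemma linear_quot_map:
  assumes "module k M" "submodule H k M" "module k N" "submodule H' k N"
    "linear k M N F" "F ` H \<subseteq> H'"
  shows "linear k (quotient_module M H) (quotient_module N H') (quot_map N H' F)"
proof -
  interpret M: module k M by fact
  note s = quot_map_coset[OF assms] quotient_add[OF assms(1,2)] quotient_add[OF assms(3,4)]
    quotient_smult[OF assms(1,2)] quotient_smult[OF assms(3,4)] semilinearD[OF assms(5)]
  show ?thesis
    unfolding semilinear_def by (auto simp: quotient_carrier s)
qed

text \<open>\<open>F\<close> and \<open>G\<close> are asked to be inverse to each other only up to
  \<open>H\<close> and \<open>H'\<close>. For cycles modulo boundaries this is what a homotopy
  supplies.\<close>

lemma quotient_module_iso:
  assumes M: "module k M" "submodule H k M" and N: "module k N" "submodule H' k N"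
    and F: "linear k M N F" "F ` H \<subseteq> H'"
    and G: "linear k N M G" "G ` H' \<subseteq> H"
    and GF: "\<And>x. x \<in> carrier M \<Longrightarrow> \<exists>h\<in>H. G (F x) = h \<oplus>\<^bsub>M\<^esub> x"
    and FG: "\<And>y. y \<in> carrier N \<Longrightarrow> \<exists>h\<in>H'. F (G y) = h \<oplus>\<^bsub>N\<^esub> y"
  shows "quot_map N H' F \<in> module_isos k (quotient_module M H) (quotient_module N H')"
proof -
  interpret M: module k M by fact
  interpret N: module k N by fact
  interpret H: abelian_subgroup H M by (rule submodule_imp_abelian_subgroup) fact+
  interpret H': abelian_subgroup H' N by (rule submodule_imp_abelian_subgroup) fact+
  note FQ = linear_quot_map[OF M N F] and GQ = linear_quot_map[OF N M G]
  note Fq = quot_map_coset[OF M N F] and Gq = quot_map_coset[OF N M G]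
  have "quot_map M H G (quot_map N H' F X) = X" if "X \<in> carrier (quotient_module M H)" for X
  proof -
    from that obtain x where x: "x \<in> carrier M" "X = H +>\<^bsub>M\<^esub> x" by (auto simp: quotient_carrier)
    then have "G (F x) \<in> H +>\<^bsub>M\<^esub> x" using GF by (auto simp: a_r_coset_def')
    then have "H +>\<^bsub>M\<^esub> G (F x) = H +>\<^bsub>M\<^esub> x" using H.a_repr_independence' x by metis
    then show ?thesis using x by (simp add: Fq Gq semilinearD(1)[OF F(1)])
  qed
  moreover have "quot_map N H' F (quot_map M H G X) = X" if "X \<in> carrier (quotient_module N H')" for X
  proof -
    from that obtain x where x: "x \<in> carrier N" "X = H' +>\<^bsub>N\<^esub> x" by (auto simp: quotient_carrier)
    then have "F (G x) \<in> H' +>\<^bsub>N\<^esub> x" using FG by (auto simp: a_r_coset_def')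
    then have "H' +>\<^bsub>N\<^esub> F (G x) = H' +>\<^bsub>N\<^esub> x" using H'.a_repr_independence' x by metis
    then show ?thesis using x by (simp add: Fq Gq semilinearD(1)[OF G(1)])
  qed
  ultimately have "bij_betw (quot_map N H' F) (carrier (quotient_module M H)) (carrier (quotient_module N H'))"
    using FQ GQ by (intro bij_betw_byWitness[where f' = "quot_map M H G"]) (auto simp: semilinear_def)
  then show ?thesis using FQ by (auto simp: module_isos_def semilinear_def)
qed

section \<open>Homology and homotopy equivalences\<close>

lemma cycles_submodule:
  assumes "\<And>i. module k (C i)" "\<And>i. linear k (C (Suc i)) (C i) (\<delta> i)"
  shows "submodule (cycles C \<delta> i) k (C i)"
proof (cases i)
  case 0
  then show ?thesis using module.carrier_is_submodule[OF assms(1)] by (simp add: cycles_def)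
next
  case (Suc j)
  then show ?thesis using linear_kernel_submodule[OF assms(1) assms(1) assms(2)] by (simp add: cycles_def)
qed

lemma cycles_module:
  assumes E: "\<And>i. module k (E i)" "\<And>i. linear k (E (Suc i)) (E i) (d i)"
      "\<And>i x. x \<in> carrier (E (Suc (Suc i))) \<Longrightarrow> d i (d (Suc i) x) = \<zero>\<^bsub>E i\<^esub>"
  shows "module k (E i\<lparr>carrier := cycles E d i\<rparr>)"
    and "submodule (d i ` carrier (E (Suc i))) k (E i\<lparr>carrier := cycles E d i\<rparr>)"
proof -
  have c: "submodule (cycles E d i) k (E i)" by (rule cycles_submodule) fact+
  show m: "module k (E i\<lparr>carrier := cycles E d i\<rparr>)"
    by (rule submodule.submodule_is_module[OF c E(1)])
  have "linear k (E (Suc i)) (E i\<lparr>carrier := cycles E d i\<rparr>) (d i)"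
    using E(2)[of i] E(3) semilinearD(1)[OF E(2)] by (auto simp: semilinear_def cycles_def split: nat.splits)
  then show "submodule (d i ` carrier (E (Suc i))) k (E i\<lparr>carrier := cycles E d i\<rparr>)"
    by (rule linear_image_submodule[OF E(1) m])
qed

lemma cycles_map:
  assumes E: "\<And>i. module k (E i)"
    and E': "\<And>i. module k (E' i)"
    and h: "\<And>i. linear k (E i) (E' i) (h i)"
      "\<And>i x. x \<in> carrier (E (Suc i)) \<Longrightarrow> h i (d i x) = d' i (h (Suc i) x)"
  shows "linear k (E i\<lparr>carrier := cycles E d i\<rparr>) (E' i\<lparr>carrier := cycles E' d' i\<rparr>) (h i)"
    and "h i ` d i ` carrier (E (Suc i)) \<subseteq> d' i ` carrier (E' (Suc i))"
proof -
  have hz: "h i \<zero>\<^bsub>E i\<^esub> = \<zero>\<^bsub>E' i\<^esub>" for i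
    using E(1)[of i] E'[of i] by (intro semilinear_zero(1)[OF h(1)]) (auto simp: module_def)
  have "h i x \<in> cycles E' d' i" if "x \<in> cycles E d i" for x
  proof (cases i)
    case 0
    then show ?thesis using that semilinearD(1)[OF h(1)] by (auto simp: cycles_def)
  next
    case (Suc j)
    then show ?thesis using that semilinearD(1)[OF h(1)] hz h(2)[of x j]
      by (auto simp: cycles_def)
  qed
  moreover have "cycles E d i \<subseteq> carrier (E i)" by (auto simp: cycles_def split: nat.splits)
  ultimately show "linear k (E i\<lparr>carrier := cycles E d i\<rparr>) (E' i\<lparr>carrier := cycles E' d' i\<rparr>) (h i)"
    using h(1)[of i] by (auto simp: semilinear_def subset_iff)
  show "h i ` d i ` carrier (E (Suc i)) \<subseteq> d' i ` carrier (E' (Suc i))"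
    using h(2) semilinearD(1)[OF h(1)] by fastforce
qed

text \<open>The homotopy hypotheses speak of cycles only: there the summand of a homotopy that
  begins with the differential vanishes, and a single boundary \<open>\<delta> i y\<close>
  remains.\<close>

lemma graded_homology_iso:
  assumes C: "\<And>i. module k (C i)" "\<And>i. linear k (C (Suc i)) (C i) (\<delta> i)"
      "\<And>i x. x \<in> carrier (C (Suc (Suc i))) \<Longrightarrow> \<delta> i (\<delta> (Suc i) x) = \<zero>\<^bsub>C i\<^esub>"
    and D: "\<And>i. module k (D i)" "\<And>i. linear k (D (Suc i)) (D i) (\<delta>' i)"
      "\<And>i x. x \<in> carrier (D (Suc (Suc i))) \<Longrightarrow> \<delta>' i (\<delta>' (Suc i) x) = \<zero>\<^bsub>D i\<^esub>"
    and f: "\<And>i. linear k (C i) (D i) (f i)"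
      "\<And>i x. x \<in> carrier (C (Suc i)) \<Longrightarrow> f i (\<delta> i x) = \<delta>' i (f (Suc i) x)"
    and g: "\<And>i. linear k (D i) (C i) (g i)"
      "\<And>i x. x \<in> carrier (D (Suc i)) \<Longrightarrow> g i (\<delta>' i x) = \<delta> i (g (Suc i) x)"
    and gf: "\<And>i x. x \<in> cycles C \<delta> i \<Longrightarrow> \<exists>y\<in>carrier (C (Suc i)). g i (f i x) = \<delta> i y \<oplus>\<^bsub>C i\<^esub> x"
    and fg: "\<And>i x. x \<in> cycles D \<delta>' i \<Longrightarrow> \<exists>y\<in>carrier (D (Suc i)). f i (g i x) = \<delta>' i y \<oplus>\<^bsub>D i\<^esub> x"
  shows "graded_module_iso k (homology C \<delta>) (homology D \<delta>')"
proof -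
  note ZC = cycles_module[where E = C and d = \<delta>, OF C] and ZD = cycles_module[where E = D and d = \<delta>', OF D]
  note mf = cycles_map[where E = C and d = \<delta> and E' = D and d' = \<delta>' and h = f, OF C(1) D(1) f]
  note mg = cycles_map[where E = D and d = \<delta>' and E' = C and d' = \<delta> and h = g, OF D(1) C(1) g]
  have "\<exists>h. h \<in> module_isos k (homology C \<delta> i) (homology D \<delta>' i)" for i
    unfolding homology_def
    by (rule exI, rule quotient_module_iso[OF ZC ZD mf mg])
      (use gf[of _ i] fg[of _ i] in auto)
  then show ?thesis unfolding graded_module_iso_def by metis
qed

section \<open>Functoriality of tensor products\<close>

lemma (in module) submodule_span_props:
  assumes "X \<subseteq> carrier M"
  shows "submodule (submodule_span R M X) R M" and "X \<subseteq> submodule_span R M X"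
    and "\<And>H. submodule H R M \<Longrightarrow> X \<subseteq> H \<Longrightarrow> submodule_span R M X \<subseteq> H"
proof -
  have c: "submodule_span R M X \<subseteq> carrier M"
    unfolding submodule_span_def using carrier_is_submodule assms by auto
  have z: "\<zero>\<^bsub>M\<^esub> \<in> H" if "submodule H R M" for H
    using additive_subgroup.zero_closed[of H M] that
      submodule_imp_abelian_subgroup[OF module_axioms that] by (simp add: abelian_subgroup_def)
  show "submodule (submodule_span R M X) R M"
    by (rule submoduleI[OF c]) (auto simp: submodule_span_def z submoduleE)
  show "X \<subseteq> submodule_span R M X" by (auto simp: submodule_span_def)
  show "\<And>H. submodule H R M \<Longrightarrow> X \<subseteq> H \<Longrightarrow> submodule_span R M X \<subseteq> H"
    by (auto simp: submodule_span_def)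
qed

lemma module_free: "cring k \<Longrightarrow> module k (free_module k S)"
  by (simp add: module_iff_left_module ring.left_module_free cring.axioms(1))

lemma tensor_relations_intros:
  "\<lbrakk>m \<in> carrier M; m' \<in> carrier M; x \<in> carrier N\<rbrakk> \<Longrightarrow>
    basis_vec k (m \<oplus>\<^bsub>M\<^esub> m', x) \<ominus>\<^bsub>free_module k (carrier M \<times> carrier N)\<^esub>
      (basis_vec k (m, x) \<oplus>\<^bsub>free_module k (carrier M \<times> carrier N)\<^esub> basis_vec k (m', x)) \<in> tensor_relations k A M N"
  "\<lbrakk>m \<in> carrier M; x \<in> carrier N; x' \<in> carrier N\<rbrakk> \<Longrightarrow>
    basis_vec k (m, x \<oplus>\<^bsub>N\<^esub> x') \<ominus>\<^bsub>free_module k (carrier M \<times> carrier N)\<^esub>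
      (basis_vec k (m, x) \<oplus>\<^bsub>free_module k (carrier M \<times> carrier N)\<^esub> basis_vec k (m, x')) \<in> tensor_relations k A M N"
  "\<lbrakk>a \<in> carrier A; m \<in> carrier M; x \<in> carrier N\<rbrakk> \<Longrightarrow>
    basis_vec k (a \<odot>\<^bsub>M\<^esub> m, x) \<ominus>\<^bsub>free_module k (carrier M \<times> carrier N)\<^esub> basis_vec k (m, a \<odot>\<^bsub>N\<^esub> x)
      \<in> tensor_relations k A M N"
  "\<lbrakk>c \<in> carrier k; m \<in> carrier M; x \<in> carrier N\<rbrakk> \<Longrightarrow>
    basis_vec k ((c \<odot>\<^bsub>A\<^esub> \<one>\<^bsub>A\<^esub>) \<odot>\<^bsub>M\<^esub> m, x) \<ominus>\<^bsub>free_module k (carrier M \<times> carrier N)\<^esub>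
      c \<odot>\<^bsub>free_module k (carrier M \<times> carrier N)\<^esub> basis_vec k (m, x) \<in> tensor_relations k A M N"
  unfolding tensor_relations_def Let_def by blast+

text \<open>The right module enters through labels of generators, so closure under its operations is
  what is recorded about \<open>M\<close>. The hypothesis \<open>scalars\<close> keeps the fourth
  family of relations inside the free module.\<close>

locale tensor_factors =
  fixes k :: "('k, 'z) ring_scheme" and A :: "('k, 'a, 'y) module_scheme"
    and M :: "('a, 'm, 'x) module_scheme" and N :: "('a, 'n, 'w) module_scheme"
  assumes k: "cring k"
    and scalars: "\<And>c. c \<in> carrier k \<Longrightarrow> c \<odot>\<^bsub>A\<^esub> \<one>\<^bsub>A\<^esub> \<in> carrier A"
    and M_add: "\<And>m m'. m \<in> carrier M \<Longrightarrow> m' \<in> carrier M \<Longrightarrow> m \<oplus>\<^bsub>M\<^esub> m' \<in> carrier M"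
    and M_smult: "\<And>a m. a \<in> carrier A \<Longrightarrow> m \<in> carrier M \<Longrightarrow> a \<odot>\<^bsub>M\<^esub> m \<in> carrier M"
    and N: "left_module A N"
begin

abbreviation "F \<equiv> free_module k (carrier M \<times> carrier N)"
abbreviation "K \<equiv> tensor_kernel k A M N"

sublocale k: cring k by (rule k)
sublocale N: left_module A N by (rule N)
sublocale F: module k F by (rule module_free[OF k])

lemma F_left_module: "left_module k F"
  using F.module_axioms by (simp add: module_iff_left_module)

lemma relations_closed: "tensor_relations k A M N \<subseteq> carrier F"
proof -
  have b: "basis_vec k (m, x) \<in> carrier F" if "m \<in> carrier M" "x \<in> carrier N" for m x
    using that by (intro k.basis_closed) auto
  show ?thesis
    unfolding tensor_relations_def Let_def
    by (intro Un_least subsetI)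
      (auto simp del: free_simps intro!: F.M.minus_closed F.M.a_closed F.smult_closed b M_add M_smult
        N.smult_closed N.M.a_closed scalars)
qed

lemma kernel_submodule: "submodule K k F"
  unfolding tensor_kernel_def by (rule F.submodule_span_props[OF relations_closed])

lemma relation_in_kernel: "r \<in> tensor_relations k A M N \<Longrightarrow> r \<in> K"
  unfolding tensor_kernel_def using F.submodule_span_props(2)[OF relations_closed] by auto

lemma module_tensor: "module k (tensor_product k A M N)"
  unfolding tensor_product_def by (rule module_quotient[OF F.module_axioms kernel_submodule])

lemma tensor_carrier: "X \<in> carrier (tensor_product k A M N) \<Longrightarrow>
    \<exists>f\<in>carrier F. X = K +>\<^bsub>F\<^esub> f"
  by (auto simp: tensor_product_def quotient_carrier)

end

text \<open>Two modules with the same elements and sums whose actions match along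
  \<open>\<rho>\<close>. The last clause compares the scalars \<open>c 1\<close> of both algebras
  through their actions, as \<open>\<rho>\<close> may be any function; it serves the fourth family
  of tensor relations.\<close>

definition scalar_change ::
  "('k, 'z) ring_scheme \<Rightarrow> ('a \<Rightarrow> 'b) \<Rightarrow> ('k, 'a, 'y) module_scheme \<Rightarrow> ('a, 'm, 'x) module_scheme \<Rightarrow>
     ('k, 'b, 'v) module_scheme \<Rightarrow> ('b, 'm, 'w) module_scheme \<Rightarrow> bool" where
  "scalar_change k \<rho> A M A' M' \<longleftrightarrow>
     \<rho> \<in> carrier A \<rightarrow> carrier A' \<and> carrier M' = carrier M \<and>
     (\<forall>m\<in>carrier M. \<forall>m'\<in>carrier M. m \<oplus>\<^bsub>M'\<^esub> m' = m \<oplus>\<^bsub>M\<^esub> m') \<and>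
     (\<forall>a\<in>carrier A. \<forall>m\<in>carrier M. \<rho> a \<odot>\<^bsub>M'\<^esub> m = a \<odot>\<^bsub>M\<^esub> m) \<and>
     (\<forall>c\<in>carrier k. \<forall>m\<in>carrier M. (c \<odot>\<^bsub>A'\<^esub> \<one>\<^bsub>A'\<^esub>) \<odot>\<^bsub>M'\<^esub> m = (c \<odot>\<^bsub>A\<^esub> \<one>\<^bsub>A\<^esub>) \<odot>\<^bsub>M\<^esub> m)"

text \<open>The lift of \<open>tensor_map\<close> to the free modules on pairs. The first entry of a
  pair is kept, which makes sense between right modules with the same carrier.\<close>

definition push ::
  "('k, 'z) ring_scheme \<Rightarrow> 'm set \<Rightarrow> 'n set \<Rightarrow> ('l \<Rightarrow> 'n) \<Rightarrow> ('m \<times> 'l \<Rightarrow> 'k) \<Rightarrow> 'm \<times> 'n \<Rightarrow> 'k" where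
  "push k M N d = lin_ext k (free_module k (M \<times> N)) (\<lambda>(m, x). basis_vec k (m, d x))"

lemma tensor_map_quot_map:
  "tensor_map k A M N d =
     quot_map (free_module k (carrier M \<times> carrier N)) (tensor_kernel k A M N) (push k (carrier M) (carrier N) d)"
  by (simp add: fun_eq_iff tensor_map_def quot_map_def push_def Let_def)

context
  fixes k :: "('k, 'z) ring_scheme"
  assumes k: "cring k"
begin

interpretation k: cring k by (rule k)

lemma linear_push:
  assumes "d \<in> L \<rightarrow> N"
  shows "linear k (free_module k (M \<times> L)) (free_module k (M \<times> N)) (push k M N d)"
  unfolding push_def using assms
  by (intro left_module.linear_lin_ext k.left_module_free) (auto intro!: k.basis_closed)

lemma push_basis:
  assumes "d x \<in> N" "m \<in> M"
  shows "push k M N d (basis_vec k (m, x)) = basis_vec k (m, d x)"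
  unfolding push_def using assms
  by (subst left_module.lin_ext_basis[OF k.left_module_free]) (auto intro!: k.basis_closed)

text \<open>Each family of relations goes to the same family: sums in \<open>M\<close> and
  \<open>M'\<close> agree, \<open>d\<close> is additive, \<open>d\<close> turns the action of
  \<open>a\<close> into that of \<open>\<rho> a\<close>, which acts on \<open>M'\<close> as
  \<open>a\<close> does on \<open>M\<close>, and the scalars \<open>c 1\<close> act alike. The
  preimage of the target kernel is a submodule that contains the relations, hence it contains their
  span.\<close>

lemma push_kernel:
  assumes "tensor_factors k A M N" "tensor_factors k A' M' N'"
    "scalar_change k \<rho> A M A' M'" "semilinear A \<rho> N N' d"
  shows "push k (carrier M') (carrier N') d ` tensor_kernel k A M N \<subseteq> tensor_kernel k A' M' N'"
proof -
  interpret T: tensor_factors k A M N by fact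
  interpret T': tensor_factors k A' M' N' by fact
  let ?p = "push k (carrier M') (carrier N') d"
  have car: "carrier M' = carrier M" using assms(3) by (simp add: scalar_change_def)
  note d = semilinearD[OF assms(4)]
  have lin: "linear k T.F T'.F ?p"
    using linear_push[of d "carrier N" "carrier N'" "carrier M"] d(1) by (auto simp: car)
  note p = semilinearD(2,3)[OF lin] semilinear_zero(3)[OF lin T.F.M.abelian_group_axioms T'.F.M.abelian_group_axioms]
  have b: "basis_vec k (m, x) \<in> carrier T.F" if "m \<in> carrier M" "x \<in> carrier N" for m x
    using that by (intro k.basis_closed) auto
  have pb: "?p (basis_vec k (m, x)) = basis_vec k (m, d x)" if "m \<in> carrier M" "x \<in> carrier N" for m x
    using that d(1) by (intro push_basis) (auto simp: car)
  have eq: "m \<oplus>\<^bsub>M'\<^esub> m' = m \<oplus>\<^bsub>M\<^esub> m'" if "m \<in> carrier M" "m' \<in> carrier M" for m m'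
    using that assms(3) by (simp add: scalar_change_def)
  have eq2: "\<rho> a \<odot>\<^bsub>M'\<^esub> m = a \<odot>\<^bsub>M\<^esub> m" "\<rho> a \<in> carrier A'" if "a \<in> carrier A" "m \<in> carrier M" for a m
    using that assms(3) by (auto simp: scalar_change_def)
  have eq3: "(c \<odot>\<^bsub>A\<^esub> \<one>\<^bsub>A\<^esub>) \<odot>\<^bsub>M\<^esub> m = (c \<odot>\<^bsub>A'\<^esub> \<one>\<^bsub>A'\<^esub>) \<odot>\<^bsub>M'\<^esub> m" if "c \<in> carrier k" "m \<in> carrier M" for c m
    using that assms(3) by (auto simp: scalar_change_def)
  have "?p r \<in> tensor_relations k A' M' N'" if "r \<in> tensor_relations k A M N" for r
    using that[unfolded tensor_relations_def Let_def]
  proof (elim UnE)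
    assume "r \<in> {basis_vec k (m \<oplus>\<^bsub>M\<^esub> m', x) \<ominus>\<^bsub>T.F\<^esub> (basis_vec k (m, x) \<oplus>\<^bsub>T.F\<^esub> basis_vec k (m', x)) | m m' x.
        m \<in> carrier M \<and> m' \<in> carrier M \<and> x \<in> carrier N}"
    then obtain m m' x where r: "r = basis_vec k (m \<oplus>\<^bsub>M\<^esub> m', x) \<ominus>\<^bsub>T.F\<^esub> (basis_vec k (m, x) \<oplus>\<^bsub>T.F\<^esub> basis_vec k (m', x))"
      "m \<in> carrier M" "m' \<in> carrier M" "x \<in> carrier N" by blast
    from r have "?p r = basis_vec k (m \<oplus>\<^bsub>M'\<^esub> m', d x) \<ominus>\<^bsub>T'.F\<^esub> (basis_vec k (m, d x) \<oplus>\<^bsub>T'.F\<^esub> basis_vec k (m', d x))"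
      by (simp add: p pb b eq T.M_add del: free_simps)
    also have "\<dots> \<in> tensor_relations k A' M' N'"
      by (rule tensor_relations_intros(1)) (use r(2-) d(1) eq2(2) in \<open>auto simp: car\<close>)
    finally show ?thesis .
  next
    assume "r \<in> {basis_vec k (m, x \<oplus>\<^bsub>N\<^esub> x') \<ominus>\<^bsub>T.F\<^esub> (basis_vec k (m, x) \<oplus>\<^bsub>T.F\<^esub> basis_vec k (m, x')) | m x x'.
        m \<in> carrier M \<and> x \<in> carrier N \<and> x' \<in> carrier N}"
    then obtain m x x' where r: "r = basis_vec k (m, x \<oplus>\<^bsub>N\<^esub> x') \<ominus>\<^bsub>T.F\<^esub> (basis_vec k (m, x) \<oplus>\<^bsub>T.F\<^esub> basis_vec k (m, x'))"
      "m \<in> carrier M" "x \<in> carrier N" "x' \<in> carrier N" by blast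
    from r have "?p r = basis_vec k (m, d x \<oplus>\<^bsub>N'\<^esub> d x') \<ominus>\<^bsub>T'.F\<^esub> (basis_vec k (m, d x) \<oplus>\<^bsub>T'.F\<^esub> basis_vec k (m, d x'))"
      by (simp add: p pb b d(2) del: free_simps)
    also have "\<dots> \<in> tensor_relations k A' M' N'"
      by (rule tensor_relations_intros(2)) (use r(2-) d(1) eq2(2) in \<open>auto simp: car\<close>)
    finally show ?thesis .
  next
    assume "r \<in> {basis_vec k (a \<odot>\<^bsub>M\<^esub> m, x) \<ominus>\<^bsub>T.F\<^esub> basis_vec k (m, a \<odot>\<^bsub>N\<^esub> x) | a m x.
        a \<in> carrier A \<and> m \<in> carrier M \<and> x \<in> carrier N}"
    then obtain a m x where r: "r = basis_vec k (a \<odot>\<^bsub>M\<^esub> m, x) \<ominus>\<^bsub>T.F\<^esub> basis_vec k (m, a \<odot>\<^bsub>N\<^esub> x)"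
      "a \<in> carrier A" "m \<in> carrier M" "x \<in> carrier N" by blast
    from r have "?p r = basis_vec k (\<rho> a \<odot>\<^bsub>M'\<^esub> m, d x) \<ominus>\<^bsub>T'.F\<^esub> basis_vec k (m, \<rho> a \<odot>\<^bsub>N'\<^esub> d x)"
      by (simp add: p pb b d(3) eq2 T.M_smult del: free_simps)
    also have "\<dots> \<in> tensor_relations k A' M' N'"
      by (rule tensor_relations_intros(3)) (use r(2-) d(1) eq2(2) in \<open>auto simp: car\<close>)
    finally show ?thesis .
  next
    assume "r \<in> {basis_vec k ((c \<odot>\<^bsub>A\<^esub> \<one>\<^bsub>A\<^esub>) \<odot>\<^bsub>M\<^esub> m, x) \<ominus>\<^bsub>T.F\<^esub> c \<odot>\<^bsub>T.F\<^esub> basis_vec k (m, x) | c m x.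
        c \<in> carrier k \<and> m \<in> carrier M \<and> x \<in> carrier N}"
    then obtain c m x where r: "r = basis_vec k ((c \<odot>\<^bsub>A\<^esub> \<one>\<^bsub>A\<^esub>) \<odot>\<^bsub>M\<^esub> m, x) \<ominus>\<^bsub>T.F\<^esub> c \<odot>\<^bsub>T.F\<^esub> basis_vec k (m, x)"
      "c \<in> carrier k" "m \<in> carrier M" "x \<in> carrier N" by blast
    from r have "?p r = basis_vec k ((c \<odot>\<^bsub>A'\<^esub> \<one>\<^bsub>A'\<^esub>) \<odot>\<^bsub>M'\<^esub> m, d x) \<ominus>\<^bsub>T'.F\<^esub> c \<odot>\<^bsub>T'.F\<^esub> basis_vec k (m, d x)"
      by (simp add: p pb b eq3[symmetric] T.M_smult T.scalars del: free_simps)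
    also have "\<dots> \<in> tensor_relations k A' M' N'"
      by (rule tensor_relations_intros(4)) (use r(2-) d(1) eq2(2) in \<open>auto simp: car\<close>)
    finally show ?thesis .
  qed
  then have "tensor_relations k A M N \<subseteq> {f \<in> carrier T.F. ?p f \<in> T'.K}"
    using T'.relation_in_kernel T.relations_closed by auto
  from T.F.submodule_span_props(3)[OF T.relations_closed
      linear_vimage_submodule[OF T.F.module_axioms T'.F.module_axioms lin T'.kernel_submodule] this]
  show ?thesis unfolding tensor_kernel_def[of k A M N] by auto
qed

context
  fixes A :: "('k, 'a, 'y) module_scheme" and M :: "('a, 'm, 'x) module_scheme" and N :: "('a, 'n, 'w) module_scheme"
    and A' :: "('k, 'b, 't) module_scheme" and M' :: "('b, 'm, 'u) module_scheme" and N' :: "('b, 'l, 'v) module_scheme"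
    and \<rho>
  assumes T: "tensor_factors k A M N" and T': "tensor_factors k A' M' N'"
    and \<rho>: "scalar_change k \<rho> A M A' M'"
begin

interpretation T: tensor_factors k A M N by (rule T)
interpretation T': tensor_factors k A' M' N' by (rule T')

lemma linear_push': "semilinear A \<rho> N N' d \<Longrightarrow> linear k T.F T'.F (push k (carrier M') (carrier N') d)"
  using linear_push[of d "carrier N" "carrier N'" "carrier M"] \<rho>
  by (simp add: semilinear_def scalar_change_def)

lemma tensor_map_coset:
  assumes d: "semilinear A \<rho> N N' d" and "f \<in> carrier T.F"
  shows "tensor_map k A' M' N' d (T.K +>\<^bsub>T.F\<^esub> f) = T'.K +>\<^bsub>T'.F\<^esub> push k (carrier M') (carrier N') d f"
  unfolding tensor_map_quot_map
  by (intro quot_map_coset[OF T.F.module_axioms T.kernel_submodule T'.F.module_axioms T'.kernel_submodule]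
      linear_push' push_kernel[OF T T' \<rho>] assms)

lemma linear_tensor_map:
  assumes d: "semilinear A \<rho> N N' d"
  shows "linear k (tensor_product k A M N) (tensor_product k A' M' N') (tensor_map k A' M' N' d)"
  unfolding tensor_map_quot_map tensor_product_def
  by (intro linear_quot_map[OF T.F.module_axioms T.kernel_submodule T'.F.module_axioms T'.kernel_submodule]
      linear_push' push_kernel[OF T T' \<rho>] assms)

text \<open>On the free modules \<open>push\<close> is not additive in the map: on a pair the two
  sides differ by a relation of the second family. Their difference is linear, so it takes values in
  the kernel everywhere.\<close>

lemma tensor_map_add:
  assumes d: "semilinear A \<rho> N N' d" and e: "semilinear A \<rho> N N' e"
    and X: "X \<in> carrier (tensor_product k A M N)"
  shows "tensor_map k A' M' N' (\<lambda>x. d x \<oplus>\<^bsub>N'\<^esub> e x) X =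
    tensor_map k A' M' N' d X \<oplus>\<^bsub>tensor_product k A' M' N'\<^esub> tensor_map k A' M' N' e X"
proof -
  have car: "carrier M' = carrier M" and \<rho>c: "\<rho> \<in> carrier A \<rightarrow> carrier A'"
    using \<rho> by (simp_all add: scalar_change_def)
  have s: "semilinear A \<rho> N N' (\<lambda>x. d x \<oplus>\<^bsub>N'\<^esub> e x)"
    using semilinear_add[OF d e T'.N \<rho>c] .
  let ?p = "push k (carrier M') (carrier N')"
  let ?q = "\<lambda>f. ?p (\<lambda>x. d x \<oplus>\<^bsub>N'\<^esub> e x) f \<ominus>\<^bsub>T'.F\<^esub> (?p d f \<oplus>\<^bsub>T'.F\<^esub> ?p e f)"
  have sum: "linear k T.F T'.F (\<lambda>f. ?p d f \<oplus>\<^bsub>T'.F\<^esub> ?p e f)"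
    by (rule semilinear_add[OF linear_push'[OF d] linear_push'[OF e] T'.F_left_module]) simp
  have lin: "linear k T.F T'.F ?q"
    by (rule semilinear_diff[OF linear_push'[OF s] sum T'.F_left_module]) simp
  have "?q f \<in> T'.K" if "f \<in> carrier T.F" for f
    using that
  proof (induct rule: k.free_induct)
    case zero
    show ?case
      using semilinear_zero(1)[OF lin T.F.M.abelian_group_axioms T'.F.M.abelian_group_axioms]
        subgroup.one_closed[OF submodule.axioms(1)[OF T'.kernel_submodule]] by (simp del: free_simps)
  next
    case (basis s)
    then obtain m x where s: "s = (m, x)" "m \<in> carrier M" "x \<in> carrier N" by auto
    then have "?q (basis_vec k s) = basis_vec k (m, d x \<oplus>\<^bsub>N'\<^esub> e x) \<ominus>\<^bsub>T'.F\<^esub>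
        (basis_vec k (m, d x) \<oplus>\<^bsub>T'.F\<^esub> basis_vec k (m, e x))"
      using semilinearD(1)[OF d] semilinearD(1)[OF e]
      by (simp add: push_basis car T'.N.M.a_closed del: free_simps)
    also have "\<dots> \<in> tensor_relations k A' M' N'"
      by (rule tensor_relations_intros(2)) (use s semilinearD(1)[OF d] semilinearD(1)[OF e] in \<open>auto simp: car\<close>)
    finally show ?case by (rule T'.relation_in_kernel)
  next
    case (add f g)
    then show ?case
      using T'.F.submoduleE(5)[OF T'.kernel_submodule] semilinearD(2)[OF lin, of f g] by (simp del: free_simps)
  next
    case (smult a f)
    then show ?case
      using T'.F.submoduleE(4)[OF T'.kernel_submodule] semilinearD(3)[OF lin, of a f] by (simp del: free_simps)
  qed
  then have *: "T'.K +>\<^bsub>T'.F\<^esub> ?p (\<lambda>x. d x \<oplus>\<^bsub>N'\<^esub> e x) f = T'.K +>\<^bsub>T'.F\<^esub> (?p d f \<oplus>\<^bsub>T'.F\<^esub> ?p e f)"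
    if "f \<in> carrier T.F" for f
    using that quotient_coset_eq_iff[OF T'.F.module_axioms T'.kernel_submodule
        semilinearD(1)[OF linear_push'[OF s]] semilinearD(1)[OF sum], of f f] by (simp del: free_simps)
  obtain f where f: "f \<in> carrier T.F" "X = T.K +>\<^bsub>T.F\<^esub> f"
    using T.tensor_carrier[OF X] by auto
  show ?thesis
    unfolding f(2) tensor_map_coset[OF s f(1)] tensor_map_coset[OF d f(1)] tensor_map_coset[OF e f(1)] *[OF f(1)]
      tensor_product_def
    by (intro quotient_add[symmetric, OF T'.F.module_axioms T'.kernel_submodule]
        semilinearD(1)[OF linear_push'] d e f)
qed

text \<open>Identities between chain maps hold on carriers and not as equalities of functions, so
  replacing one map by another inside \<open>tensor_map\<close> needs an argument.\<close>

lemma tensor_map_cong: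
  assumes d: "semilinear A \<rho> N N' d" and e: "\<And>x. x \<in> carrier N \<Longrightarrow> e x = d x"
    and X: "X \<in> carrier (tensor_product k A M N)"
  shows "tensor_map k A' M' N' e X = tensor_map k A' M' N' d X"
proof -
  have e': "semilinear A \<rho> N N' e" using d e by (auto simp: semilinear_def)
  have "push k (carrier M') (carrier N') e f = push k (carrier M') (carrier N') d f"
    if "f \<in> carrier T.F" for f
    by (rule semilinear_free_eqI[OF k.ring_axioms T'.F.M.abelian_group_axioms linear_push'[OF e'] linear_push'[OF d] _ that])
      (use d \<rho> in \<open>auto simp: e push_basis semilinearD(1)[OF d] scalar_change_def\<close>)
  then show ?thesis using T.tensor_carrier[OF X] d e' by (auto simp: tensor_map_coset)
qed

end

lemma scalar_change_id: "scalar_change k (\<lambda>a. a) A M A M"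
  by (simp add: scalar_change_def)

lemma tensor_map_id:
  assumes "tensor_factors k A M N" "X \<in> carrier (tensor_product k A M N)"
  shows "tensor_map k A M N (\<lambda>x. x) X = X"
proof -
  interpret T: tensor_factors k A M N by fact
  note * = assms(1,1) scalar_change_id
  have "push k (carrier M) (carrier N) (\<lambda>x. x) f = f" if "f \<in> carrier T.F" for f
    by (rule semilinear_free_eqI[OF k.ring_axioms T.F.M.abelian_group_axioms linear_push'[OF * linear_id] linear_id _ that])
      (auto simp: push_basis)
  then show ?thesis using T.tensor_carrier[OF assms(2)] by (auto simp: tensor_map_coset[OF * linear_id])
qed

lemma tensor_map_comp:
  assumes T: "tensor_factors k A M N" "tensor_factors k A' M' N'" "tensor_factors k A'' M'' N''"
    and \<rho>: "scalar_change k \<rho> A M A' M'" and \<rho>': "scalar_change k \<rho>' A' M' A'' M''"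
    and d: "semilinear A \<rho> N N' d" and e: "semilinear A' \<rho>' N' N'' e"
    and X: "X \<in> carrier (tensor_product k A M N)"
  shows "tensor_map k A'' M'' N'' e (tensor_map k A' M' N' d X) = tensor_map k A'' M'' N'' (\<lambda>x. e (d x)) X"
proof -
  interpret T: tensor_factors k A M N by fact
  interpret T': tensor_factors k A' M' N' by fact
  interpret T'': tensor_factors k A'' M'' N'' by fact
  have \<rho>'': "scalar_change k (\<lambda>a. \<rho>' (\<rho> a)) A M A'' M''"
    using \<rho> \<rho>' by (auto simp: scalar_change_def Pi_iff)
  have ed: "semilinear A (\<lambda>a. \<rho>' (\<rho> a)) N N'' (\<lambda>x. e (d x))"
    using semilinear_comp[OF d e] \<rho> by (simp add: scalar_change_def)
  note pd = linear_push'[OF T(1,2) \<rho> d] and pe = linear_push'[OF T(2,3) \<rho>' e]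
    and ped = linear_push'[OF T(1,3) \<rho>'' ed]
  have "push k (carrier M'') (carrier N'') e (push k (carrier M') (carrier N') d f) =
      push k (carrier M'') (carrier N'') (\<lambda>x. e (d x)) f" if "f \<in> carrier T.F" for f
    by (rule semilinear_free_eqI[OF k.ring_axioms T''.F.M.abelian_group_axioms semilinear_comp[OF pd pe] ped _ that])
      (use \<rho> \<rho>' in \<open>auto simp: push_basis scalar_change_def semilinearD(1)[OF d] semilinearD(1)[OF e]\<close>)
  then show ?thesis
    using T.tensor_carrier[OF X] semilinearD(1)[OF pd]
    by (auto simp: tensor_map_coset[OF T(1,2) \<rho> d] tensor_map_coset[OF T(2,3) \<rho>' e]
        tensor_map_coset[OF T(1,3) \<rho>'' ed])
qed

end

section \<open>Semilinear chain maps between canonical resolutions\<close>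

lemma linear_combination_closed:
  assumes "ring A" "set l \<subseteq> carrier A \<times> S"
  shows "linear_combination A l \<in> carrier (free_module A S)"
  using assms(2)
proof (induct l)
  case Nil
  interpret F: left_module A "free_module A S" by (rule ring.left_module_free) fact
  show ?case using F.M.zero_closed by simp
next
  case (Cons p l)
  interpret F: left_module A "free_module A S" by (rule ring.left_module_free) fact
  obtain a s where p: "p = (a, s)" by (cases p)
  have "(a \<odot>\<^bsub>free_module A S\<^esub> basis_vec A s) \<oplus>\<^bsub>free_module A S\<^esub> linear_combination A l \<in> carrier (free_module A S)"
    using Cons p by (intro F.M.a_closed F.smult_closed F.R.basis_closed) auto
  then show ?case by (simp add: p)
qed

lemma linear_combination_Cons:
  "linear_combination A ((a, s) # l) =
     (a \<odot>\<^bsub>free_module A S\<^esub> basis_vec A s) \<oplus>\<^bsub>free_module A S\<^esub> linear_combination A l"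
  by simp

lemma linear_combination_Nil: "linear_combination A [] = \<zero>\<^bsub>free_module A S\<^esub>"
  by simp

text \<open>Cells store lists in which a basis element may occur several times. Evaluating along the
  list avoids collecting its coefficients and permits induction over \<open>l\<close>.\<close>

lemma semilinear_combination:
  assumes A: "ring A" and N: "left_module A' N" and F: "semilinear A \<rho> (free_module A S) N F"
    and l: "set l \<subseteq> carrier A \<times> S"
  shows "F (linear_combination A l) = foldr (\<lambda>(a, s) y. \<rho> a \<odot>\<^bsub>N\<^esub> F (basis_vec A s) \<oplus>\<^bsub>N\<^esub> y) l \<zero>\<^bsub>N\<^esub>"
  using l
proof (induct l)
  case Nil
  interpret F: left_module A "free_module A S" by (rule ring.left_module_free) fact
  interpret N: left_module A' N by fact
  show ?case
    using semilinear_zero(1)[OF F F.M.abelian_group_axioms N.M.abelian_group_axioms] by simp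
next
  case (Cons p l)
  interpret F: left_module A "free_module A S" by (rule ring.left_module_free) fact
  obtain a s where p: "p = (a, s)" by (cases p)
  have as: "a \<in> carrier A" "s \<in> S" "set l \<subseteq> carrier A \<times> S" using Cons(2) p by auto
  have L: "linear_combination A l \<in> carrier (free_module A S)"
    by (rule linear_combination_closed[OF A as(3)])
  show ?case
    unfolding p linear_combination_Cons[of A a s l S]
    using semilinearD(2)[OF F F.smult_closed[OF as(1) F.R.basis_closed[OF as(2)]] L]
      semilinearD(3)[OF F as(1) F.R.basis_closed[OF as(2)]] Cons(1)[OF as(3)]
    by simp
qed

section \<open>The canonical resolution as a complex of free modules\<close>

locale resolved_module = left_module A N
  for A :: "('a, 'c) ring_scheme" and N :: "('a, 'n, 'd) module_scheme"
begin

abbreviation "cells \<equiv> resolution_cells A N"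
abbreviation "P \<equiv> resolution A N"
abbreviation "d \<equiv> resolution_map A N"
abbreviation "aug \<equiv> lin_ext A N cell_augmentation"

text \<open>Treats the augmentation as the differential that leaves degree 0. The separate clauses
  of \<open>resolution_cells\<close> for degree 1 and for higher degrees then merge into
  \<open>cells_Suc\<close>.\<close>

definition cyc :: "nat \<Rightarrow> (('a, 'n) cell \<Rightarrow> 'a) \<Rightarrow> bool" where
  "cyc i p \<longleftrightarrow> (case i of 0 \<Rightarrow> aug p = \<zero>\<^bsub>N\<^esub> | Suc j \<Rightarrow> d j p = \<zero>\<^bsub>P j\<^esub>)"

lemma P_free: "P i = free_module A (cells i)"
  by (simp add: resolution_def)

lemma left_module_P: "left_module A (P i)"
  unfolding P_free by (rule R.left_module_free)

sublocale P: left_module A "P i" for i by (rule left_module_P)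

lemma cells_Suc: "cells (Suc i) = {Syz l | l. set l \<subseteq> carrier A \<times> cells i \<and> cyc i (linear_combination A l)}"
  by (cases i) (simp_all add: cyc_def resolution_map_def P_free)

lemma P_eqI:
  assumes "abelian_group X" "semilinear A \<rho> (P i) X F" "semilinear A \<rho> (P i) X G"
    and "\<And>s. s \<in> cells i \<Longrightarrow> F (basis_vec A s) = G (basis_vec A s)" and "p \<in> carrier (P i)"
  shows "F p = G p"
  using semilinear_free_eqI[OF R.ring_axioms, of X \<rho> "cells i" F G p] assms unfolding P_free by blast

lemma boundary_closed: "s \<in> cells (Suc i) \<Longrightarrow> cell_boundary A s \<in> carrier (P i)"
  unfolding cells_Suc P_free using linear_combination_closed[OF R.ring_axioms] by auto

lemma basis_P: "s \<in> cells i \<Longrightarrow> basis_vec A s \<in> carrier (P i)"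
  unfolding P_free by (rule R.basis_closed)

lemma linear_d: "linear A (P (Suc i)) (P i) (d i)"
  unfolding resolution_map_def P_free[of "Suc i"]
  by (intro P.linear_lin_ext) (auto simp: boundary_closed)

lemma d_basis: "s \<in> cells (Suc i) \<Longrightarrow> d i (basis_vec A s) = cell_boundary A s"
  unfolding resolution_map_def by (intro P.lin_ext_basis boundary_closed)

lemma linear_aug: "linear A (P 0) N aug"
  unfolding P_free by (intro linear_lin_ext) auto

lemma aug_basis: "x \<in> carrier N \<Longrightarrow> aug (basis_vec A (Gen x)) = x"
  by (subst lin_ext_basis) auto

text \<open>Built into the basis: \<open>Syz l\<close> is a cell only if the combination presented
  by \<open>l\<close> is a cycle.\<close>

lemma d_d:
  assumes "p \<in> carrier (P (Suc (Suc i)))"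
  shows "d i (d (Suc i) p) = \<zero>\<^bsub>P i\<^esub>"
proof -
  have z: "linear A (P (Suc (Suc i))) (P i) (\<lambda>_. \<zero>\<^bsub>P i\<^esub>)"
    by (auto simp: semilinear_def)
  have "d i (d (Suc i) (basis_vec A s)) = \<zero>\<^bsub>P i\<^esub>" if s: "s \<in> cells (Suc (Suc i))" for s
  proof -
    obtain l where "s = Syz l" "cyc (Suc i) (linear_combination A l)"
      using s unfolding cells_Suc[of "Suc i"] by blast
    then show ?thesis using d_basis[OF s] by (simp add: cyc_def)
  qed
  moreover have "linear A (P (Suc (Suc i))) (P i) (\<lambda>p. d i (d (Suc i) p))"
    by (rule semilinear_comp[OF linear_d linear_d]) simp
  ultimately show ?thesis
    using P_eqI[OF P.M.abelian_group_axioms _ z _ assms] by blast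
qed

end

text \<open>The nested \<open>map\<close> is the shape of primitive recursion through lists of
  pairs; \<open>cell_map_Syz\<close> is the working form. The factor \<open>e\<close> in the
  coefficients is forced: the chain map \<open>F\<close> below sends a basis cell to
  \<open>e\<close> times its image, so these are the coefficients in the image of a
  boundary.\<close>

primrec cell_map :: "('b, 'z) ring_scheme \<Rightarrow> ('a \<Rightarrow> 'b) \<Rightarrow> 'b \<Rightarrow> ('a, 'n) cell \<Rightarrow> ('b, 'n) cell" where
  "cell_map R \<rho> e (Gen x) = Gen x"
| "cell_map R \<rho> e (Syz l) = Syz (map (\<lambda>(a, t). (e \<otimes>\<^bsub>R\<^esub> \<rho> a, t)) (map (map_prod id (cell_map R \<rho> e)) l))"

lemma cell_map_Syz:
  "cell_map R \<rho> e (Syz l) = Syz (map (\<lambda>(a, s). (e \<otimes>\<^bsub>R\<^esub> \<rho> a, cell_map R \<rho> e s)) l)"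
  by (simp add: case_prod_unfold map_prod_def)

declare cell_map.simps(2) [simp del]

text \<open>Used three times: along \<open>\<pi>\<close> with the unit of \<open>B\<close>, along
  \<open>\<iota>\<close> with the idempotent \<open>e\<close>, and along the identity of
  \<open>A\<close> with \<open>e\<close>, which describes the round trip. By \<open>same\<close> the
  elements of \<open>N\<close> are elements of \<open>N'\<close> with matching operations, so
  generators \<open>Gen x\<close> can be kept.\<close>

locale twist = A: resolved_module A N + A': resolved_module A' N'
  for A :: "('a, 'c) ring_scheme" and N :: "('a, 'n, 'd) module_scheme"
    and A' :: "('b, 'u) ring_scheme" and N' :: "('b, 'n, 'v) module_scheme" +
  fixes \<rho> :: "'a \<Rightarrow> 'b" and e :: 'b
  assumes \<rho>: "\<rho> \<in> ring_hom A A'" and e: "e \<in> carrier A'" and ee: "e \<otimes>\<^bsub>A'\<^esub> e = e"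
    and comm: "\<And>a. a \<in> carrier A \<Longrightarrow> e \<otimes>\<^bsub>A'\<^esub> \<rho> a = \<rho> a \<otimes>\<^bsub>A'\<^esub> e"
    and same: "semilinear A \<rho> N N' (\<lambda>x. x)"
    and e_N: "\<And>x. x \<in> carrier N' \<Longrightarrow> e \<odot>\<^bsub>N'\<^esub> x = x"
begin

abbreviation "c \<equiv> cell_map A' \<rho> e"

text \<open>The factor \<open>e\<close> puts the image into the part fixed by \<open>e\<close>.
  There, scalars with the same multiple by \<open>e\<close> act alike, on which \<open>qp_F\<close>
  rests.\<close>

definition F :: "nat \<Rightarrow> (('a, 'n) cell \<Rightarrow> 'a) \<Rightarrow> ('b, 'n) cell \<Rightarrow> 'b" where
  "F i = semi_ext A' (A'.P i) \<rho> (\<lambda>s. e \<odot>\<^bsub>A'.P i\<^esub> basis_vec A' (c s))"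

lemma \<rho>_closed: "a \<in> carrier A \<Longrightarrow> \<rho> a \<in> carrier A'"
  using \<rho> by (rule ring_hom_closed)

text \<open>The inclusion of cells is a hypothesis because it is proved together with the
  preservation of cycles in \<open>cells_cyc\<close>. The third claim comes from \<open>e\<close>
  being idempotent and commuting with the image of \<open>\<rho>\<close>. By the fourth, changing
  the coefficients of a list presents the image under \<open>F\<close>, so boundaries of image cells
  are images of boundaries.\<close>

lemma F_facts:
  assumes c: "c ` A.cells i \<subseteq> A'.cells i"
  shows "semilinear A \<rho> (A.P i) (A'.P i) (F i)"
    and "\<And>s. s \<in> A.cells i \<Longrightarrow> F i (basis_vec A s) = e \<odot>\<^bsub>A'.P i\<^esub> basis_vec A' (c s)"
    and "\<And>p. p \<in> carrier (A.P i) \<Longrightarrow> e \<odot>\<^bsub>A'.P i\<^esub> F i p = F i p"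
    and "\<And>l. set l \<subseteq> carrier A \<times> A.cells i \<Longrightarrow>
      linear_combination A' (map (\<lambda>(a, s). (e \<otimes>\<^bsub>A'\<^esub> \<rho> a, c s)) l) = F i (linear_combination A l)"
proof -
  have v: "e \<odot>\<^bsub>A'.P i\<^esub> basis_vec A' (c s) \<in> carrier (A'.P i)" if "s \<in> A.cells i" for s
    using c that e by (intro A'.P.smult_closed A'.basis_P) auto
  show F: "semilinear A \<rho> (A.P i) (A'.P i) (F i)"
    unfolding F_def A.P_free
    by (intro semilinear_semi_ext[OF \<rho> A.R.ring_axioms A'.left_module_P]) (auto intro: v)
  show Fb: "F i (basis_vec A s) = e \<odot>\<^bsub>A'.P i\<^esub> basis_vec A' (c s)" if "s \<in> A.cells i" for s
    unfolding F_def
    by (rule semi_ext_basis[where v = "\<lambda>s. e \<odot>\<^bsub>A'.P i\<^esub> basis_vec A' (c s)", OF \<rho> A.R.ring_axioms A'.left_module_P v[OF that]])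
  have eF: "semilinear A \<rho> (A.P i) (A'.P i) (\<lambda>p. e \<odot>\<^bsub>A'.P i\<^esub> F i p)"
    using F e comm by (auto simp: semilinear_def Pi_iff A'.P.smult_r_distr A'.P.smult_assoc1[symmetric] \<rho>_closed)
  have eFb: "e \<odot>\<^bsub>A'.P i\<^esub> F i (basis_vec A s) = F i (basis_vec A s)" if "s \<in> A.cells i" for s
    using c that e by (subst (1 2) Fb) (auto simp: A'.P.smult_assoc1[symmetric] ee A'.basis_P)
  show "e \<odot>\<^bsub>A'.P i\<^esub> F i p = F i p" if "p \<in> carrier (A.P i)" for p
    by (rule semilinear_free_eqI[OF A.R.ring_axioms A'.P.M.abelian_group_axioms
          eF[unfolded A.P_free] F[unfolded A.P_free] eFb])
      (use that in \<open>auto simp: A.P_free\<close>)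
  show "linear_combination A' (map (\<lambda>(a, s). (e \<otimes>\<^bsub>A'\<^esub> \<rho> a, c s)) l) = F i (linear_combination A l)"
    if "set l \<subseteq> carrier A \<times> A.cells i" for l
    unfolding semilinear_combination[OF A.R.ring_axioms A'.left_module_P F[unfolded A.P_free] that]
    using that
  proof (induct l)
    case Nil
    then show ?case by (simp add: A'.P_free)
  next
    case (Cons p l)
    obtain a s where p: "p = (a, s)" by (cases p)
    have as: "a \<in> carrier A" "s \<in> A.cells i" "c s \<in> A'.cells i" using Cons(2) p c by auto
    have "(e \<otimes>\<^bsub>A'\<^esub> \<rho> a) \<odot>\<^bsub>A'.P i\<^esub> basis_vec A' (c s) = \<rho> a \<odot>\<^bsub>A'.P i\<^esub> F i (basis_vec A s)"
      using as e by (simp add: comm Fb A'.P.smult_assoc1 \<rho>_closed A'.basis_P)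
    then show ?case
      using Cons p by (simp add: A'.P_free del: free_simps add: linear_combination_Cons[of A' _ _ _ "A'.cells i"] del: linear_combination.simps)
  qed
qed

text \<open>Generators keep their names under \<open>c\<close>, and the factor \<open>e\<close> acts
  on \<open>N'\<close> as the identity.\<close>

lemma F_aug:
  assumes c: "c ` A.cells 0 \<subseteq> A'.cells 0" and p: "p \<in> carrier (A.P 0)"
  shows "A'.aug (F 0 p) = A.aug p"
proof -
  have s1: "semilinear A \<rho> (A.P 0) N' (\<lambda>p. A'.aug (F 0 p))"
    by (rule semilinear_comp[OF F_facts(1)[OF c] A'.linear_aug]) (auto intro: \<rho>_closed)
  have s2: "semilinear A \<rho> (A.P 0) N' A.aug"
    by (rule semilinear_comp[OF A.linear_aug same]) auto
  show ?thesis
  proof (rule semilinear_free_eqI[OF A.R.ring_axioms A'.M.abelian_group_axioms s1[unfolded A.P_free] s2[unfolded A.P_free]])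
    fix s assume s: "s \<in> A.cells 0"
    then obtain x where x: "s = Gen x" "x \<in> carrier N" by auto
    then have x': "x \<in> carrier N'" using semilinearD(1)[OF same] by auto
    then have "basis_vec A' (Gen x) \<in> carrier (A'.P 0)" by (intro A'.basis_P) auto
    then show "A'.aug (F 0 (basis_vec A s)) = A.aug (basis_vec A s)"
      using s x x' semilinearD(3)[OF A'.linear_aug e]
      by (simp add: F_facts(2)[OF c] A'.aug_basis A.aug_basis e_N)
  qed (use p A.P_free in auto)
qed

text \<open>On a cell the left side is \<open>e\<close> times the boundary of the image cell, and
  that boundary is the image under \<open>F\<close> of the original boundary. The additional
  \<open>e\<close> is absorbed since it fixes the values of \<open>F\<close>.\<close>

lemma F_chain':
  assumes c0: "c ` A.cells i \<subseteq> A'.cells i" and c1: "c ` A.cells (Suc i) \<subseteq> A'.cells (Suc i)"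
    and p: "p \<in> carrier (A.P (Suc i))"
  shows "A'.d i (F (Suc i) p) = F i (A.d i p)"
proof -
  have s1: "semilinear A \<rho> (A.P (Suc i)) (A'.P i) (\<lambda>p. A'.d i (F (Suc i) p))"
    by (rule semilinear_comp[OF F_facts(1)[OF c1] A'.linear_d]) (auto intro: \<rho>_closed)
  have s2: "semilinear A \<rho> (A.P (Suc i)) (A'.P i) (\<lambda>p. F i (A.d i p))"
    by (rule semilinear_comp[OF A.linear_d F_facts(1)[OF c0]]) auto
  show ?thesis
  proof (rule semilinear_free_eqI[OF A.R.ring_axioms A'.P.M.abelian_group_axioms
        s1[unfolded A.P_free[of "Suc i"]] s2[unfolded A.P_free[of "Suc i"]]])
    fix s assume s: "s \<in> A.cells (Suc i)"
    then obtain l where l: "s = Syz l" "set l \<subseteq> carrier A \<times> A.cells i" unfolding A.cells_Suc by auto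
    have cs: "c s \<in> A'.cells (Suc i)" using c1 s by auto
    have "A'.d i (F (Suc i) (basis_vec A s)) = e \<odot>\<^bsub>A'.P i\<^esub> cell_boundary A' (c s)"
      using semilinearD(3)[OF A'.linear_d e A'.basis_P[OF cs]]
      by (simp add: F_facts(2)[OF c1 s] A'.d_basis[OF cs])
    also have "cell_boundary A' (c s) = F i (linear_combination A l)"
      using F_facts(4)[OF c0 l(2)] by (simp add: l cell_map_Syz)
    also have "e \<odot>\<^bsub>A'.P i\<^esub> F i (linear_combination A l) = F i (linear_combination A l)"
      using linear_combination_closed[OF A.R.ring_axioms l(2)] by (intro F_facts(3)[OF c0]) (simp add: A.P_free)
    also have "\<dots> = F i (A.d i (basis_vec A s))" using A.d_basis[OF s] l by simp
    finally show "A'.d i (F (Suc i) (basis_vec A s)) = F i (A.d i (basis_vec A s))" .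
  qed (use p A.P_free in auto)
qed

text \<open>The two statements need each other. For \<open>c s\<close> to be a cell of degree
  \<open>Suc i\<close>, \<open>F i\<close> must preserve cycles; that cycles are preserved in degree
  \<open>Suc i\<close> follows from the chain identity, which presupposes the inclusion of cells in
  both degrees.\<close>

lemma cells_cyc:
  "c ` A.cells i \<subseteq> A'.cells i \<and> (\<forall>p\<in>carrier (A.P i). A.cyc i p \<longrightarrow> A'.cyc i (F i p))"
proof (induct i)
  case 0
  have c: "c ` A.cells 0 \<subseteq> A'.cells 0"
    using semilinearD(1)[OF same] by auto
  have "\<zero>\<^bsub>N\<^esub> = \<zero>\<^bsub>N'\<^esub>"
    by (rule semilinear_zero(1)[OF same A.M.abelian_group_axioms A'.M.abelian_group_axioms])
  then show ?case using c F_aug[OF c] by (auto simp: A.cyc_def A'.cyc_def simp del: resolution_cells.simps)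
next
  case (Suc i)
  then have c0: "c ` A.cells i \<subseteq> A'.cells i" by simp
  have "c s \<in> A'.cells (Suc i)" if s: "s \<in> A.cells (Suc i)" for s
  proof -
    obtain l where l: "s = Syz l" "set l \<subseteq> carrier A \<times> A.cells i" "A.cyc i (linear_combination A l)"
      using s unfolding A.cells_Suc by auto
    have "A'.cyc i (F i (linear_combination A l))"
      using Suc l linear_combination_closed[OF A.R.ring_axioms l(2)] by (simp add: A.P_free)
    moreover have "set (map (\<lambda>(a, s). (e \<otimes>\<^bsub>A'\<^esub> \<rho> a, c s)) l) \<subseteq> carrier A' \<times> A'.cells i"
      using l(2) c0 e by (auto simp: \<rho>_closed intro!: A'.R.m_closed)
    ultimately show ?thesis
      unfolding A'.cells_Suc l(1) cell_map_Syz using F_facts(4)[OF c0 l(2)] by auto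
  qed
  then have c1: "c ` A.cells (Suc i) \<subseteq> A'.cells (Suc i)" by auto
  have "F i \<zero>\<^bsub>A.P i\<^esub> = \<zero>\<^bsub>A'.P i\<^esub>"
    by (rule semilinear_zero(1)[OF F_facts(1)[OF c0] A.P.M.abelian_group_axioms A'.P.M.abelian_group_axioms])
  then show ?case
    using c1 F_chain'[OF c0 c1] by (auto simp: A.cyc_def A'.cyc_def)
qed

lemma c_cells: "c ` A.cells i \<subseteq> A'.cells i" using cells_cyc by simp

lemmas semilinear_F = F_facts(1)[OF c_cells]
  and F_basis = F_facts(2)[OF c_cells]
  and F_chain = F_chain'[OF c_cells c_cells]

end

section \<open>The homotopy of a central idempotent\<close>

text \<open>Solves d H = F - 1 - H d on a basis cell by writing the right side as a list:
  \<open>e\<close> times the image cell, minus the cell, minus the homotopy of its boundary. Wrapped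
  in \<open>Syz\<close>, the list is a cell with that boundary as soon as it presents a cycle. On
  \<open>Gen x\<close> there is no boundary term.\<close>

primrec cell_homotopy :: "('a, 'z) ring_scheme \<Rightarrow> 'a \<Rightarrow> ('a, 'n) cell \<Rightarrow> ('a, 'n) cell" where
  "cell_homotopy R e (Gen x) = Syz [(e, Gen x), (\<ominus>\<^bsub>R\<^esub> \<one>\<^bsub>R\<^esub>, Gen x)]"
| "cell_homotopy R e (Syz l) =
     Syz ((e, cell_map R (\<lambda>a. a) e (Syz l)) # (\<ominus>\<^bsub>R\<^esub> \<one>\<^bsub>R\<^esub>, Syz l) #
       map (\<lambda>(a, t). (\<ominus>\<^bsub>R\<^esub> a, t)) (map (map_prod id (cell_homotopy R e)) l))"

lemma cell_homotopy_Syz: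
  "cell_homotopy R e (Syz l) =
     Syz ((e, cell_map R (\<lambda>a. a) e (Syz l)) # (\<ominus>\<^bsub>R\<^esub> \<one>\<^bsub>R\<^esub>, Syz l) #
       map (\<lambda>(a, s). (\<ominus>\<^bsub>R\<^esub> a, cell_homotopy R e s)) l)"
  by (simp add: case_prod_unfold map_prod_def)

declare cell_homotopy.simps(2) [simp del]

lemma ring_hom_id: "(\<lambda>a. a) \<in> ring_hom R R"
  by (rule ring_hom_memI) auto

locale central_idempotent = resolved_module A N
  for A :: "('a, 'c) ring_scheme" and N :: "('a, 'n, 'd) module_scheme" +
  fixes e
  assumes e: "e \<in> carrier A" and ee: "e \<otimes>\<^bsub>A\<^esub> e = e"
    and comm: "\<And>a. a \<in> carrier A \<Longrightarrow> e \<otimes>\<^bsub>A\<^esub> a = a \<otimes>\<^bsub>A\<^esub> e"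
    and e_N: "\<And>x. x \<in> carrier N \<Longrightarrow> e \<odot>\<^bsub>N\<^esub> x = x"
begin

text \<open>The case of unchanged scalars: coefficients are multiplied by \<open>e\<close> at all
  levels of a cell. As \<open>e\<close> acts on \<open>N\<close> as the identity, this lifts the
  identity of \<open>N\<close> and should be homotopic to the identity.\<close>

sublocale T: twist A N A N "\<lambda>a. a" e
  by (intro twist.intro twist_axioms.intro resolved_module_axioms e ee comm e_N linear_id ring_hom_id)

abbreviation "h \<equiv> cell_homotopy A e"

definition H :: "nat \<Rightarrow> (('a, 'n) cell \<Rightarrow> 'a) \<Rightarrow> ('a, 'n) cell \<Rightarrow> 'a" where
  "H i = lin_ext A (P (Suc i)) (\<lambda>s. basis_vec A (h s))"

text \<open>The boundary that \<open>H\<close> is meant to have. With a name for it, the cycle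
  condition can be checked before \<open>h s\<close> is known to be a cell.\<close>

definition K :: "nat \<Rightarrow> (('a, 'n) cell \<Rightarrow> 'a) \<Rightarrow> ('a, 'n) cell \<Rightarrow> 'a" where
  "K i p = (T.F i p \<ominus>\<^bsub>P i\<^esub> p) \<ominus>\<^bsub>P i\<^esub> (case i of 0 \<Rightarrow> \<zero>\<^bsub>P 0\<^esub> | Suc j \<Rightarrow> H j (d j p))"

lemma linear_H:
  assumes "h ` cells i \<subseteq> cells (Suc i)"
  shows "linear A (P i) (P (Suc i)) (H i)"
proof -
  have "basis_vec A (h s) \<in> carrier (P (Suc i))" if "s \<in> cells i" for s
    using that assms by (intro basis_P) blast
  then show ?thesis unfolding H_def P_free[of i] by (intro P.linear_lin_ext Pi_I)
qed

lemma H_basis: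
  assumes "h s \<in> cells (Suc i)"
  shows "H i (basis_vec A s) = basis_vec A (h s)"
  unfolding H_def by (rule P.lin_ext_basis[where v = "\<lambda>s. basis_vec A (h s)", OF basis_P[OF assms]])

lemma linear_K:
  assumes "\<And>j. i = Suc j \<Longrightarrow> h ` cells j \<subseteq> cells i"
  shows "linear A (P i) (P i) (K i)"
proof -
  have "linear A (P i) (P i) (\<lambda>p. case i of 0 \<Rightarrow> \<zero>\<^bsub>P 0\<^esub> | Suc j \<Rightarrow> H j (d j p))"
  proof (cases i)
    case 0
    then show ?thesis by (simp add: semilinear_def)
  next
    case (Suc j)
    have "linear A (P (Suc j)) (P (Suc j)) (\<lambda>p. H j (d j p))"
      using semilinear_comp[OF linear_d linear_H] assms[OF Suc] Suc by auto
    then show ?thesis by (simp add: Suc)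
  qed
  moreover have "linear A (P i) (P i) (\<lambda>p. T.F i p \<ominus>\<^bsub>P i\<^esub> p)"
    by (rule semilinear_diff[OF T.semilinear_F linear_id left_module_P]) simp
  ultimately show ?thesis
    unfolding K_def[abs_def] using semilinear_diff[OF _ _ left_module_P] by blast
qed

lemma P_minus_zero: "\<ominus>\<^bsub>P i\<^esub> \<zero>\<^bsub>P i\<^esub> = \<zero>\<^bsub>P i\<^esub>"
  by (intro P.M.minus_equality P.M.zero_closed P.M.l_zero)

text \<open>Covers degree 0 and cycles, where no homotopy term from one degree lower
  contributes.\<close>

lemma K_eq:
  assumes "p \<in> carrier (P i)"
    and "(case i of 0 \<Rightarrow> \<zero>\<^bsub>P 0\<^esub> | Suc j \<Rightarrow> H j (d j p)) = \<zero>\<^bsub>P i\<^esub>"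
  shows "K i p = T.F i p \<ominus>\<^bsub>P i\<^esub> p"
proof -
  have "T.F i p \<ominus>\<^bsub>P i\<^esub> p \<in> carrier (P i)"
    by (intro P.M.minus_closed semilinearD(1)[OF T.semilinear_F] assms)
  then show ?thesis
    unfolding K_def assms(2) a_minus_def[of _ _ "\<zero>\<^bsub>P i\<^esub>"] P_minus_zero by (rule P.M.r_zero)
qed

lemma minus_one_smult: "x \<in> carrier (P i) \<Longrightarrow> (\<ominus>\<^bsub>A\<^esub> \<one>\<^bsub>A\<^esub>) \<odot>\<^bsub>P i\<^esub> x = \<ominus>\<^bsub>P i\<^esub> x"
  by (simp only: P.smult_l_minus[OF R.one_closed] P.smult_one)

lemma combination_closed: "set l \<subseteq> carrier A \<times> cells i \<Longrightarrow> linear_combination A l \<in> carrier (P i)"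
  unfolding P_free by (rule linear_combination_closed[OF R.ring_axioms])

text \<open>Identifies the tail of the list in \<open>cell_homotopy\<close>; the minus sign of the
  term H d is carried by the coefficients.\<close>

lemma h_combination:
  assumes "h ` cells i \<subseteq> cells (Suc i)" "set l \<subseteq> carrier A \<times> cells i"
  shows "linear_combination A (map (\<lambda>(a, s). (\<ominus>\<^bsub>A\<^esub> a, h s)) l) = \<ominus>\<^bsub>P (Suc i)\<^esub> H i (linear_combination A l)"
  using assms(2)
proof (induct l)
  case Nil
  have "H i (linear_combination A []) = \<zero>\<^bsub>P (Suc i)\<^esub>"
    using semilinear_zero(1)[OF linear_H[OF assms(1)] P.M.abelian_group_axioms P.M.abelian_group_axioms]
    unfolding P_free[of i] linear_combination_Nil[of A "cells i"] .
  then have "\<ominus>\<^bsub>P (Suc i)\<^esub> H i (linear_combination A []) = \<zero>\<^bsub>P (Suc i)\<^esub>"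
    by (simp only: P_minus_zero)
  then show ?case by (simp add: P_free)
next
  case (Cons p l)
  obtain a s where p: "p = (a, s)" by (cases p)
  have as: "a \<in> carrier A" "s \<in> cells i" "h s \<in> cells (Suc i)" "set l \<subseteq> carrier A \<times> cells i"
    using Cons(2) p assms by auto
  note b = basis_P[OF as(2)] basis_P[OF as(3)] and L = combination_closed[OF as(4)]
  note HL = semilinearD[OF linear_H[OF assms(1)]]
  have "H i (linear_combination A (p # l)) = a \<odot>\<^bsub>P (Suc i)\<^esub> basis_vec A (h s) \<oplus>\<^bsub>P (Suc i)\<^esub> H i (linear_combination A l)"
    unfolding p linear_combination_Cons[of A a s l "cells i"] P_free[symmetric]
    using as b L by (simp add: HL H_basis)
  moreover have "linear_combination A (map (\<lambda>(a, s). (\<ominus>\<^bsub>A\<^esub> a, h s)) (p # l)) =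
      (\<ominus>\<^bsub>A\<^esub> a) \<odot>\<^bsub>P (Suc i)\<^esub> basis_vec A (h s) \<oplus>\<^bsub>P (Suc i)\<^esub> (\<ominus>\<^bsub>P (Suc i)\<^esub> H i (linear_combination A l))"
    unfolding Cons(1)[OF as(4), symmetric] by (simp add: p P_free)
  ultimately show ?case
    using as b L HL(1) by (simp add: P.smult_l_minus P.M.minus_add)
qed

text \<open>Concerns the list inside \<open>h s\<close>, before it is settled whether
  \<open>h s\<close> is a cell; therefore the inclusion of homotopy cells is assumed from one degree
  lower only.\<close>

lemma h_boundary:
  assumes "\<And>j. i = Suc j \<Longrightarrow> h ` cells j \<subseteq> cells i" and s: "s \<in> cells i"
  shows "\<exists>l. h s = Syz l \<and> set l \<subseteq> carrier A \<times> cells i \<and> linear_combination A l = K i (basis_vec A s)"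
proof -
  have cs: "T.c s \<in> cells i" using T.c_cells s by auto
  note b = basis_P[OF s] basis_P[OF cs]
  have Fs: "T.F i (basis_vec A s) = e \<odot>\<^bsub>P i\<^esub> basis_vec A (T.c s)"
    by (rule T.F_basis[OF s])
  have two: "linear_combination A ((e, T.c s) # (\<ominus>\<^bsub>A\<^esub> \<one>\<^bsub>A\<^esub>, s) # l) =
      (T.F i (basis_vec A s) \<ominus>\<^bsub>P i\<^esub> basis_vec A s) \<oplus>\<^bsub>P i\<^esub> linear_combination A l"
    if "set l \<subseteq> carrier A \<times> cells i" for l
  proof -
    note L = combination_closed[OF that]
    have "linear_combination A ((e, T.c s) # (\<ominus>\<^bsub>A\<^esub> \<one>\<^bsub>A\<^esub>, s) # l) =
      e \<odot>\<^bsub>P i\<^esub> basis_vec A (T.c s) \<oplus>\<^bsub>P i\<^esub> ((\<ominus>\<^bsub>A\<^esub> \<one>\<^bsub>A\<^esub>) \<odot>\<^bsub>P i\<^esub> basis_vec A s \<oplus>\<^bsub>P i\<^esub> linear_combination A l)"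
      by (simp add: P_free)
    also have "\<dots> = e \<odot>\<^bsub>P i\<^esub> basis_vec A (T.c s) \<oplus>\<^bsub>P i\<^esub> (\<ominus>\<^bsub>P i\<^esub> basis_vec A s \<oplus>\<^bsub>P i\<^esub> linear_combination A l)"
      by (simp only: minus_one_smult[OF b(1)])
    also have "\<dots> = (e \<odot>\<^bsub>P i\<^esub> basis_vec A (T.c s) \<oplus>\<^bsub>P i\<^esub> \<ominus>\<^bsub>P i\<^esub> basis_vec A s) \<oplus>\<^bsub>P i\<^esub> linear_combination A l"
      using b e L by (simp add: P.M.a_assoc)
    finally show ?thesis unfolding Fs a_minus_def .
  qed
  have m1: "\<ominus>\<^bsub>A\<^esub> \<one>\<^bsub>A\<^esub> \<in> carrier A" by simp
  have Fc: "T.F i (basis_vec A s) \<ominus>\<^bsub>P i\<^esub> basis_vec A s \<in> carrier (P i)"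
    using b semilinearD(1)[OF T.semilinear_F] by (intro P.M.minus_closed) auto
  show ?thesis
  proof (cases i)
    case 0
    then obtain x where x: "s = Gen x" using s by auto
    have "h s = Syz ((e, T.c s) # (\<ominus>\<^bsub>A\<^esub> \<one>\<^bsub>A\<^esub>, s) # [])"
      unfolding x cell_homotopy.simps cell_map.simps ..
    moreover have "linear_combination A ((e, T.c s) # (\<ominus>\<^bsub>A\<^esub> \<one>\<^bsub>A\<^esub>, s) # []) = K i (basis_vec A s)"
    proof -
      have n: "set [] \<subseteq> carrier A \<times> cells i" by simp
      have "linear_combination A [] = \<zero>\<^bsub>P i\<^esub>"
        unfolding P_free by (rule linear_combination_Nil)
      then have "linear_combination A ((e, T.c s) # (\<ominus>\<^bsub>A\<^esub> \<one>\<^bsub>A\<^esub>, s) # []) =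
          T.F i (basis_vec A s) \<ominus>\<^bsub>P i\<^esub> basis_vec A s"
        unfolding two[OF n] using P.M.r_zero[OF Fc] by simp
      moreover have "K i (basis_vec A s) = (T.F i (basis_vec A s) \<ominus>\<^bsub>P i\<^esub> basis_vec A s) \<ominus>\<^bsub>P i\<^esub> \<zero>\<^bsub>P i\<^esub>"
        by (simp add: K_def 0)
      ultimately show ?thesis
        unfolding a_minus_def[of _ _ "\<zero>\<^bsub>P i\<^esub>"] P_minus_zero P.M.r_zero[OF Fc] by simp
    qed
    moreover have "set [(e, T.c s), (\<ominus>\<^bsub>A\<^esub> \<one>\<^bsub>A\<^esub>, s)] \<subseteq> carrier A \<times> cells i"
      using cs s e m1 by simp
    ultimately show ?thesis by blast
  next
    case (Suc j)
    then obtain l where l: "s = Syz l" "set l \<subseteq> carrier A \<times> cells j" using s cells_Suc by auto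
    have hj: "h ` cells j \<subseteq> cells (Suc j)" using assms(1)[OF Suc] Suc by simp
    let ?l = "map (\<lambda>(a, s). (\<ominus>\<^bsub>A\<^esub> a, h s)) l"
    have sl: "set ?l \<subseteq> carrier A \<times> cells i" using l(2) hj Suc by auto
    have "h s = Syz ((e, T.c s) # (\<ominus>\<^bsub>A\<^esub> \<one>\<^bsub>A\<^esub>, s) # ?l)" by (simp add: l cell_homotopy_Syz)
    moreover have "linear_combination A ((e, T.c s) # (\<ominus>\<^bsub>A\<^esub> \<one>\<^bsub>A\<^esub>, s) # ?l) = K i (basis_vec A s)"
      unfolding two[OF sl] h_combination[OF hj l(2)] K_def
      using d_basis[of s j] s by (simp add: Suc l a_minus_def)
    moreover have "set ((e, T.c s) # (\<ominus>\<^bsub>A\<^esub> \<one>\<^bsub>A\<^esub>, s) # ?l) \<subseteq> carrier A \<times> cells i"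
      using cs s e m1 sl by simp
    ultimately show ?thesis by blast
  qed
qed

lemma d_H':
  assumes "\<And>j. i = Suc j \<Longrightarrow> h ` cells j \<subseteq> cells i" "h ` cells i \<subseteq> cells (Suc i)" "p \<in> carrier (P i)"
  shows "d i (H i p) = K i p"
proof (rule semilinear_free_eqI[OF R.ring_axioms P.M.abelian_group_axioms, where F = "\<lambda>p. d i (H i p)"])
  show "linear A (free_module A (cells i)) (P i) (\<lambda>p. d i (H i p))"
    using semilinear_comp[OF linear_H[OF assms(2)] linear_d] by (simp add: P_free)
  show "linear A (free_module A (cells i)) (P i) (K i)"
    using linear_K[OF assms(1)] by (simp add: P_free)
  show "d i (H i (basis_vec A s)) = K i (basis_vec A s)" if s: "s \<in> cells i" for s
  proof -
    have hs: "h s \<in> cells (Suc i)" using assms(2) s by auto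
    obtain l where "h s = Syz l" "linear_combination A l = K i (basis_vec A s)"
      using h_boundary[OF assms(1) s] by auto
    then show ?thesis using hs by (simp add: H_basis d_basis)
  qed
  show "p \<in> carrier (free_module A (cells i))" using assms(3) by (simp add: P_free)
qed

text \<open>The point is that \<open>K i\<close> of a basis cell is a cycle. In degree 0,
  \<open>F\<close> and the identity both respect the augmentation. Above it, let b be the boundary
  of the cell: the differential of \<open>K\<close> is F b - b - d H b, and d H b = F b - b because
  b is a cycle. The last equation uses the claim one and two degrees lower, hence the complete
  induction.\<close>

lemma h_cells: "h ` cells i \<subseteq> cells (Suc i)"
proof (induct i rule: less_induct)
  case (less i)
  then have lower: "\<And>j. i = Suc j \<Longrightarrow> h ` cells j \<subseteq> cells i" by blast
  have "h s \<in> cells (Suc i)" if s: "s \<in> cells i" for s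
  proof -
    obtain l where l: "h s = Syz l" "set l \<subseteq> carrier A \<times> cells i" "linear_combination A l = K i (basis_vec A s)"
      using h_boundary[OF lower s] by auto
    note b = basis_P[OF s]
    have "cyc i (K i (basis_vec A s))"
    proof (cases i)
      case 0
      then obtain x where x: "s = Gen x" "x \<in> carrier N" using s by auto
      have F: "T.F 0 (basis_vec A s) \<in> carrier (P 0)"
        using b 0 semilinearD(1)[OF T.semilinear_F] by auto
      have "aug (K 0 (basis_vec A s)) = aug (T.F 0 (basis_vec A s)) \<ominus>\<^bsub>N\<^esub> aug (basis_vec A s)"
        using F b 0 K_eq[of "basis_vec A s" 0]
          semilinear_zero(3)[OF linear_aug P.M.abelian_group_axioms M.abelian_group_axioms] by simp
      also have "\<dots> = \<zero>\<^bsub>N\<^esub>"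
        using b 0 T.F_aug[OF T.c_cells] semilinearD(1)[OF linear_aug] by (simp add: a_minus_def M.r_neg)
      finally show ?thesis by (simp add: cyc_def 0)
    next
      case (Suc j)
      obtain m where m: "s = Syz m" "set m \<subseteq> carrier A \<times> cells j" "cyc j (linear_combination A m)"
        using s Suc cells_Suc by auto
      let ?L = "linear_combination A m"
      have L: "?L \<in> carrier (P j)" by (rule combination_closed[OF m(2)])
      have db: "d j (basis_vec A s) = ?L" using d_basis[of s j] s Suc m by simp
      have hj: "h ` cells j \<subseteq> cells (Suc j)" using less Suc by auto
      have hj': "h ` cells i \<subseteq> cells j" if "j = Suc i" for i using less Suc that by auto
      have F: "T.F (Suc j) (basis_vec A s) \<in> carrier (P (Suc j))" "T.F j ?L \<in> carrier (P j)"
        using b L Suc semilinearD(1)[OF T.semilinear_F] by auto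
      have HL: "H j ?L \<in> carrier (P (Suc j))" using L semilinearD(1)[OF linear_H[OF hj]] by simp
      \<comment> \<open>The boundary of a cell is a cycle, so the homotopy term one degree further
        down disappears.\<close>
      have z: "(case j of 0 \<Rightarrow> \<zero>\<^bsub>P 0\<^esub> | Suc i \<Rightarrow> H i (d i ?L)) = \<zero>\<^bsub>P j\<^esub>"
      proof (cases j)
        case (Suc i)
        have "H i \<zero>\<^bsub>P i\<^esub> = \<zero>\<^bsub>P (Suc i)\<^esub>"
          using hj'[OF Suc] Suc
          by (intro semilinear_zero(1)[OF linear_H P.M.abelian_group_axioms P.M.abelian_group_axioms]) simp
        then show ?thesis using m(3) Suc by (simp add: cyc_def)
      qed simp
      have dH: "d j (H j ?L) = T.F j ?L \<ominus>\<^bsub>P j\<^esub> ?L"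
      proof -
        have "d j (H j ?L) = K j ?L" by (rule d_H'[OF _ hj L]) (rule hj')
        then show ?thesis unfolding K_eq[OF L z] .
      qed
      have "d j (K (Suc j) (basis_vec A s)) =
          (d j (T.F (Suc j) (basis_vec A s)) \<ominus>\<^bsub>P j\<^esub> d j (basis_vec A s)) \<ominus>\<^bsub>P j\<^esub> d j (H j ?L)"
      proof -
        have Fb: "T.F (Suc j) (basis_vec A s) \<ominus>\<^bsub>P (Suc j)\<^esub> basis_vec A s \<in> carrier (P (Suc j))"
          using F(1) b Suc by (intro P.M.minus_closed) auto
        note dm = semilinear_zero(3)[OF linear_d P.M.abelian_group_axioms P.M.abelian_group_axioms]
        have "K (Suc j) (basis_vec A s) =
            (T.F (Suc j) (basis_vec A s) \<ominus>\<^bsub>P (Suc j)\<^esub> basis_vec A s) \<ominus>\<^bsub>P (Suc j)\<^esub> H j ?L"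
          by (simp add: K_def db)
        then show ?thesis
          using dm[OF Fb HL] dm[OF F(1) b[unfolded Suc]] by simp
      qed
      also have "\<dots> = \<zero>\<^bsub>P j\<^esub>"
      proof -
        have "d j (T.F (Suc j) (basis_vec A s)) = T.F j ?L"
          using T.F_chain[OF b[unfolded Suc]] db by simp
        then show ?thesis
          unfolding db dH a_minus_def[of _ _ "a_minus _ _ _"]
          by (simp only: P.M.r_neg[OF P.M.minus_closed[OF F(2) L]])
      qed
      finally show ?thesis by (simp add: cyc_def Suc)
    qed
    then show ?thesis unfolding cells_Suc using l by auto
  qed
  then show ?case by auto
qed

lemma d_H: "p \<in> carrier (P i) \<Longrightarrow> d i (H i p) = K i p"
  using d_H'[of i p] h_cells by blast

lemmas linear_H' = linear_H[OF h_cells]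

lemma homotopy_0:
  assumes "p \<in> carrier (P 0)"
  shows "T.F 0 p = d 0 (H 0 p) \<oplus>\<^bsub>P 0\<^esub> p"
  using d_H[OF assms] K_eq[OF assms] semilinearD(1)[OF T.semilinear_F assms] assms
  by (simp add: a_minus_def P.M.a_assoc P.M.l_neg)

lemma homotopy_Suc:
  assumes "p \<in> carrier (P (Suc i))"
  shows "T.F (Suc i) p = (d (Suc i) (H (Suc i) p) \<oplus>\<^bsub>P (Suc i)\<^esub> H i (d i p)) \<oplus>\<^bsub>P (Suc i)\<^esub> p"
proof -
  have a: "T.F (Suc i) p \<in> carrier (P (Suc i))" "H i (d i p) \<in> carrier (P (Suc i))"
    using assms semilinearD(1)[OF T.semilinear_F] semilinearD(1)[OF linear_H'] semilinearD(1)[OF linear_d]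
    by auto
  then show ?thesis
    using d_H[OF assms] assms
    by (simp add: K_def a_minus_def P.M.a_assoc P.M.l_neg)
qed

end

section \<open>Tor and retracts of algebras\<close>

locale algebra_retract =
  A: left_module A NA + B: left_module B NB
  for A :: "('k, 'a, 'c) module_scheme" and NA :: "('a, 'n, 'd) module_scheme"
    and B :: "('k, 'b, 'u) module_scheme" and NB :: "('b, 'n, 'v) module_scheme" +
  fixes k :: "('k, 'z) ring_scheme" and MA :: "('a, 'm, 'x) module_scheme" and MB :: "('b, 'm, 'y) module_scheme"
    and \<pi> \<iota> e
  assumes k: "cring k"
    and \<pi>: "\<pi> \<in> ring_hom A B" and \<iota>: "\<iota> \<in> ring_hom B A"
    and \<pi>\<iota>: "\<And>b. b \<in> carrier B \<Longrightarrow> \<pi> (\<iota> b) = b"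
    and e: "e \<in> carrier A" and ee: "e \<otimes>\<^bsub>A\<^esub> e = e"
    and comm: "\<And>a. a \<in> carrier A \<Longrightarrow> e \<otimes>\<^bsub>A\<^esub> a = a \<otimes>\<^bsub>A\<^esub> e"
    and \<pi>e: "\<pi> e = \<one>\<^bsub>B\<^esub>"
    and e\<iota>\<pi>: "\<And>a. a \<in> carrier A \<Longrightarrow> e \<otimes>\<^bsub>A\<^esub> \<iota> (\<pi> a) = e \<otimes>\<^bsub>A\<^esub> a"
    and NAB: "semilinear A \<pi> NA NB (\<lambda>x. x)" and NBA: "semilinear B \<iota> NB NA (\<lambda>x. x)"
    and eN: "\<And>x. x \<in> carrier NA \<Longrightarrow> e \<odot>\<^bsub>NA\<^esub> x = x"
    and MAB: "scalar_change k \<pi> A MA B MB" and MBA: "scalar_change k \<iota> B MB A MA"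
    and scalars: "\<And>c. c \<in> carrier k \<Longrightarrow> c \<odot>\<^bsub>A\<^esub> \<one>\<^bsub>A\<^esub> \<in> carrier A"
      "\<And>c. c \<in> carrier k \<Longrightarrow> c \<odot>\<^bsub>B\<^esub> \<one>\<^bsub>B\<^esub> \<in> carrier B"
    and MA_closed: "\<And>m m'. m \<in> carrier MA \<Longrightarrow> m' \<in> carrier MA \<Longrightarrow> m \<oplus>\<^bsub>MA\<^esub> m' \<in> carrier MA"
      "\<And>a m. a \<in> carrier A \<Longrightarrow> m \<in> carrier MA \<Longrightarrow> a \<odot>\<^bsub>MA\<^esub> m \<in> carrier MA"
begin

lemma resolved_A: "resolved_module A NA"
  by (intro resolved_module.intro A.left_module_axioms)

lemma resolved_B: "resolved_module B NB"
  by (intro resolved_module.intro B.left_module_axioms)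

sublocale A: central_idempotent A NA e
  by (intro central_idempotent.intro central_idempotent_axioms.intro resolved_A e ee comm eN)

sublocale B: resolved_module B NB
  by (rule resolved_B)

lemma \<pi>_closed: "a \<in> carrier A \<Longrightarrow> \<pi> a \<in> carrier B" using \<pi> by (rule ring_hom_closed)
lemma \<iota>_closed: "b \<in> carrier B \<Longrightarrow> \<iota> b \<in> carrier A" using \<iota> by (rule ring_hom_closed)

sublocale p: twist A NA B NB \<pi> "\<one>\<^bsub>B\<^esub>"
  by (intro twist.intro twist_axioms.intro resolved_A resolved_B \<pi> NAB B.R.one_closed)
    (simp_all add: \<pi>_closed)

sublocale q: twist B NB A NA \<iota> e
  by (intro twist.intro twist_axioms.intro resolved_A resolved_B \<iota> NBA e ee comm eN \<iota>_closed)

text \<open>On coefficients the round trip yields \<open>e\<close> times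
  \<open>\<iota> (\<pi> a)\<close>, which is \<open>e\<close> times \<open>a\<close>. On cells it is
  therefore literally the map \<open>A.T.c\<close>, to which the homotopy applies.\<close>

lemma qp_cell: "s \<in> A.cells i \<Longrightarrow> q.c (p.c s) = A.T.c s"
proof (induct i arbitrary: s)
  case 0
  then show ?case by auto
next
  case (Suc i)
  then obtain l where l: "s = Syz l" "set l \<subseteq> carrier A \<times> A.cells i" unfolding A.cells_Suc by auto
  have "(e \<otimes>\<^bsub>A\<^esub> \<iota> (\<one>\<^bsub>B\<^esub> \<otimes>\<^bsub>B\<^esub> \<pi> a), q.c (p.c t)) = (e \<otimes>\<^bsub>A\<^esub> a, A.T.c t)" if "(a, t) \<in> set l" for a t
    using that l(2) Suc(1)[of t] by (auto simp: \<pi>_closed e\<iota>\<pi>)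
  then show ?case unfolding l(1) cell_map_Syz by auto
qed

text \<open>As \<open>\<pi> e\<close> is the unit, \<open>\<pi>\<close> sends \<open>e\<close> times
  \<open>\<iota> b\<close> back to \<open>b\<close>; on the side of \<open>B\<close> the round trip
  is the identity itself.\<close>

lemma pq_cell: "s \<in> B.cells i \<Longrightarrow> p.c (q.c s) = s"
proof (induct i arbitrary: s)
  case 0
  then show ?case by auto
next
  case (Suc i)
  then obtain l where l: "s = Syz l" "set l \<subseteq> carrier B \<times> B.cells i" unfolding B.cells_Suc by auto
  have "(\<one>\<^bsub>B\<^esub> \<otimes>\<^bsub>B\<^esub> \<pi> (e \<otimes>\<^bsub>A\<^esub> \<iota> b), p.c (q.c t)) = (b, t)" if "(b, t) \<in> set l" for b t
    using that l(2) Suc(1)[of t] e by (auto simp: \<pi>_closed \<iota>_closed ring_hom_mult[OF \<pi>] \<pi>e \<pi>\<iota>)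
  then show ?case unfolding l(1) cell_map_Syz by (auto intro!: map_idI)
qed

lemma p_F_basis: "s \<in> A.cells i \<Longrightarrow> p.F i (basis_vec A s) = basis_vec B (p.c s)"
  using p.c_cells[of i] by (subst p.F_basis) (auto intro!: B.P.smult_one B.basis_P)

text \<open>The left side is semilinear along \<open>\<iota>\<close> after \<open>\<pi>\<close>, the
  right side is linear. They can be compared on basis cells because the right side is semilinear in
  the first sense too: its values are fixed by \<open>e\<close>, and \<open>a\<close> and
  \<open>\<iota> (\<pi> a)\<close> have the same product with \<open>e\<close>.\<close>

lemma qp_F:
  assumes "x \<in> carrier (A.P i)"
  shows "q.F i (p.F i x) = A.T.F i x"
proof -
  have 1: "semilinear A (\<lambda>a. \<iota> (\<pi> a)) (A.P i) (A.P i) (\<lambda>x. q.F i (p.F i x))"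
    by (rule semilinear_comp[OF p.semilinear_F q.semilinear_F]) (auto intro: \<pi>_closed)
  note F = semilinearD[OF A.T.semilinear_F]
  have "a \<odot>\<^bsub>A.P i\<^esub> A.T.F i y = \<iota> (\<pi> a) \<odot>\<^bsub>A.P i\<^esub> A.T.F i y"
    if a: "a \<in> carrier A" and y: "y \<in> carrier (A.P i)" for a y
  proof -
    have eF: "e \<odot>\<^bsub>A.P i\<^esub> A.T.F i y = A.T.F i y" by (rule A.T.F_facts(3)[OF A.T.c_cells y])
    have ia: "\<iota> (\<pi> a) \<in> carrier A" using a by (intro \<iota>_closed \<pi>_closed)
    have "a \<odot>\<^bsub>A.P i\<^esub> A.T.F i y = (a \<otimes>\<^bsub>A\<^esub> e) \<odot>\<^bsub>A.P i\<^esub> A.T.F i y"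
      using A.P.smult_assoc1[OF a e F(1)[OF y]] eF by simp
    also have "a \<otimes>\<^bsub>A\<^esub> e = \<iota> (\<pi> a) \<otimes>\<^bsub>A\<^esub> e"
      using comm[OF a] comm[OF ia] e\<iota>\<pi>[OF a] by simp
    also have "(\<iota> (\<pi> a) \<otimes>\<^bsub>A\<^esub> e) \<odot>\<^bsub>A.P i\<^esub> A.T.F i y = \<iota> (\<pi> a) \<odot>\<^bsub>A.P i\<^esub> A.T.F i y"
      using A.P.smult_assoc1[OF ia e F(1)[OF y]] eF by simp
    finally show ?thesis .
  qed
  then have 2: "semilinear A (\<lambda>a. \<iota> (\<pi> a)) (A.P i) (A.P i) (A.T.F i)"
    using A.T.semilinear_F[of i] unfolding semilinear_def by metis
  have "q.F i (p.F i (basis_vec A s)) = A.T.F i (basis_vec A s)" if s: "s \<in> A.cells i" for s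
    using s p.c_cells[of i] q.F_basis[of "p.c s" i] A.T.F_basis[OF s]
    by (auto simp: p_F_basis[OF s] qp_cell[OF s])
  then show ?thesis by (rule A.P_eqI[OF A.P.M.abelian_group_axioms 1 2 _ assms])
qed

lemma pq_F:
  assumes "y \<in> carrier (B.P i)"
  shows "p.F i (q.F i y) = y"
proof -
  have "semilinear B (\<lambda>b. \<pi> (\<iota> b)) (B.P i) (B.P i) (\<lambda>x. p.F i (q.F i x))"
    by (rule semilinear_comp[OF q.semilinear_F p.semilinear_F]) (auto intro: \<iota>_closed)
  then have 1: "linear B (B.P i) (B.P i) (\<lambda>x. p.F i (q.F i x))"
    by (simp add: semilinear_def \<pi>\<iota>)
  have "p.F i (q.F i (basis_vec B s)) = basis_vec B s" if s: "s \<in> B.cells i" for s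
  proof -
    have c: "q.c s \<in> A.cells i" using s q.c_cells by auto
    have "p.F i (q.F i (basis_vec B s)) = \<pi> e \<odot>\<^bsub>B.P i\<^esub> basis_vec B (p.c (q.c s))"
      by (simp only: q.F_basis[OF s] semilinearD(3)[OF p.semilinear_F e A.basis_P[OF c]] p_F_basis[OF c])
    then show ?thesis using pq_cell[OF s] B.basis_P[OF s] by (simp add: \<pi>e B.P.smult_one)
  qed
  then show ?thesis by (rule B.P_eqI[OF B.P.M.abelian_group_axioms 1 linear_id _ assms])
qed

lemma factors_A: "tensor_factors k A MA (A.P i)"
  by (intro tensor_factors.intro k scalars MA_closed A.left_module_P)

lemma factors_B: "tensor_factors k B MB (B.P i)"
proof (intro tensor_factors.intro k scalars B.left_module_P)
  show "m \<oplus>\<^bsub>MB\<^esub> m' \<in> carrier MB" if "m \<in> carrier MB" "m' \<in> carrier MB" for m m'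
    using MAB MA_closed(1)[of m m'] that by (auto simp: scalar_change_def)
  \<comment> \<open>An element \<open>b\<close> acts as \<open>\<iota> b\<close> does, so closure is
    inherited from \<open>MA\<close>.\<close>
  show "b \<odot>\<^bsub>MB\<^esub> m \<in> carrier MB" if "b \<in> carrier B" "m \<in> carrier MB" for b m
    using MBA MAB MA_closed(2)[of "\<iota> b" m] \<iota>_closed[OF that(1)] that
    unfolding scalar_change_def by metis
qed

abbreviation "tA i \<equiv> tensor_product k A MA (A.P i)"
abbreviation "tB i \<equiv> tensor_product k B MB (B.P i)"
abbreviation "dA i \<equiv> tensor_map k A MA (A.P i) (A.d i)"
abbreviation "dB i \<equiv> tensor_map k B MB (B.P i) (B.d i)"
abbreviation "pT i \<equiv> tensor_map k B MB (B.P i) (p.F i)"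
abbreviation "qT i \<equiv> tensor_map k A MA (A.P i) (q.F i)"
abbreviation "hT i \<equiv> tensor_map k A MA (A.P (Suc i)) (A.H i)"

lemmas mapA = factors_A factors_A scalar_change_id[OF k, of A MA]
  and mapB = factors_B factors_B scalar_change_id[OF k, of B MB]
  and mapAB = factors_A factors_B MAB
  and mapBA = factors_B factors_A MBA

lemma linear_dA: "linear k (tA (Suc i)) (tA i) (dA i)"
  by (rule linear_tensor_map[OF k mapA A.linear_d])

lemma linear_dB: "linear k (tB (Suc i)) (tB i) (dB i)"
  by (rule linear_tensor_map[OF k mapB B.linear_d])

lemma linear_pT: "linear k (tA i) (tB i) (pT i)"
  by (rule linear_tensor_map[OF k mapAB p.semilinear_F])

lemma linear_qT: "linear k (tB i) (tA i) (qT i)"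
  by (rule linear_tensor_map[OF k mapBA q.semilinear_F])

lemma linear_hT: "linear k (tA i) (tA (Suc i)) (hT i)"
  by (rule linear_tensor_map[OF k mapA A.linear_H'])

lemma module_tA: "module k (tA i)"
  by (rule tensor_factors.module_tensor[OF factors_A])

lemma module_tB: "module k (tB i)"
  by (rule tensor_factors.module_tensor[OF factors_B])

end

text \<open>A zero map satisfies d = d + d, so by additivity the induced value equals its own
  double.\<close>

lemma tensor_map_null:
  assumes k: "cring k" and T: "tensor_factors k A M N" "tensor_factors k A M N'"
    and X: "X \<in> carrier (tensor_product k A M N)"
    and z: "\<And>x. x \<in> carrier N \<Longrightarrow> d x = \<zero>\<^bsub>N'\<^esub>"
  shows "tensor_map k A M N' d X = \<zero>\<^bsub>tensor_product k A M N'\<^esub>"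
proof -
  interpret N': left_module A N' using T(2) by (simp add: tensor_factors_def)
  interpret P: module k "tensor_product k A M N'" by (rule tensor_factors.module_tensor[OF T(2)])
  have d: "linear A N N' d"
    using z T(1)[unfolded tensor_factors_def]
    by (auto simp: semilinear_def left_module.smult_closed abelian_monoid.a_closed left_module_def
        abelian_group_def)
  have "tensor_map k A M N' d X = tensor_map k A M N' (\<lambda>x. d x \<oplus>\<^bsub>N'\<^esub> d x) X"
    by (rule tensor_map_cong[OF k T scalar_change_id[OF k] semilinear_add[OF d d N'.left_module_axioms]])
      (use z X in auto)
  also have "\<dots> = tensor_map k A M N' d X \<oplus>\<^bsub>tensor_product k A M N'\<^esub> tensor_map k A M N' d X"
    by (rule tensor_map_add[OF k T scalar_change_id[OF k] d d X])
  finally show ?thesis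
    using semilinearD(1)[OF linear_tensor_map[OF k T scalar_change_id[OF k] d] X] by (metis P.M.add.r_cancel_one')
qed

context algebra_retract
begin

text \<open>Tensoring preserves sums and composites of maps, so F = d H + H d + 1 survives. On a
  cycle of the tensored complex the term H d acts as the tensored differential followed by the
  tensored H, hence as zero.\<close>

lemma tensor_homotopy:
  assumes x: "x \<in> cycles tA dA i"
  shows "qT i (pT i x) = dA i (hT i x) \<oplus>\<^bsub>tA i\<^esub> x"
proof -
  have xc: "x \<in> carrier (tA i)" using x by (auto simp: cycles_def split: nat.splits)
  interpret M: module k "tA i" by (rule module_tA)
  have "qT i (pT i x) = tensor_map k A MA (A.P i) (\<lambda>x. q.F i (p.F i x)) x"
    by (rule tensor_map_comp[OF k factors_A factors_B factors_A MAB MBA p.semilinear_F q.semilinear_F xc])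
  also have "\<dots> = tensor_map k A MA (A.P i) (A.T.F i) x"
    by (rule tensor_map_cong[OF k mapA A.T.semilinear_F qp_F xc])
  finally have 1: "qT i (pT i x) = tensor_map k A MA (A.P i) (A.T.F i) x" .
  have dH: "linear A (A.P i) (A.P i) (\<lambda>p. A.d i (A.H i p))"
    by (rule semilinear_comp[OF A.linear_H' A.linear_d]) simp
  have 2: "tensor_map k A MA (A.P i) (\<lambda>p. A.d i (A.H i p)) x = dA i (hT i x)"
    by (rule tensor_map_comp[symmetric, OF k factors_A factors_A factors_A scalar_change_id[OF k] scalar_change_id[OF k]
          A.linear_H' A.linear_d xc])
  have dHx: "dA i (hT i x) \<in> carrier (tA i)"
    by (intro semilinearD(1)[OF linear_dA] semilinearD(1)[OF linear_hT] xc)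
  have 3: "tensor_map k A MA (A.P i) (\<lambda>p. p) x = x"
    by (rule tensor_map_id[OF k factors_A xc])
  show ?thesis
  proof (cases i)
    case 0
    have "tensor_map k A MA (A.P i) (A.T.F i) x =
        tensor_map k A MA (A.P i) (\<lambda>p. A.d i (A.H i p) \<oplus>\<^bsub>A.P i\<^esub> p) x"
      by (rule tensor_map_cong[OF k mapA semilinear_add[OF dH linear_id A.left_module_P] _ xc])
        (use A.homotopy_0 0 in auto)
    also have "\<dots> = dA i (hT i x) \<oplus>\<^bsub>tA i\<^esub> x"
      using tensor_map_add[OF k mapA dH linear_id xc] 2 3 by simp
    finally show ?thesis using 1 by simp
  next
    case (Suc j)
    have Hd: "linear A (A.P i) (A.P i) (\<lambda>p. A.H j (A.d j p))"
      unfolding Suc by (rule semilinear_comp[OF A.linear_d A.linear_H']) simp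
    have "tensor_map k A MA (A.P i) (\<lambda>p. A.H j (A.d j p)) x = hT j (dA j x)"
      using xc unfolding Suc
      by (intro tensor_map_comp[symmetric, OF k factors_A factors_A factors_A scalar_change_id[OF k] scalar_change_id[OF k]
          A.linear_d A.linear_H'])
    also have "dA j x = \<zero>\<^bsub>tA j\<^esub>" using x by (simp add: cycles_def Suc)
    also have "hT j \<zero>\<^bsub>tA j\<^esub> = \<zero>\<^bsub>tA i\<^esub>"
      unfolding Suc using module_tA by (intro semilinear_zero(1)[OF linear_hT]) (simp_all add: module_def)
    finally have 4: "tensor_map k A MA (A.P i) (\<lambda>p. A.H j (A.d j p)) x = \<zero>\<^bsub>tA i\<^esub>" .
    have s: "linear A (A.P i) (A.P i) (\<lambda>p. A.d i (A.H i p) \<oplus>\<^bsub>A.P i\<^esub> A.H j (A.d j p))"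
      by (rule semilinear_add[OF dH Hd A.left_module_P]) simp
    have "tensor_map k A MA (A.P i) (A.T.F i) x =
        tensor_map k A MA (A.P i) (\<lambda>p. (A.d i (A.H i p) \<oplus>\<^bsub>A.P i\<^esub> A.H j (A.d j p)) \<oplus>\<^bsub>A.P i\<^esub> p) x"
      by (rule tensor_map_cong[OF k mapA semilinear_add[OF s linear_id A.left_module_P] _ xc])
        (use A.homotopy_Suc[of _ j] Suc in auto)
    also have "\<dots> = (dA i (hT i x) \<oplus>\<^bsub>tA i\<^esub> \<zero>\<^bsub>tA i\<^esub>) \<oplus>\<^bsub>tA i\<^esub> x"
      unfolding tensor_map_add[OF k mapA s linear_id xc] tensor_map_add[OF k mapA dH Hd xc] 2 3 4 ..
    finally show ?thesis using 1 dHx by simp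
  qed
qed

theorem Tor_iso: "graded_module_iso k (Tor k A MA NA) (Tor k B MB NB)"
  unfolding Tor_def
proof (rule graded_homology_iso[where f = pT and g = qT])
  show "module k (tA i)" for i by (rule module_tA)
  show "module k (tB i)" for i by (rule module_tB)
  show "linear k (tA (Suc i)) (tA i) (dA i)" for i by (rule linear_dA)
  show "linear k (tB (Suc i)) (tB i) (dB i)" for i by (rule linear_dB)
  show "linear k (tA i) (tB i) (pT i)" for i by (rule linear_pT)
  show "linear k (tB i) (tA i) (qT i)" for i by (rule linear_qT)
  show "dA i (dA (Suc i) x) = \<zero>\<^bsub>tA i\<^esub>" if x: "x \<in> carrier (tA (Suc (Suc i)))" for i x
    unfolding tensor_map_comp[OF k factors_A factors_A factors_A scalar_change_id[OF k] scalar_change_id[OF k] A.linear_d A.linear_d x]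
    by (rule tensor_map_null[OF k factors_A factors_A x A.d_d])
  show "dB i (dB (Suc i) x) = \<zero>\<^bsub>tB i\<^esub>" if x: "x \<in> carrier (tB (Suc (Suc i)))" for i x
    unfolding tensor_map_comp[OF k factors_B factors_B factors_B scalar_change_id[OF k] scalar_change_id[OF k] B.linear_d B.linear_d x]
    by (rule tensor_map_null[OF k factors_B factors_B x B.d_d])
  show "pT i (dA i x) = dB i (pT (Suc i) x)" if x: "x \<in> carrier (tA (Suc i))" for i x
    unfolding tensor_map_comp[OF k factors_A factors_A factors_B scalar_change_id[OF k] MAB A.linear_d p.semilinear_F x]
      tensor_map_comp[OF k factors_A factors_B factors_B MAB scalar_change_id[OF k] p.semilinear_F B.linear_d x]
    by (rule tensor_map_cong[OF k mapAB semilinear_comp[OF p.semilinear_F B.linear_d] p.F_chain[symmetric] x])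
      (auto intro: \<pi>_closed)
  show "qT i (dB i x) = dA i (qT (Suc i) x)" if x: "x \<in> carrier (tB (Suc i))" for i x
    unfolding tensor_map_comp[OF k factors_B factors_B factors_A scalar_change_id[OF k] MBA B.linear_d q.semilinear_F x]
      tensor_map_comp[OF k factors_B factors_A factors_A MBA scalar_change_id[OF k] q.semilinear_F A.linear_d x]
    by (rule tensor_map_cong[OF k mapBA semilinear_comp[OF q.semilinear_F A.linear_d] q.F_chain[symmetric] x])
      (auto intro: \<iota>_closed)
  show "\<exists>y\<in>carrier (tA (Suc i)). qT i (pT i x) = dA i y \<oplus>\<^bsub>tA i\<^esub> x" if x: "x \<in> cycles tA dA i" for i x
  proof -
    have "x \<in> carrier (tA i)" using x by (auto simp: cycles_def split: nat.splits)
    then show ?thesis using tensor_homotopy[OF x] semilinearD(1)[OF linear_hT] by blast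
  qed
  show "\<exists>y\<in>carrier (tB (Suc i)). pT i (qT i x) = dB i y \<oplus>\<^bsub>tB i\<^esub> x" if x: "x \<in> cycles tB dB i" for i x
  proof -
    have xc: "x \<in> carrier (tB i)" using x by (auto simp: cycles_def split: nat.splits)
    have "pT i (qT i x) = tensor_map k B MB (B.P i) (\<lambda>x. p.F i (q.F i x)) x"
      by (rule tensor_map_comp[OF k factors_B factors_A factors_B MBA MAB q.semilinear_F p.semilinear_F xc])
    also have "\<dots> = tensor_map k B MB (B.P i) (\<lambda>x. x) x"
      by (rule tensor_map_cong[OF k mapB linear_id pq_F xc])
    also have "\<dots> = x" by (rule tensor_map_id[OF k factors_B xc])
    finally have "pT i (qT i x) = x" .
    \<comment> \<open>This composite is the identity already on chains, so the zero chain serves as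
      the witness.\<close>
    moreover have "dB i \<zero>\<^bsub>tB (Suc i)\<^esub> = \<zero>\<^bsub>tB i\<^esub>"
      using module_tB by (intro semilinear_zero(1)[OF linear_dB]) (simp_all add: module_def)
    moreover have "\<zero>\<^bsub>tB (Suc i)\<^esub> \<in> carrier (tB (Suc i))" "\<zero>\<^bsub>tB i\<^esub> \<oplus>\<^bsub>tB i\<^esub> x = x"
      using module_tB xc by (simp_all add: module_def abelian_group_def abelian_monoid.zero_closed abelian_monoid.l_zero)
    ultimately show ?thesis by metis
  qed
qed

end

section \<open>Twisted monoid algebras\<close>

locale k_algebra = L: left_module k A + A: ring A + k: cring k
  for k :: "('k, 'z) ring_scheme" and A :: "('k, 'a, 'y) module_scheme" +
  assumes smult_mult_l: "\<lbrakk>c \<in> carrier k; a \<in> carrier A; b \<in> carrier A\<rbrakk> \<Longrightarrow>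
      (c \<odot>\<^bsub>A\<^esub> a) \<otimes>\<^bsub>A\<^esub> b = c \<odot>\<^bsub>A\<^esub> (a \<otimes>\<^bsub>A\<^esub> b)"
    and smult_mult_r: "\<lbrakk>c \<in> carrier k; a \<in> carrier A; b \<in> carrier A\<rbrakk> \<Longrightarrow>
      a \<otimes>\<^bsub>A\<^esub> (c \<odot>\<^bsub>A\<^esub> b) = c \<odot>\<^bsub>A\<^esub> (a \<otimes>\<^bsub>A\<^esub> b)"
begin

lemma linear_mult_left: "b \<in> carrier A \<Longrightarrow> linear k A A (\<lambda>a. a \<otimes>\<^bsub>A\<^esub> b)"
  by (auto simp: semilinear_def A.l_distr smult_mult_l)

lemma linear_mult_right: "a \<in> carrier A \<Longrightarrow> linear k A A (\<lambda>b. a \<otimes>\<^bsub>A\<^esub> b)"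
  by (auto simp: semilinear_def A.r_distr smult_mult_r)

end

lemma linear_smult:
  assumes "linear k M N F" "cring k" "left_module k N" "c \<in> carrier k"
  shows "linear k M N (\<lambda>x. c \<odot>\<^bsub>N\<^esub> F x)"
proof -
  interpret cring k by fact
  interpret N: left_module k N by fact
  show ?thesis
    using assms(1,4) by (auto simp: semilinear_def Pi_iff N.smult_r_distr N.smult_assoc1[symmetric] m_comm)
qed

text \<open>On basis vectors, \<open>cocycle\<close> makes the twisted product associative, and the
  normalisation \<open>\<alpha>_one\<close> makes the basis vector of the unit a unit.\<close>

locale twisted_monoid = S: monoid S + k: cring k
  for k :: "('k, 'z) ring_scheme" and S :: "('s, 'y) monoid_scheme" +
  fixes \<alpha>
  assumes \<alpha>_closed: "\<lbrakk>x \<in> carrier S; y \<in> carrier S\<rbrakk> \<Longrightarrow> \<alpha> x y \<in> carrier k"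
    and cocycle: "\<lbrakk>x \<in> carrier S; y \<in> carrier S; z \<in> carrier S\<rbrakk> \<Longrightarrow>
      \<alpha> x y \<otimes>\<^bsub>k\<^esub> \<alpha> (x \<otimes>\<^bsub>S\<^esub> y) z = \<alpha> y z \<otimes>\<^bsub>k\<^esub> \<alpha> x (y \<otimes>\<^bsub>S\<^esub> z)"
    and \<alpha>_one: "x \<in> carrier S \<Longrightarrow> \<alpha> \<one>\<^bsub>S\<^esub> x = \<one>\<^bsub>k\<^esub>" "x \<in> carrier S \<Longrightarrow> \<alpha> x \<one>\<^bsub>S\<^esub> = \<one>\<^bsub>k\<^esub>"
begin

abbreviation "W \<equiv> twisted_monoid_algebra k S \<alpha>"
abbreviation "F \<equiv> free_module k (carrier S)"
abbreviation "bas \<equiv> basis_vec k"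

lemma W_simps: "carrier W = carrier F" "\<zero>\<^bsub>W\<^esub> = \<zero>\<^bsub>F\<^esub>" "\<one>\<^bsub>W\<^esub> = bas \<one>\<^bsub>S\<^esub>"
    "a \<oplus>\<^bsub>W\<^esub> b = a \<oplus>\<^bsub>F\<^esub> b" "c \<odot>\<^bsub>W\<^esub> a = c \<odot>\<^bsub>F\<^esub> a"
  by (simp_all add: twisted_monoid_algebra_def Let_def)

lemma W_mult: "a \<otimes>\<^bsub>W\<^esub> b = lin_ext k F (\<lambda>x. lin_ext k F (\<lambda>y. \<alpha> x y \<odot>\<^bsub>F\<^esub> bas (x \<otimes>\<^bsub>S\<^esub> y)) b) a"
  by (simp add: twisted_monoid_algebra_def Let_def)

sublocale F: left_module k F by (rule k.left_module_free)

lemma linear_W: "linear k W W = linear k F F" "linear k W M = linear k F M" "linear k M W = linear k M F"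
  by (auto simp: semilinear_def W_simps fun_eq_iff simp del: free_simps)

lemma term_closed: "\<lbrakk>x \<in> carrier S; y \<in> carrier S\<rbrakk> \<Longrightarrow> \<alpha> x y \<odot>\<^bsub>F\<^esub> bas (x \<otimes>\<^bsub>S\<^esub> y) \<in> carrier F"
  by (intro F.smult_closed \<alpha>_closed k.basis_closed S.m_closed)

lemma linear_inner: "x \<in> carrier S \<Longrightarrow> linear k F F (lin_ext k F (\<lambda>y. \<alpha> x y \<odot>\<^bsub>F\<^esub> bas (x \<otimes>\<^bsub>S\<^esub> y)))"
  by (intro F.linear_lin_ext Pi_I term_closed)

lemma linear_left: "b \<in> carrier F \<Longrightarrow> linear k F F (\<lambda>a. a \<otimes>\<^bsub>W\<^esub> b)"
  unfolding W_mult using semilinearD(1)[OF linear_inner] by (intro F.linear_lin_ext) auto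

lemma basis_mult_left:
  assumes "x \<in> carrier S" "b \<in> carrier F"
  shows "bas x \<otimes>\<^bsub>W\<^esub> b = lin_ext k F (\<lambda>y. \<alpha> x y \<odot>\<^bsub>F\<^esub> bas (x \<otimes>\<^bsub>S\<^esub> y)) b"
  unfolding W_mult by (rule F.lin_ext_basis) (rule semilinearD(1)[OF linear_inner[OF assms(1)] assms(2)])

lemma basis_mult:
  assumes "x \<in> carrier S" "y \<in> carrier S"
  shows "bas x \<otimes>\<^bsub>W\<^esub> bas y = \<alpha> x y \<odot>\<^bsub>F\<^esub> bas (x \<otimes>\<^bsub>S\<^esub> y)"
  using assms by (simp add: basis_mult_left F.lin_ext_basis term_closed del: free_simps)

lemma mult_closed: "a \<in> carrier F \<Longrightarrow> b \<in> carrier F \<Longrightarrow> a \<otimes>\<^bsub>W\<^esub> b \<in> carrier F"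
  using semilinearD(1)[OF linear_left] .

lemmas F_eqI = semilinear_free_eqI[OF k.ring_axioms]

text \<open>Linearity in the first factor is immediate from the outer extension in the product. For
  the second factor both sides are compared as linear maps of \<open>a\<close>; on basis vectors
  only the inner extension is left.\<close>

lemma right_laws:
  assumes a: "a \<in> carrier F" and b: "b \<in> carrier F"
  shows "b' \<in> carrier F \<Longrightarrow> a \<otimes>\<^bsub>W\<^esub> (b \<oplus>\<^bsub>F\<^esub> b') = (a \<otimes>\<^bsub>W\<^esub> b) \<oplus>\<^bsub>F\<^esub> (a \<otimes>\<^bsub>W\<^esub> b')"
    and "c \<in> carrier k \<Longrightarrow> a \<otimes>\<^bsub>W\<^esub> (c \<odot>\<^bsub>F\<^esub> b) = c \<odot>\<^bsub>F\<^esub> (a \<otimes>\<^bsub>W\<^esub> b)"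
proof -
  assume b': "b' \<in> carrier F"
  show "a \<otimes>\<^bsub>W\<^esub> (b \<oplus>\<^bsub>F\<^esub> b') = (a \<otimes>\<^bsub>W\<^esub> b) \<oplus>\<^bsub>F\<^esub> (a \<otimes>\<^bsub>W\<^esub> b')"
  proof (rule F_eqI[OF F.M.abelian_group_axioms linear_left _ _ a])
    show "linear k F F (\<lambda>a. (a \<otimes>\<^bsub>W\<^esub> b) \<oplus>\<^bsub>F\<^esub> (a \<otimes>\<^bsub>W\<^esub> b'))"
      by (rule semilinear_add[OF linear_left[OF b] linear_left[OF b'] F.left_module_axioms]) simp
    show "bas x \<otimes>\<^bsub>W\<^esub> (b \<oplus>\<^bsub>F\<^esub> b') = (bas x \<otimes>\<^bsub>W\<^esub> b) \<oplus>\<^bsub>F\<^esub> (bas x \<otimes>\<^bsub>W\<^esub> b')" if x: "x \<in> carrier S" for x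
      using semilinearD(2)[OF linear_inner[OF x] b b']
      by (simp only: basis_mult_left[OF x b] basis_mult_left[OF x b'] basis_mult_left[OF x F.M.a_closed[OF b b']])
  qed (rule F.M.a_closed[OF b b'])
next
  assume c: "c \<in> carrier k"
  show "a \<otimes>\<^bsub>W\<^esub> (c \<odot>\<^bsub>F\<^esub> b) = c \<odot>\<^bsub>F\<^esub> (a \<otimes>\<^bsub>W\<^esub> b)"
  proof (rule F_eqI[OF F.M.abelian_group_axioms linear_left _ _ a])
    show "linear k F F (\<lambda>a. c \<odot>\<^bsub>F\<^esub> (a \<otimes>\<^bsub>W\<^esub> b))"
      by (rule linear_smult[OF linear_left[OF b] k.is_cring F.left_module_axioms c])
    show "bas x \<otimes>\<^bsub>W\<^esub> (c \<odot>\<^bsub>F\<^esub> b) = c \<odot>\<^bsub>F\<^esub> (bas x \<otimes>\<^bsub>W\<^esub> b)" if x: "x \<in> carrier S" for x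
      using semilinearD(3)[OF linear_inner[OF x] c b]
      by (simp only: basis_mult_left[OF x b] basis_mult_left[OF x F.smult_closed[OF c b]])
  qed (rule F.smult_closed[OF c b])
qed

lemma linear_right: "a \<in> carrier F \<Longrightarrow> linear k F F (\<lambda>b. a \<otimes>\<^bsub>W\<^esub> b)"
  by (auto simp: semilinear_def right_laws mult_closed simp del: free_simps)

lemma linear_comp: "linear k M N f \<Longrightarrow> linear k N P g \<Longrightarrow> linear k M P (\<lambda>x. g (f x))"
  by (rule semilinear_comp[where \<rho> = "\<lambda>a. a" and \<rho>' = "\<lambda>a. a"]) auto

lemma basis_assoc:
  assumes "x \<in> carrier S" "y \<in> carrier S" "z \<in> carrier S"
  shows "(bas x \<otimes>\<^bsub>W\<^esub> bas y) \<otimes>\<^bsub>W\<^esub> bas z = bas x \<otimes>\<^bsub>W\<^esub> (bas y \<otimes>\<^bsub>W\<^esub> bas z)"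
proof -
  note c = assms S.m_closed[OF assms(1,2)] S.m_closed[OF assms(2,3)]
  have "(bas x \<otimes>\<^bsub>W\<^esub> bas y) \<otimes>\<^bsub>W\<^esub> bas z = \<alpha> x y \<odot>\<^bsub>F\<^esub> (bas (x \<otimes>\<^bsub>S\<^esub> y) \<otimes>\<^bsub>W\<^esub> bas z)"
    unfolding basis_mult[OF c(1,2)]
    by (rule semilinearD(3)[OF linear_left]) (use c \<alpha>_closed in auto)
  also have "\<dots> = (\<alpha> x y \<otimes>\<^bsub>k\<^esub> \<alpha> (x \<otimes>\<^bsub>S\<^esub> y) z) \<odot>\<^bsub>F\<^esub> bas (x \<otimes>\<^bsub>S\<^esub> y \<otimes>\<^bsub>S\<^esub> z)"
    unfolding basis_mult[OF c(4,3)] using c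
    by (intro F.smult_assoc1[symmetric] \<alpha>_closed k.basis_closed) auto
  also have "\<dots> = (\<alpha> y z \<otimes>\<^bsub>k\<^esub> \<alpha> x (y \<otimes>\<^bsub>S\<^esub> z)) \<odot>\<^bsub>F\<^esub> bas (x \<otimes>\<^bsub>S\<^esub> (y \<otimes>\<^bsub>S\<^esub> z))"
    by (simp only: cocycle[OF c(1-3)] S.m_assoc[OF c(1-3)])
  also have "\<dots> = \<alpha> y z \<odot>\<^bsub>F\<^esub> (bas x \<otimes>\<^bsub>W\<^esub> bas (y \<otimes>\<^bsub>S\<^esub> z))"
    unfolding basis_mult[OF c(1,5)] using c
    by (intro F.smult_assoc1 \<alpha>_closed k.basis_closed) auto
  also have "\<dots> = bas x \<otimes>\<^bsub>W\<^esub> (bas y \<otimes>\<^bsub>W\<^esub> bas z)"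
    unfolding basis_mult[OF c(2,3)]
    by (rule semilinearD(3)[OF linear_right, symmetric]) (use c \<alpha>_closed in auto)
  finally show ?thesis .
qed

text \<open>Both sides are linear in each of the three factors, so three reductions to basis vectors
  leave \<open>basis_assoc\<close>.\<close>

lemma mult_assoc:
  assumes a: "a \<in> carrier F" and b: "b \<in> carrier F" and c: "c \<in> carrier F"
  shows "(a \<otimes>\<^bsub>W\<^esub> b) \<otimes>\<^bsub>W\<^esub> c = a \<otimes>\<^bsub>W\<^esub> (b \<otimes>\<^bsub>W\<^esub> c)"
proof (rule F_eqI[OF F.M.abelian_group_axioms linear_comp[OF linear_left linear_left] linear_left _ a])
  fix x assume x: "x \<in> carrier S"
  then have bx: "bas x \<in> carrier F" by simp
  show "(bas x \<otimes>\<^bsub>W\<^esub> b) \<otimes>\<^bsub>W\<^esub> c = bas x \<otimes>\<^bsub>W\<^esub> (b \<otimes>\<^bsub>W\<^esub> c)"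
  proof (rule F_eqI[OF F.M.abelian_group_axioms linear_comp[OF linear_right linear_left]
        linear_comp[OF linear_left linear_right] _ b])
    fix y assume y: "y \<in> carrier S"
    then have bs: "bas y \<in> carrier F" by simp
    show "(bas x \<otimes>\<^bsub>W\<^esub> bas y) \<otimes>\<^bsub>W\<^esub> c = bas x \<otimes>\<^bsub>W\<^esub> (bas y \<otimes>\<^bsub>W\<^esub> c)"
      by (rule F_eqI[OF F.M.abelian_group_axioms linear_right linear_comp[OF linear_right linear_right] _ c])
        (auto intro: basis_assoc mult_closed bx bs x y)
  qed (auto intro: bx c)
qed (auto intro: b c mult_closed)

lemma one_mult:
  assumes a: "a \<in> carrier F"
  shows "bas \<one>\<^bsub>S\<^esub> \<otimes>\<^bsub>W\<^esub> a = a" "a \<otimes>\<^bsub>W\<^esub> bas \<one>\<^bsub>S\<^esub> = a"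
proof -
  have o: "bas \<one>\<^bsub>S\<^esub> \<in> carrier F" by simp
  show "bas \<one>\<^bsub>S\<^esub> \<otimes>\<^bsub>W\<^esub> a = a"
    by (rule F_eqI[OF F.M.abelian_group_axioms linear_right[OF o] linear_id _ a])
      (simp add: basis_mult \<alpha>_one F.smult_one del: free_simps)
  show "a \<otimes>\<^bsub>W\<^esub> bas \<one>\<^bsub>S\<^esub> = a"
    by (rule F_eqI[OF F.M.abelian_group_axioms linear_left[OF o] linear_id _ a])
      (simp add: basis_mult \<alpha>_one F.smult_one del: free_simps)
qed

lemma k_algebra: "k_algebra k W"
proof -
  have ag: "abelian_group W"
    by (rule abelian_groupI)
      (use F.M.add.l_inv_ex in \<open>auto simp: W_simps F.M.a_ac F.M.l_zero simp del: free_simps\<close>)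
  have r: "ring W"
    by (intro ringI ag monoidI)
      (simp_all add: W_simps mult_closed mult_assoc one_mult semilinearD(2)[OF linear_left]
        semilinearD(2)[OF linear_right] F.M.add.m_comm del: free_simps)
  show ?thesis
    by (intro k_algebra.intro left_module.intro left_module_axioms.intro k_algebra_axioms.intro
        ag r k.ring_axioms k.is_cring)
      (simp_all add: W_simps F.smult_closed F.smult_l_distr F.smult_r_distr F.smult_assoc1 F.smult_one
        semilinearD(3)[OF linear_left] semilinearD(3)[OF linear_right] del: free_simps)
qed

sublocale W: k_algebra k W by (rule k_algebra)

text \<open>A map of the basis that is multiplicative up to \<open>\<alpha>\<close> extends to the
  algebra. The projection, the inclusion and the characters below are obtained in this way.\<close>

lemma lin_ext_ring_hom:
  assumes A: "k_algebra k A" and v: "v \<in> carrier S \<rightarrow> carrier A"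
    and one: "v \<one>\<^bsub>S\<^esub> = \<one>\<^bsub>A\<^esub>"
    and mult: "\<And>x y. \<lbrakk>x \<in> carrier S; y \<in> carrier S\<rbrakk> \<Longrightarrow> v x \<otimes>\<^bsub>A\<^esub> v y = \<alpha> x y \<odot>\<^bsub>A\<^esub> v (x \<otimes>\<^bsub>S\<^esub> y)"
  shows "lin_ext k A v \<in> ring_hom W A"
proof -
  interpret A: k_algebra k A by fact
  let ?f = "lin_ext k A v"
  have f: "linear k F A ?f" by (rule A.L.linear_lin_ext[OF v])
  have fb: "?f (bas x) = v x" if "x \<in> carrier S" for x
    using v that by (intro A.L.lin_ext_basis) auto
  have c: "?f a \<in> carrier A" if "a \<in> carrier F" for a using semilinearD(1)[OF f that] .
  have "?f (a \<otimes>\<^bsub>W\<^esub> b) = ?f a \<otimes>\<^bsub>A\<^esub> ?f b" if a: "a \<in> carrier F" and b: "b \<in> carrier F" for a b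
  proof (rule F_eqI[OF A.L.M.abelian_group_axioms linear_comp[OF linear_left[OF b] f]
        linear_comp[OF f A.linear_mult_left[OF c[OF b]]] _ a])
    fix x assume x: "x \<in> carrier S"
    have bx: "bas x \<in> carrier F" using x by simp
    show "?f (bas x \<otimes>\<^bsub>W\<^esub> b) = ?f (bas x) \<otimes>\<^bsub>A\<^esub> ?f b"
    proof (rule F_eqI[OF A.L.M.abelian_group_axioms linear_comp[OF linear_right[OF bx] f]
          linear_comp[OF f A.linear_mult_right[OF c[OF bx]]] _ b])
      fix y assume y: "y \<in> carrier S"
      show "?f (bas x \<otimes>\<^bsub>W\<^esub> bas y) = ?f (bas x) \<otimes>\<^bsub>A\<^esub> ?f (bas y)"
        using x y semilinearD(3)[OF f \<alpha>_closed[OF x y] k.basis_closed[OF S.m_closed[OF x y]]]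
        by (simp add: basis_mult fb mult del: free_simps)
    qed
  qed
  then show ?thesis
    by (intro ring_hom_memI) (simp_all add: W_simps c fb one semilinearD(2)[OF f] del: free_simps)
qed

end

section \<open>Characters of twisted monoid algebras\<close>

definition scalar_algebra :: "('k, 'z) ring_scheme \<Rightarrow> ('k, 'k) module" where
  "scalar_algebra k = \<lparr>carrier = carrier k, monoid.mult = monoid.mult k, one = \<one>\<^bsub>k\<^esub>,
     zero = \<zero>\<^bsub>k\<^esub>, add = add k, smult = monoid.mult k\<rparr>"

lemma scalar_algebra_simps [simp]:
  "carrier (scalar_algebra k) = carrier k" "x \<otimes>\<^bsub>scalar_algebra k\<^esub> y = x \<otimes>\<^bsub>k\<^esub> y"
  "\<one>\<^bsub>scalar_algebra k\<^esub> = \<one>\<^bsub>k\<^esub>" "\<zero>\<^bsub>scalar_algebra k\<^esub> = \<zero>\<^bsub>k\<^esub>"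
  "x \<oplus>\<^bsub>scalar_algebra k\<^esub> y = x \<oplus>\<^bsub>k\<^esub> y" "x \<odot>\<^bsub>scalar_algebra k\<^esub> y = x \<otimes>\<^bsub>k\<^esub> y"
  by (simp_all add: scalar_algebra_def)

lemma k_algebra_scalar:
  assumes "cring k"
  shows "k_algebra k (scalar_algebra k)"
proof -
  interpret cring k by fact
  have ag: "abelian_group (scalar_algebra k)"
    by (rule abelian_groupI) (use add.l_inv_ex in \<open>auto simp: a_ac\<close>)
  have r: "ring (scalar_algebra k)"
    by (intro ringI ag monoidI) (simp_all add: m_assoc l_distr r_distr)
  show ?thesis
    by (intro k_algebra.intro left_module.intro left_module_axioms.intro k_algebra_axioms.intro
        ag r ring_axioms assms) (simp_all add: m_ac l_distr r_distr)
qed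

lemma character_module_simps [simp]:
  "carrier (character_module k \<chi>) = carrier k" "\<zero>\<^bsub>character_module k \<chi>\<^esub> = \<zero>\<^bsub>k\<^esub>"
  "x \<oplus>\<^bsub>character_module k \<chi>\<^esub> y = x \<oplus>\<^bsub>k\<^esub> y"
  by (simp_all add: character_module_def)

lemma character_smult: "a \<odot>\<^bsub>character_module k \<chi>\<^esub> x = lin_ext k (scalar_algebra k) \<chi> a \<otimes>\<^bsub>k\<^esub> x"
  by (simp add: character_module_def lin_ext_def finsum_def finprod_def scalar_algebra_def)

text \<open>The conditions on \<open>\<chi>\<close> let it extend to a ring homomorphism into
  \<open>k\<close>, viewed as an algebra over itself; the module is \<open>k\<close> pulled back
  along this homomorphism.\<close>

lemma (in twisted_monoid) left_module_character:
  assumes "\<chi> \<in> carrier S \<rightarrow> carrier k" "\<chi> \<one>\<^bsub>S\<^esub> = \<one>\<^bsub>k\<^esub>"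
    and "\<And>x y. \<lbrakk>x \<in> carrier S; y \<in> carrier S\<rbrakk> \<Longrightarrow> \<chi> x \<otimes>\<^bsub>k\<^esub> \<chi> y = \<alpha> x y \<otimes>\<^bsub>k\<^esub> \<chi> (x \<otimes>\<^bsub>S\<^esub> y)"
  shows "left_module W (character_module k \<chi>)"
proof -
  have h: "lin_ext k (scalar_algebra k) \<chi> \<in> ring_hom W (scalar_algebra k)"
    by (rule lin_ext_ring_hom[OF k_algebra_scalar[OF k.is_cring]]) (use assms in auto)
  have ag: "abelian_group (character_module k \<chi>)"
    by (rule abelian_groupI) (use k.add.l_inv_ex in \<open>auto simp: k.a_ac\<close>)
  show ?thesis
    by (intro left_module.intro left_module_axioms.intro ag W.A.ring_axioms)
      (use ring_hom_closed[OF h] ring_hom_add[OF h] ring_hom_mult[OF h] ring_hom_one[OF h] in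
        \<open>simp_all add: character_smult k.l_distr k.r_distr k.m_assoc\<close>)
qed

section \<open>Retracts of monoids\<close>

lemma semilinear_character:
  assumes "\<And>a. a \<in> carrier W \<Longrightarrow> lin_ext k (scalar_algebra k) \<chi>' (\<rho> a) = lin_ext k (scalar_algebra k) \<chi> a"
  shows "semilinear W \<rho> (character_module k \<chi>) (character_module k \<chi>') (\<lambda>x. x)"
  using assms by (auto simp: semilinear_def character_smult)

text \<open>Linearity of \<open>\<rho>\<close> over \<open>k\<close> supplies the clause on scalars:
  it sends \<open>c 1\<close> in \<open>A\<close> to \<open>c 1\<close> in \<open>B\<close>.\<close>

lemma scalar_change_character:
  fixes A :: "('k, 's \<Rightarrow> 'k, 'y) module_scheme" and B :: "('k, 't \<Rightarrow> 'k, 'x) module_scheme"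
  assumes "k_algebra k A" "k_algebra k B" "\<rho> \<in> ring_hom A B" "linear k A B \<rho>"
    and \<chi>: "\<And>a. a \<in> carrier A \<Longrightarrow> lin_ext k (scalar_algebra k) \<chi>' (\<rho> a) = lin_ext k (scalar_algebra k) \<chi> a"
  shows "scalar_change k \<rho> A (character_module k \<chi>) B (character_module k \<chi>')"
proof -
  interpret A: k_algebra k A by fact
  have "\<rho> (c \<odot>\<^bsub>A\<^esub> \<one>\<^bsub>A\<^esub>) = c \<odot>\<^bsub>B\<^esub> \<one>\<^bsub>B\<^esub>" if "c \<in> carrier k" for c
    using semilinearD(3)[OF assms(4) that A.A.one_closed] ring_hom_one[OF assms(3)] by simp
  then have "lin_ext k (scalar_algebra k) \<chi>' (c \<odot>\<^bsub>B\<^esub> \<one>\<^bsub>B\<^esub>) = lin_ext k (scalar_algebra k) \<chi> (c \<odot>\<^bsub>A\<^esub> \<one>\<^bsub>A\<^esub>)"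
    if "c \<in> carrier k" for c
    using \<chi>[of "c \<odot>\<^bsub>A\<^esub> \<one>\<^bsub>A\<^esub>"] that by simp
  then show ?thesis
    using ring_hom_closed[OF assms(3)] \<chi> by (auto simp: scalar_change_def character_smult)
qed

text \<open>Models the permutation diagrams inside the rook monoid. By \<open>ideal\<close> the
  complement of the image of \<open>\<theta>\<close> is a two-sided ideal, which makes discarding it
  multiplicative; \<open>chi\<close> is the trivial character of the image, extended by
  zero.\<close>

locale monoid_retract = twisted_monoid k S \<alpha>
  for k :: "('k, 'z) ring_scheme" and S :: "('s, 'y) monoid_scheme" and \<alpha> +
  fixes \<Gamma> :: "('g, 'x) monoid_scheme" and \<theta> :: "'g \<Rightarrow> 's" and chi :: "'s \<Rightarrow> 'k"
  assumes \<Gamma>_mult: "\<lbrakk>g \<in> carrier \<Gamma>; h \<in> carrier \<Gamma>\<rbrakk> \<Longrightarrow> g \<otimes>\<^bsub>\<Gamma>\<^esub> h \<in> carrier \<Gamma>"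
    and \<Gamma>_one: "\<one>\<^bsub>\<Gamma>\<^esub> \<in> carrier \<Gamma>"
    and \<theta>_inj: "inj_on \<theta> (carrier \<Gamma>)"
    and \<theta>_closed: "g \<in> carrier \<Gamma> \<Longrightarrow> \<theta> g \<in> carrier S"
    and \<theta>_mult: "\<lbrakk>g \<in> carrier \<Gamma>; h \<in> carrier \<Gamma>\<rbrakk> \<Longrightarrow> \<theta> (g \<otimes>\<^bsub>\<Gamma>\<^esub> h) = \<theta> g \<otimes>\<^bsub>S\<^esub> \<theta> h"
    and \<theta>_one: "\<theta> \<one>\<^bsub>\<Gamma>\<^esub> = \<one>\<^bsub>S\<^esub>"
    and \<alpha>_\<theta>: "\<lbrakk>g \<in> carrier \<Gamma>; h \<in> carrier \<Gamma>\<rbrakk> \<Longrightarrow> \<alpha> (\<theta> g) (\<theta> h) = \<one>\<^bsub>k\<^esub>"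
    and ideal: "\<lbrakk>x \<in> carrier S; y \<in> carrier S; x \<otimes>\<^bsub>S\<^esub> y \<in> \<theta> ` carrier \<Gamma>\<rbrakk> \<Longrightarrow>
      x \<in> \<theta> ` carrier \<Gamma> \<and> y \<in> \<theta> ` carrier \<Gamma>"
    and chi_eq: "x \<in> carrier S \<Longrightarrow> chi x = (if x \<in> \<theta> ` carrier \<Gamma> then \<one>\<^bsub>k\<^esub> else \<zero>\<^bsub>k\<^esub>)"
begin

text \<open>The laws of \<open>S\<close> are pulled back along the injective map
  \<open>\<theta>\<close>.\<close>

lemma \<Gamma>_monoid: "monoid \<Gamma>"
proof (intro monoidI \<Gamma>_mult \<Gamma>_one)
  fix x y z assume c: "x \<in> carrier \<Gamma>" "y \<in> carrier \<Gamma>" "z \<in> carrier \<Gamma>"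
  then show "x \<otimes>\<^bsub>\<Gamma>\<^esub> y \<otimes>\<^bsub>\<Gamma>\<^esub> z = x \<otimes>\<^bsub>\<Gamma>\<^esub> (y \<otimes>\<^bsub>\<Gamma>\<^esub> z)"
    by (intro inj_onD[OF \<theta>_inj]) (simp_all add: \<theta>_mult \<Gamma>_mult \<theta>_closed S.m_assoc)
next
  fix x assume c: "x \<in> carrier \<Gamma>"
  show "\<one>\<^bsub>\<Gamma>\<^esub> \<otimes>\<^bsub>\<Gamma>\<^esub> x = x" "x \<otimes>\<^bsub>\<Gamma>\<^esub> \<one>\<^bsub>\<Gamma>\<^esub> = x"
    by (rule inj_onD[OF \<theta>_inj]; simp add: c \<theta>_mult \<Gamma>_mult \<theta>_closed \<theta>_one \<Gamma>_one)+
qed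

sublocale B: twisted_monoid k \<Gamma> "\<lambda>_ _. \<one>\<^bsub>k\<^esub>"
proof -
  interpret \<Gamma>: monoid \<Gamma> by (rule \<Gamma>_monoid)
  show "twisted_monoid k \<Gamma> (\<lambda>_ _. \<one>\<^bsub>k\<^esub>)" by unfold_locales auto
qed

definition proj_basis :: "'s \<Rightarrow> 'g \<Rightarrow> 'k" where
  "proj_basis x = (if x \<in> \<theta> ` carrier \<Gamma> then basis_vec k (inv_into (carrier \<Gamma>) \<theta> x) else \<zero>\<^bsub>B.W\<^esub>)"

definition proj :: "('s \<Rightarrow> 'k) \<Rightarrow> 'g \<Rightarrow> 'k" where
  "proj = lin_ext k B.W proj_basis"

definition incl :: "('g \<Rightarrow> 'k) \<Rightarrow> 's \<Rightarrow> 'k" where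
  "incl = lin_ext k W (\<lambda>g. bas (\<theta> g))"

lemma proj_basis_image: "g \<in> carrier \<Gamma> \<Longrightarrow> proj_basis (\<theta> g) = bas g"
  using \<theta>_inj by (simp add: proj_basis_def)

lemma proj_basis_other: "x \<notin> \<theta> ` carrier \<Gamma> \<Longrightarrow> proj_basis x = \<zero>\<^bsub>B.W\<^esub>"
  by (simp add: proj_basis_def)

lemma proj_basis_closed: "proj_basis x \<in> carrier B.W"
  using \<theta>_inj unfolding proj_basis_def by (auto simp: B.W_simps(1) simp del: free_simps intro: B.W.L.M.zero_closed[unfolded B.W_simps(1)])

text \<open>If a factor lies in the complement, so does the product, and both sides vanish. On the
  image, \<open>\<alpha>\<close> is 1 and \<open>\<theta>\<close> is multiplicative.\<close>

lemma proj_hom: "proj \<in> ring_hom W B.W"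
  unfolding proj_def
proof (rule lin_ext_ring_hom[OF B.k_algebra])
  show "proj_basis \<in> carrier S \<rightarrow> carrier B.W" using proj_basis_closed by simp
  show "proj_basis \<one>\<^bsub>S\<^esub> = \<one>\<^bsub>B.W\<^esub>"
    using proj_basis_image[OF \<Gamma>_one] by (simp add: \<theta>_one B.W_simps)
  show "proj_basis x \<otimes>\<^bsub>B.W\<^esub> proj_basis y = \<alpha> x y \<odot>\<^bsub>B.W\<^esub> proj_basis (x \<otimes>\<^bsub>S\<^esub> y)"
    if x: "x \<in> carrier S" and y: "y \<in> carrier S" for x y
  proof (cases "x \<in> \<theta> ` carrier \<Gamma> \<and> y \<in> \<theta> ` carrier \<Gamma>")
    case True
    then obtain g h where gh: "g \<in> carrier \<Gamma>" "h \<in> carrier \<Gamma>" "x = \<theta> g" "y = \<theta> h" by auto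
    then show ?thesis
      using proj_basis_image[OF \<Gamma>_mult[OF gh(1,2)]]
      by (simp add: proj_basis_image \<alpha>_\<theta> \<theta>_mult[symmetric] B.basis_mult B.W_simps(5) del: free_simps)
  next
    case False
    then have "proj_basis (x \<otimes>\<^bsub>S\<^esub> y) = \<zero>\<^bsub>B.W\<^esub>" using ideal[OF x y] by (intro proj_basis_other) auto
    moreover have "proj_basis x \<otimes>\<^bsub>B.W\<^esub> proj_basis y = \<zero>\<^bsub>B.W\<^esub>"
      using False proj_basis_other[of x] proj_basis_other[of y] proj_basis_closed[of x] proj_basis_closed[of y]
      by (metis B.W.A.l_null B.W.A.r_null)
    ultimately show ?thesis using \<alpha>_closed[OF x y] by (simp add: B.W.L.smult_r_null)
  qed
qed

lemma incl_hom: "incl \<in> ring_hom B.W W"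
  unfolding incl_def
  by (rule B.lin_ext_ring_hom[OF k_algebra])
    (use \<theta>_closed \<Gamma>_one in \<open>auto simp: \<theta>_one basis_mult \<theta>_mult \<alpha>_\<theta> W_simps(1,3,5) \<Gamma>_mult simp del: free_simps\<close>)

lemma linear_proj: "linear k W B.W proj"
  unfolding proj_def linear_W by (intro B.W.L.linear_lin_ext) (simp add: proj_basis_closed)

lemma linear_incl: "linear k B.W W incl"
  unfolding incl_def B.linear_W by (intro W.L.linear_lin_ext) (simp add: W_simps(1) \<theta>_closed)

lemma proj_bas: "x \<in> carrier S \<Longrightarrow> proj (bas x) = proj_basis x"
  unfolding proj_def by (intro B.W.L.lin_ext_basis proj_basis_closed)

lemma incl_bas: "g \<in> carrier \<Gamma> \<Longrightarrow> incl (bas g) = bas (\<theta> g)"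
  unfolding incl_def by (intro W.L.lin_ext_basis) (simp add: W_simps(1) \<theta>_closed)

lemma W_eqI:
  assumes "abelian_group N" "linear k W N f" "linear k W N g"
    "\<And>x. x \<in> carrier S \<Longrightarrow> f (bas x) = g (bas x)" "a \<in> carrier W"
  shows "f a = g a"
  using F_eqI[OF assms(1) assms(2,3)[unfolded linear_W] assms(4)] assms(5) by (simp add: W_simps(1))

lemma BW_eqI:
  assumes "abelian_group N" "linear k B.W N f" "linear k B.W N g"
    "\<And>x. x \<in> carrier \<Gamma> \<Longrightarrow> f (bas x) = g (bas x)" "a \<in> carrier B.W"
  shows "f a = g a"
  using B.F_eqI[OF assms(1) assms(2,3)[unfolded B.linear_W] assms(4)] assms(5) by (simp add: B.W_simps(1))

lemma proj_incl: "b \<in> carrier B.W \<Longrightarrow> proj (incl b) = b"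
  by (rule BW_eqI[OF B.W.L.M.abelian_group_axioms linear_comp[OF linear_incl linear_proj] linear_id])
    (simp_all add: incl_bas proj_bas proj_basis_image \<theta>_closed)

abbreviation "chiA \<equiv> lin_ext k (scalar_algebra k) chi"
abbreviation "chiB \<equiv> lin_ext k (scalar_algebra k) (\<lambda>_. \<one>\<^bsub>k\<^esub>)"

lemma left_module_chi: "left_module W (character_module k chi)"
proof (rule left_module_character)
  show "chi \<one>\<^bsub>S\<^esub> = \<one>\<^bsub>k\<^esub>" using \<Gamma>_one \<theta>_one chi_eq[OF S.one_closed] by (metis image_eqI)
  show "chi x \<otimes>\<^bsub>k\<^esub> chi y = \<alpha> x y \<otimes>\<^bsub>k\<^esub> chi (x \<otimes>\<^bsub>S\<^esub> y)" if x: "x \<in> carrier S" and y: "y \<in> carrier S" for x y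
  proof (cases "x \<in> \<theta> ` carrier \<Gamma> \<and> y \<in> \<theta> ` carrier \<Gamma>")
    case True
    then obtain g h where gh: "g \<in> carrier \<Gamma>" "h \<in> carrier \<Gamma>" "x = \<theta> g" "y = \<theta> h" by auto
    then show ?thesis by (simp add: chi_eq \<alpha>_\<theta> \<theta>_mult[symmetric] \<Gamma>_mult \<theta>_closed)
  next
    case False
    then have "chi (x \<otimes>\<^bsub>S\<^esub> y) = \<zero>\<^bsub>k\<^esub>" using ideal[OF x y] x y by (auto simp: chi_eq)
    moreover have "chi x \<otimes>\<^bsub>k\<^esub> chi y = \<zero>\<^bsub>k\<^esub>" using False x y by (auto simp: chi_eq)
    ultimately show ?thesis using \<alpha>_closed[OF x y] by simp
  qed
qed (simp add: chi_eq)

lemma left_module_one: "left_module B.W (character_module k (\<lambda>_. \<one>\<^bsub>k\<^esub>))"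
  by (rule B.left_module_character) auto

interpretation K: k_algebra k "scalar_algebra k"
  by (rule k_algebra_scalar[OF k.is_cring])

lemma linear_chiA: "linear k W (scalar_algebra k) chiA"
  unfolding linear_W by (rule K.L.linear_lin_ext) (simp add: chi_eq)

lemma linear_chiB: "linear k B.W (scalar_algebra k) chiB"
  unfolding B.linear_W by (rule K.L.linear_lin_ext) simp

text \<open>The trivial module of \<open>W\<close> is thus pulled back along \<open>proj\<close>; in
  particular every element that \<open>proj\<close> sends to the unit acts on it as the
  identity.\<close>

lemma chi_proj: "a \<in> carrier W \<Longrightarrow> chiB (proj a) = chiA a"
proof (rule W_eqI[OF K.L.M.abelian_group_axioms linear_comp[OF linear_proj linear_chiB] linear_chiA])
  fix x assume x: "x \<in> carrier S"
  have A: "chiA (bas x) = chi x" by (rule K.L.lin_ext_basis) (simp add: chi_eq x)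
  show "chiB (proj (bas x)) = chiA (bas x)"
  proof (cases "x \<in> \<theta> ` carrier \<Gamma>")
    case True
    then obtain g where g: "g \<in> carrier \<Gamma>" "x = \<theta> g" by auto
    have "chiB (bas g) = \<one>\<^bsub>k\<^esub>" by (rule K.L.lin_ext_basis) simp
    moreover have "chi x = \<one>\<^bsub>k\<^esub>" using True x by (simp add: chi_eq)
    ultimately show ?thesis using A proj_bas[OF x] proj_basis_image[OF g(1)] g(2) by simp
  next
    case False
    have "chiB \<zero>\<^bsub>B.W\<^esub> = \<zero>\<^bsub>k\<^esub>"
      using semilinear_zero(1)[OF linear_chiB B.W.L.M.abelian_group_axioms K.L.M.abelian_group_axioms] by simp
    then show ?thesis using False x by (simp add: A proj_bas proj_basis_other chi_eq)
  qed
qed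

lemma chi_incl: "b \<in> carrier B.W \<Longrightarrow> chiA (incl b) = chiB b"
  using chi_proj[of "incl b"] proj_incl[of b] semilinearD(1)[OF linear_incl, of b] by simp

text \<open>The map \<open>incl\<close> after \<open>proj\<close> fixes the basis vectors of the
  image and kills those of the complement, which \<open>eL\<close> kills as well.\<close>

lemma annihilator_absorb:
  assumes eL: "eL \<in> carrier W" "\<forall>x\<in>carrier S - \<theta> ` carrier \<Gamma>. eL \<otimes>\<^bsub>W\<^esub> bas x = \<zero>\<^bsub>W\<^esub>"
    and a: "a \<in> carrier W"
  shows "eL \<otimes>\<^bsub>W\<^esub> incl (proj a) = eL \<otimes>\<^bsub>W\<^esub> a"
proof (rule W_eqI[OF W.L.M.abelian_group_axioms
      linear_comp[OF linear_comp[OF linear_proj linear_incl] W.linear_mult_right[OF eL(1)]] W.linear_mult_right[OF eL(1)] _ a])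
  fix x assume x: "x \<in> carrier S"
  have "incl \<zero>\<^bsub>B.W\<^esub> = \<zero>\<^bsub>W\<^esub>"
    by (rule semilinear_zero(1)[OF linear_incl B.W.L.M.abelian_group_axioms W.L.M.abelian_group_axioms])
  then show "eL \<otimes>\<^bsub>W\<^esub> incl (proj (bas x)) = eL \<otimes>\<^bsub>W\<^esub> bas x"
    using x eL by (cases "x \<in> \<theta> ` carrier \<Gamma>") (auto simp: proj_bas proj_basis_image incl_bas proj_basis_other)
qed

lemma annihilator_absorb':
  assumes eR: "eR \<in> carrier W" "\<forall>x\<in>carrier S - \<theta> ` carrier \<Gamma>. bas x \<otimes>\<^bsub>W\<^esub> eR = \<zero>\<^bsub>W\<^esub>"
    and a: "a \<in> carrier W"
  shows "incl (proj a) \<otimes>\<^bsub>W\<^esub> eR = a \<otimes>\<^bsub>W\<^esub> eR"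
proof (rule W_eqI[OF W.L.M.abelian_group_axioms
      linear_comp[OF linear_comp[OF linear_proj linear_incl] W.linear_mult_left[OF eR(1)]] W.linear_mult_left[OF eR(1)] _ a])
  fix x assume x: "x \<in> carrier S"
  have "incl \<zero>\<^bsub>B.W\<^esub> = \<zero>\<^bsub>W\<^esub>"
    by (rule semilinear_zero(1)[OF linear_incl B.W.L.M.abelian_group_axioms W.L.M.abelian_group_axioms])
  then show "incl (proj (bas x)) \<otimes>\<^bsub>W\<^esub> eR = bas x \<otimes>\<^bsub>W\<^esub> eR"
    using x eR by (cases "x \<in> \<theta> ` carrier \<Gamma>") (auto simp: proj_bas proj_basis_image incl_bas proj_basis_other)
qed

theorem Tor_character_iso:
  assumes eL: "eL \<in> carrier W" "proj eL = \<one>\<^bsub>B.W\<^esub>"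
      "\<forall>x\<in>carrier S - \<theta> ` carrier \<Gamma>. eL \<otimes>\<^bsub>W\<^esub> bas x = \<zero>\<^bsub>W\<^esub>"
    and eR: "eR \<in> carrier W" "proj eR = \<one>\<^bsub>B.W\<^esub>"
      "\<forall>x\<in>carrier S - \<theta> ` carrier \<Gamma>. bas x \<otimes>\<^bsub>W\<^esub> eR = \<zero>\<^bsub>W\<^esub>"
  shows "graded_module_iso k (Tor k W (character_module k chi) (character_module k chi))
    (Tor k (group_algebra k \<Gamma>) (group_trivial_module k) (group_trivial_module k))"
proof -
  note L = annihilator_absorb[OF eL(1,3)] and R = annihilator_absorb'[OF eR(1,3)]
  have incl1: "incl \<one>\<^bsub>B.W\<^esub> = \<one>\<^bsub>W\<^esub>" by (rule ring_hom_one[OF incl_hom])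
  note pm = ring_hom_mult[OF proj_hom] and pc = ring_hom_closed[OF proj_hom]
  \<comment> \<open>Both equal the product of \<open>eL\<close> and \<open>eR\<close>: by
    \<open>L\<close> the right factor may be replaced by \<open>incl (proj eR)\<close>, by
    \<open>R\<close> the left factor by \<open>incl (proj eL)\<close>, and both replacements are the
    unit.\<close>
  have "eL = eR"
    using L[OF eR(1)] R[OF eL(1)] eL(1) eR(1) by (simp add: eL(2) eR(2) incl1)
  note R' = R[folded this] and e = eL(1)
  have ee: "eL \<otimes>\<^bsub>W\<^esub> eL = eL" using L[OF e] e by (simp add: eL(2) incl1)
  \<comment> \<open>Both sides equal the product of \<open>eL\<close>, \<open>a\<close> and
    \<open>eL\<close>. Next to a factor \<open>eL\<close> only the image under \<open>proj\<close>
    matters, and \<open>proj\<close> does not notice a further factor \<open>eL\<close>; this is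
    applied once from the left and once from the right.\<close>
  have comm: "eL \<otimes>\<^bsub>W\<^esub> a = a \<otimes>\<^bsub>W\<^esub> eL" if a: "a \<in> carrier W" for a
  proof -
    have "eL \<otimes>\<^bsub>W\<^esub> a = eL \<otimes>\<^bsub>W\<^esub> incl (proj (a \<otimes>\<^bsub>W\<^esub> eL))"
      using L[OF a] a e by (simp add: pm eL(2) pc)
    also have "\<dots> = eL \<otimes>\<^bsub>W\<^esub> (a \<otimes>\<^bsub>W\<^esub> eL)" using a e by (intro L) simp
    also have "\<dots> = (eL \<otimes>\<^bsub>W\<^esub> a) \<otimes>\<^bsub>W\<^esub> eL" using a e by (simp add: W.A.m_assoc)
    also have "\<dots> = incl (proj (eL \<otimes>\<^bsub>W\<^esub> a)) \<otimes>\<^bsub>W\<^esub> eL" using a e by (intro R'[symmetric]) simp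
    also have "\<dots> = a \<otimes>\<^bsub>W\<^esub> eL"
      using R'[OF a] a e by (simp add: pm eL(2) pc)
    finally show ?thesis .
  qed
  have chi_e: "chiA eL = \<one>\<^bsub>k\<^esub>"
  proof -
    have "chiB (bas \<one>\<^bsub>\<Gamma>\<^esub>) = \<one>\<^bsub>k\<^esub>" by (rule K.L.lin_ext_basis) simp
    then show ?thesis using chi_proj[OF e] by (simp add: eL(2) B.W_simps(3))
  qed
  have "algebra_retract W (character_module k chi) B.W (character_module k (\<lambda>_. \<one>\<^bsub>k\<^esub>)) k
      (character_module k chi) (character_module k (\<lambda>_. \<one>\<^bsub>k\<^esub>)) proj incl eL"
  proof (intro algebra_retract.intro algebra_retract_axioms.intro left_module_chi left_module_one k.is_cring
        proj_hom incl_hom proj_incl e ee comm eL(2) L semilinear_character chi_proj chi_incl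
        scalar_change_character k_algebra B.k_algebra linear_proj linear_incl
        W.L.smult_closed B.W.L.smult_closed W.A.one_closed B.W.A.one_closed)
    show "eL \<odot>\<^bsub>character_module k chi\<^esub> x = x" if "x \<in> carrier (character_module k chi)" for x
      using that by (simp add: character_smult chi_e)
    show "m \<oplus>\<^bsub>character_module k chi\<^esub> m' \<in> carrier (character_module k chi)"
      if "m \<in> carrier (character_module k chi)" "m' \<in> carrier (character_module k chi)" for m m'
      using that by simp
    show "a \<odot>\<^bsub>character_module k chi\<^esub> m \<in> carrier (character_module k chi)"
      if "a \<in> carrier W" "m \<in> carrier (character_module k chi)" for a m
      using that left_module.smult_closed[OF left_module_chi] by blast
  qed
  from algebra_retract.Tor_iso[OF this] show ?thesis
    by (simp add: group_algebra_def group_trivial_module_def)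
qed

end

section \<open>Rook diagrams\<close>

lemma rook_diagrams_iff:
  "D \<in> rook_diagrams G n \<longleftrightarrow>
     (\<forall>i g j. (i, g, j) \<in> D \<longrightarrow> i \<in> {1..n} \<and> g \<in> carrier G \<and> j \<in> {1..n}) \<and>
     (\<forall>i g j g' j'. (i, g, j) \<in> D \<longrightarrow> (i, g', j') \<in> D \<longrightarrow> g = g' \<and> j = j') \<and>
     (\<forall>i g j i' g'. (i, g, j) \<in> D \<longrightarrow> (i', g', j) \<in> D \<longrightarrow> i = i' \<and> g = g')"
  unfolding rook_diagrams_def by fast

lemma rook_diagramsD:
  assumes "D \<in> rook_diagrams G n"
  shows "(i, g, j) \<in> D \<Longrightarrow> i \<in> {1..n}" "(i, g, j) \<in> D \<Longrightarrow> g \<in> carrier G" "(i, g, j) \<in> D \<Longrightarrow> j \<in> {1..n}"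
    and "\<lbrakk>(i, g, j) \<in> D; (i, g', j') \<in> D\<rbrakk> \<Longrightarrow> g = g' \<and> j = j'"
    and "\<lbrakk>(i, g, j) \<in> D; (i', g', j) \<in> D\<rbrakk> \<Longrightarrow> i = i' \<and> g = g'"
  using assms unfolding rook_diagrams_iff by blast+

text \<open>No two edges share an end, so edges correspond to the attached nodes of either column.
  The number of edges, the rank, carries all the counting that follows.\<close>

lemma rook_card:
  assumes "D \<in> rook_diagrams G n"
  shows "Collect (left_attached D) \<subseteq> {1..n}" "Collect (right_attached D) \<subseteq> {1..n}"
    and "card (Collect (left_attached D)) = card D" "card (Collect (right_attached D)) = card D"
    and "finite D" "card D \<le> n"
proof -
  note D = rook_diagramsD[OF assms]
  have l: "Collect (left_attached D) = fst ` D" by (force simp: left_attached_def)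
  have r: "Collect (right_attached D) = (snd \<circ> snd) ` D" by (force simp: right_attached_def)
  have il: "inj_on fst D" using D(4) by (auto simp: inj_on_def)
  have ir: "inj_on (snd \<circ> snd) D" using D(5) by (auto simp: inj_on_def)
  show ls: "Collect (left_attached D) \<subseteq> {1..n}" using D(1) by (auto simp: left_attached_def)
  show "Collect (right_attached D) \<subseteq> {1..n}" using D(3) by (auto simp: right_attached_def)
  show lc: "card (Collect (left_attached D)) = card D" unfolding l by (rule card_image[OF il])
  show "card (Collect (right_attached D)) = card D" unfolding r by (rule card_image[OF ir])
  show "finite D" using ls finite_imageD[OF _ il] finite_subset[OF ls] by (simp add: l)
  show "card D \<le> n" using card_mono[OF _ ls] lc by simp
qed

text \<open>Both columns have \<open>card D\<close> attached nodes, so a diagram that misses a node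
  on one side misses one on the other. Annihilators from the left and from the right thus concern
  the same diagrams.\<close>

lemma rook_full_iff:
  assumes "D \<in> rook_diagrams G n"
  shows "no_missing_edges n D \<longleftrightarrow> card D = n"
    and "card D = n \<longleftrightarrow> Collect (left_attached D) = {1..n}"
    and "card D = n \<longleftrightarrow> Collect (right_attached D) = {1..n}"
proof -
  note c = rook_card[OF assms]
  show l: "card D = n \<longleftrightarrow> Collect (left_attached D) = {1..n}"
    using c(1,3) card_subset_eq[OF _ c(1)] by auto
  show r: "card D = n \<longleftrightarrow> Collect (right_attached D) = {1..n}"
    using c(2,4) card_subset_eq[OF _ c(2)] by auto
  show "no_missing_edges n D \<longleftrightarrow> card D = n"
    using l r c(1) unfolding no_missing_edges_def by blast
qed

lemma rook_simps:
  "carrier (rook_monoid G n) = rook_diagrams G n"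
  "D \<otimes>\<^bsub>rook_monoid G n\<^esub> E = {(i, g \<otimes>\<^bsub>G\<^esub> h, l) | i g j h l. (i, g, j) \<in> D \<and> (j, h, l) \<in> E}"
  "\<one>\<^bsub>rook_monoid G n\<^esub> = {(i, \<one>\<^bsub>G\<^esub>, i) | i. i \<in> {1..n}}"
  by (simp_all add: rook_monoid_def)

context group
begin

abbreviation "rook n \<equiv> rook_monoid G n"

lemma rook_closed:
  assumes D: "D \<in> rook_diagrams G n" and E: "E \<in> rook_diagrams G n"
  shows "D \<otimes>\<^bsub>rook n\<^esub> E \<in> rook_diagrams G n"
proof -
  note D = rook_diagramsD[OF D] and E = rook_diagramsD[OF E]
  show ?thesis
    unfolding rook_diagrams_iff rook_simps
  proof (intro conjI allI impI)
    fix i g l assume "(i, g, l) \<in> {(i, g \<otimes> h, l) | i g j h l. (i, g, j) \<in> D \<and> (j, h, l) \<in> E}"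
    then show "i \<in> {1..n}" "g \<in> carrier G" "l \<in> {1..n}" using D(1,2) E(2,3) by auto
  next
    fix i g l g' l' assume "(i, g, l) \<in> {(i, g \<otimes> h, l) | i g j h l. (i, g, j) \<in> D \<and> (j, h, l) \<in> E}"
      "(i, g', l') \<in> {(i, g \<otimes> h, l) | i g j h l. (i, g, j) \<in> D \<and> (j, h, l) \<in> E}"
    then obtain a j b a' j' b' where ab: "(i, a, j) \<in> D" "(j, b, l) \<in> E" "g = a \<otimes> b"
      "(i, a', j') \<in> D" "(j', b', l') \<in> E" "g' = a' \<otimes> b'" by blast
    then show "g = g'" "l = l'" using D(4)[OF ab(1,4)] E(4)[of j b l b' l'] by auto
  next
    fix i g l i' g' assume "(i, g, l) \<in> {(i, g \<otimes> h, l) | i g j h l. (i, g, j) \<in> D \<and> (j, h, l) \<in> E}"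
      "(i', g', l) \<in> {(i, g \<otimes> h, l) | i g j h l. (i, g, j) \<in> D \<and> (j, h, l) \<in> E}"
    then obtain a j b a' j' b' where ab: "(i, a, j) \<in> D" "(j, b, l) \<in> E" "g = a \<otimes> b"
      "(i', a', j') \<in> D" "(j', b', l) \<in> E" "g' = a' \<otimes> b'" by blast
    then show "i = i'" "g = g'" using E(5)[OF ab(2,5)] D(5)[of i a j i' a'] by auto
  qed
qed

lemma rook_monoid: "monoid (rook n)"
proof (rule monoidI; unfold rook_simps(1))
  show "\<one>\<^bsub>rook n\<^esub> \<in> rook_diagrams G n" by (auto simp: rook_diagrams_iff rook_simps)
  fix D assume D: "D \<in> rook_diagrams G n"
  note D' = rook_diagramsD[OF D]
  have "\<one>\<^bsub>rook n\<^esub> \<otimes>\<^bsub>rook n\<^esub> D = {(i, \<one> \<otimes> g, j) | i g j. i \<in> {1..n} \<and> (i, g, j) \<in> D}"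
    unfolding rook_simps(2,3) by blast
  also have "\<dots> = {(i, g, j) | i g j. (i, g, j) \<in> D}"
    using D'(1,2) l_one by (metis (no_types, opaque_lifting))
  finally show "\<one>\<^bsub>rook n\<^esub> \<otimes>\<^bsub>rook n\<^esub> D = D" by auto
  have "D \<otimes>\<^bsub>rook n\<^esub> \<one>\<^bsub>rook n\<^esub> = {(i, g \<otimes> \<one>, j) | i g j. j \<in> {1..n} \<and> (i, g, j) \<in> D}"
    unfolding rook_simps(2,3) by blast
  also have "\<dots> = {(i, g, j) | i g j. (i, g, j) \<in> D}"
    using D'(2,3) r_one by (metis (no_types, opaque_lifting))
  finally show "D \<otimes>\<^bsub>rook n\<^esub> \<one>\<^bsub>rook n\<^esub> = D" by auto
  fix E F assume E: "E \<in> rook_diagrams G n" and F: "F \<in> rook_diagrams G n"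
  show "D \<otimes>\<^bsub>rook n\<^esub> E \<in> rook_diagrams G n" using D E by (rule rook_closed)
  note E' = rook_diagramsD[OF E] and F' = rook_diagramsD[OF F]
  have "D \<otimes>\<^bsub>rook n\<^esub> E \<otimes>\<^bsub>rook n\<^esub> F =
      {(i, g \<otimes> h \<otimes> f, m) | i g j h l f m. (i, g, j) \<in> D \<and> (j, h, l) \<in> E \<and> (l, f, m) \<in> F}"
    unfolding rook_simps by blast
  also have "\<dots> = {(i, g \<otimes> (h \<otimes> f), m) | i g j h l f m. (i, g, j) \<in> D \<and> (j, h, l) \<in> E \<and> (l, f, m) \<in> F}"
    using D'(2) E'(2) F'(2) by (metis (no_types, opaque_lifting) m_assoc)
  also have "\<dots> = D \<otimes>\<^bsub>rook n\<^esub> (E \<otimes>\<^bsub>rook n\<^esub> F)"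
    unfolding rook_simps by blast
  finally show "D \<otimes>\<^bsub>rook n\<^esub> E \<otimes>\<^bsub>rook n\<^esub> F = D \<otimes>\<^bsub>rook n\<^esub> (E \<otimes>\<^bsub>rook n\<^esub> F)" .
qed

text \<open>An edge of the product is determined by the middle node that it passes, and a middle
  node is passed exactly when it is attached on both sides.\<close>

lemma card_rook_mult:
  assumes D: "D \<in> rook_diagrams G n" and E: "E \<in> rook_diagrams G n"
  shows "card (D \<otimes>\<^bsub>rook n\<^esub> E) = card (Collect (right_attached D) \<inter> Collect (left_attached E))"
proof -
  note D' = rook_diagramsD[OF D]
  let ?D = "{d \<in> D. left_attached E (snd (snd d))}"
  have "Collect (left_attached (D \<otimes>\<^bsub>rook n\<^esub> E)) = fst ` ?D"
    unfolding rook_simps left_attached_def by force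
  moreover have "inj_on fst ?D" using D'(4) by (auto simp: inj_on_def)
  moreover have "inj_on (snd \<circ> snd) ?D" using D'(5) by (auto simp: inj_on_def)
  moreover have "(snd \<circ> snd) ` ?D = Collect (right_attached D) \<inter> Collect (left_attached E)"
    by (force simp: right_attached_def)
  ultimately show ?thesis
    using rook_card(3)[OF rook_closed[OF D E]] by (metis (no_types, lifting) card_image)
qed

text \<open>Inclusion-exclusion in the middle column. The exponent of \<epsilon> becomes a function
  of the ranks of \<open>D\<close>, \<open>E\<close> and their product, from which the cocycle
  identity and the special values are read off.\<close>

lemma middle_components_card:
  assumes D: "D \<in> rook_diagrams G n" and E: "E \<in> rook_diagrams G n"
  shows "middle_components n D E + card D + card E = n + card (D \<otimes>\<^bsub>rook n\<^esub> E)"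
proof -
  let ?R = "Collect (right_attached D)" and ?L = "Collect (left_attached E)"
  note cD = rook_card[OF D] and cE = rook_card[OF E]
  have fin: "finite ?R" "finite ?L" using finite_subset[OF cD(2)] finite_subset[OF cE(1)] by auto
  have "{j \<in> {1..n}. \<not> right_attached D j \<and> \<not> left_attached E j} = {1..n} - (?R \<union> ?L)" by auto
  then have "middle_components n D E = n - card (?R \<union> ?L)"
    unfolding middle_components_def using cD(2) cE(1) fin by (simp add: card_Diff_subset)
  moreover have "card (?R \<union> ?L) \<le> n" using card_mono[of "{1..n}" "?R \<union> ?L"] cD(2) cE(1) by simp
  moreover have "card (?R \<union> ?L) + card (?R \<inter> ?L) = card ?R + card ?L"
    using card_Un_Int[OF fin] by simp
  ultimately show ?thesis using card_rook_mult[OF D E] cD(4) cE(3) by simp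
qed

lemma card_rook_one: "card \<one>\<^bsub>rook n\<^esub> = n"
proof -
  have "\<one>\<^bsub>rook n\<^esub> = (\<lambda>i. (i, \<one>, i)) ` {1..n}" by (auto simp: rook_simps)
  then show ?thesis by (simp add: card_image inj_on_def)
qed

lemma card_rook_mult_le:
  assumes D: "D \<in> rook_diagrams G n" and E: "E \<in> rook_diagrams G n"
  shows "card (D \<otimes>\<^bsub>rook n\<^esub> E) \<le> card D" "card (D \<otimes>\<^bsub>rook n\<^esub> E) \<le> card E"
proof -
  note cD = rook_card[OF D] and cE = rook_card[OF E]
  have fin: "finite (Collect (right_attached D))" "finite (Collect (left_attached E))"
    using finite_subset[OF cD(2)] finite_subset[OF cE(1)] by auto
  show "card (D \<otimes>\<^bsub>rook n\<^esub> E) \<le> card D" "card (D \<otimes>\<^bsub>rook n\<^esub> E) \<le> card E"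
    unfolding card_rook_mult[OF D E]
    using card_mono[OF fin(1), of "Collect (right_attached D) \<inter> Collect (left_attached E)"]
      card_mono[OF fin(2), of "Collect (right_attached D) \<inter> Collect (left_attached E)"] cD(4) cE(3) by auto
qed

end

section \<open>The semidirect product as the group of diagrams without missing edges\<close>

definition permutation_diagram :: "nat \<Rightarrow> (nat \<Rightarrow> 'g) \<times> (nat \<Rightarrow> nat) \<Rightarrow> 'g diagram" where
  "permutation_diagram n = (\<lambda>(g, \<sigma>). {(i, g i, inv_into UNIV \<sigma> i) | i. i \<in> {1..n}})"

lemma mem_permutation_diagram:
  "(i, a, j) \<in> permutation_diagram n (g, \<sigma>) \<longleftrightarrow> i \<in> {1..n} \<and> a = g i \<and> j = inv_into UNIV \<sigma> i"
  by (auto simp: permutation_diagram_def)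

lemma power_semidirect_simps:
  "carrier (power_semidirect_sym G n) = (\<Pi>\<^sub>E i\<in>{1..n}. carrier G) \<times> {\<sigma>. \<sigma> permutes {1..n}}"
  "(g, \<sigma>) \<otimes>\<^bsub>power_semidirect_sym G n\<^esub> (h, \<tau>) =
     ((\<lambda>i\<in>{1..n}. g i \<otimes>\<^bsub>G\<^esub> permute_factors n \<sigma> h i), \<sigma> \<circ> \<tau>)"
  "\<one>\<^bsub>power_semidirect_sym G n\<^esub> = ((\<lambda>i\<in>{1..n}. \<one>\<^bsub>G\<^esub>), id)"
  by (simp_all add: power_semidirect_sym_def semidirect_product_def sym_group_def)

context group
begin

abbreviation "\<Gamma> n \<equiv> power_semidirect_sym G n"

lemma permutes_inv_in: "\<sigma> permutes {1..n} \<Longrightarrow> i \<in> {1..n} \<Longrightarrow> inv_into UNIV \<sigma> i \<in> {1..n}"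
  using permutes_in_image[OF permutes_inv] by metis

lemma semidirect_mult_closed:
  assumes "x \<in> carrier (\<Gamma> n)" "y \<in> carrier (\<Gamma> n)"
  shows "x \<otimes>\<^bsub>\<Gamma> n\<^esub> y \<in> carrier (\<Gamma> n)"
proof -
  obtain g \<sigma> h \<tau> where xy: "x = (g, \<sigma>)" "y = (h, \<tau>)" by (cases x, cases y)
  have "g i \<otimes> permute_factors n \<sigma> h i \<in> carrier G" if "i \<in> {1..n}" for i
  proof -
    have g: "g \<in> (\<Pi>\<^sub>E i\<in>{1..n}. carrier G)" and h: "h \<in> (\<Pi>\<^sub>E i\<in>{1..n}. carrier G)" and s: "\<sigma> permutes {1..n}"
      using assms by (simp_all add: xy power_semidirect_simps)
    show ?thesis
      using PiE_mem[OF g that] PiE_mem[OF h permutes_inv_in[OF s that]] that by (simp add: permute_factors_def)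
  qed
  then show ?thesis
    using assms permutes_compose[of \<tau> "{1..n}" \<sigma>] by (simp add: xy power_semidirect_simps PiE_iff)
qed

lemma permutation_diagram_closed:
  assumes "x \<in> carrier (\<Gamma> n)"
  shows "permutation_diagram n x \<in> rook_diagrams G n"
proof -
  obtain g \<sigma> where x: "x = (g, \<sigma>)" "g \<in> (\<Pi>\<^sub>E i\<in>{1..n}. carrier G)" "\<sigma> permutes {1..n}"
    using assms unfolding power_semidirect_simps by blast
  have inj: "inv_into UNIV \<sigma> i = inv_into UNIV \<sigma> j \<Longrightarrow> i = j" for i j
    using permutes_inj[OF permutes_inv[OF x(3)]] by (simp add: inj_eq)
  show ?thesis
    unfolding rook_diagrams_iff x(1) mem_permutation_diagram
    using PiE_mem[OF x(2)] permutes_inv_in[OF x(3)] inj by blast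
qed

lemma card_permutation_diagram: "card (permutation_diagram n x) = n"
proof -
  obtain g \<sigma> where x: "x = (g, \<sigma>)" by (cases x)
  have "permutation_diagram n x = (\<lambda>i. (i, g i, inv_into UNIV \<sigma> i)) ` {1..n}"
    by (auto simp: permutation_diagram_def x)
  then show ?thesis by (simp add: card_image inj_on_def)
qed

lemma inj_permutation_diagram: "inj_on (permutation_diagram n) (carrier (\<Gamma> n))"
proof (rule inj_onI)
  fix x y assume xy: "x \<in> carrier (\<Gamma> n)" "y \<in> carrier (\<Gamma> n)" "permutation_diagram n x = permutation_diagram n y"
  obtain g \<sigma> where x: "x = (g, \<sigma>)" "g \<in> (\<Pi>\<^sub>E i\<in>{1..n}. carrier G)" "\<sigma> permutes {1..n}"
    using xy unfolding power_semidirect_simps by blast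
  obtain h \<tau> where y: "y = (h, \<tau>)" "h \<in> (\<Pi>\<^sub>E i\<in>{1..n}. carrier G)" "\<tau> permutes {1..n}"
    using xy unfolding power_semidirect_simps by blast
  have e: "g i = h i \<and> inv_into UNIV \<sigma> i = inv_into UNIV \<tau> i" if i: "i \<in> {1..n}" for i
  proof -
    have "(i, g i, inv_into UNIV \<sigma> i) \<in> permutation_diagram n y"
      unfolding xy(3)[symmetric] x(1) mem_permutation_diagram using i by simp
    then show ?thesis unfolding y(1) mem_permutation_diagram by simp
  qed
  then have "g = h" by (intro PiE_ext[OF x(2) y(2)]) blast
  moreover have "inv_into UNIV \<sigma> = inv_into UNIV \<tau>"
  proof
    fix i show "inv_into UNIV \<sigma> i = inv_into UNIV \<tau> i"
    proof (cases "i \<in> {1..n}")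
      case True
      then show ?thesis using e by blast
    next
      case False
      show ?thesis
        unfolding permutes_not_in[OF permutes_inv[OF x(3)] False] permutes_not_in[OF permutes_inv[OF y(3)] False] ..
    qed
  qed
  then have "\<sigma> = \<tau>" using permutes_inv_inv[OF x(3)] permutes_inv_inv[OF y(3)] by metis
  ultimately show "x = y" by (simp add: x y)
qed

text \<open>This dictates the inverse in \<open>permutation_diagram\<close>. Read from left to
  right, the edges lead from i to its preimage j under \<sigma> and on to the preimage of j under
  \<tau>, which is the preimage of i under \<open>\<sigma> \<circ> \<tau>\<close>. The label is g i
  times h j, as \<open>permute_factors\<close> prescribes.\<close>

lemma permutation_diagram_mult:
  assumes "x \<in> carrier (\<Gamma> n)" "y \<in> carrier (\<Gamma> n)"
  shows "permutation_diagram n (x \<otimes>\<^bsub>\<Gamma> n\<^esub> y) = permutation_diagram n x \<otimes>\<^bsub>rook n\<^esub> permutation_diagram n y"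
proof -
  obtain g \<sigma> where x: "x = (g, \<sigma>)" "g \<in> (\<Pi>\<^sub>E i\<in>{1..n}. carrier G)" "\<sigma> permutes {1..n}"
    using assms unfolding power_semidirect_simps by blast
  obtain h \<tau> where y: "y = (h, \<tau>)" "h \<in> (\<Pi>\<^sub>E i\<in>{1..n}. carrier G)" "\<tau> permutes {1..n}"
    using assms unfolding power_semidirect_simps by blast
  let ?s = "inv_into UNIV \<sigma>" and ?t = "inv_into UNIV \<tau>"
  have "inv_into UNIV (\<sigma> \<circ> \<tau>) = ?t \<circ> ?s"
    by (intro o_inv_distrib permutes_bij[OF x(3)] permutes_bij[OF y(3)])
  then have "permutation_diagram n (x \<otimes>\<^bsub>\<Gamma> n\<^esub> y) = {(i, g i \<otimes> h (?s i), ?t (?s i)) | i. i \<in> {1..n}}"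
    unfolding x(1) y(1) power_semidirect_simps permutation_diagram_def case_prod_conv setcompr_eq_image
    by (intro image_cong refl) (simp add: permute_factors_def)
  also have "\<dots> = permutation_diagram n x \<otimes>\<^bsub>rook n\<^esub> permutation_diagram n y"
    unfolding rook_simps x(1) y(1) mem_permutation_diagram using permutes_inv_in[OF x(3)] by blast
  finally show ?thesis .
qed

lemma permutation_diagram_one: "permutation_diagram n \<one>\<^bsub>\<Gamma> n\<^esub> = \<one>\<^bsub>rook n\<^esub>"
  unfolding power_semidirect_simps permutation_diagram_def case_prod_conv rook_simps setcompr_eq_image
  by (intro image_cong refl) (simp add: inv_id[unfolded id_def] id_def)

text \<open>A diagram with \<open>n\<close> edges has one at each left node and so gives a labelled
  self-map of the nodes. It is injective because right nodes are not shared, hence a permutation of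
  a finite set.\<close>

lemma permutation_diagram_image:
  assumes D: "D \<in> rook_diagrams G n"
  shows "D \<in> permutation_diagram n ` carrier (\<Gamma> n) \<longleftrightarrow> card D = n"
proof
  assume "card D = n"
  note D' = rook_diagramsD[OF D]
  have L: "left_attached D i" if "i \<in> {1..n}" for i
    using rook_full_iff(2)[OF D] \<open>card D = n\<close> that by auto
  then have "\<forall>i\<in>{1..n}. \<exists>p. (i, fst p, snd p) \<in> D" by (auto simp: left_attached_def)
  then obtain p where "\<forall>i\<in>{1..n}. (i, fst (p i), snd (p i)) \<in> D" by (rule bchoice[THEN exE])
  moreover define g t where "g = fst \<circ> p" and "t = snd \<circ> p"
  ultimately have gt: "(i, g i, t i) \<in> D" if "i \<in> {1..n}" for i using that by simp
  have DE: "D = {(i, g i, t i) | i. i \<in> {1..n}}"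
  proof
    show "D \<subseteq> {(i, g i, t i) | i. i \<in> {1..n}}"
    proof
      fix d assume d: "d \<in> D"
      obtain i a j where [simp]: "d = (i, a, j)" by (cases d)
      have ij: "(i, a, j) \<in> D" using d by simp
      have i: "i \<in> {1..n}" by (rule D'(1)[OF ij])
      have "a = g i \<and> j = t i" by (rule D'(4)[OF ij gt[OF i]])
      with i show "d \<in> {(i, g i, t i) | i. i \<in> {1..n}}" by simp
    qed
  qed (use gt in blast)
  \<comment> \<open>Extended by the identity outside the nodes, as \<open>permutes\<close>
    demands.\<close>
  let ?t = "\<lambda>i. if i \<in> {1..n} then t i else i"
  have inj: "inj_on ?t {1..n}"
  proof (rule inj_onI)
    fix i j assume ij: "i \<in> {1..n}" "j \<in> {1..n}" "?t i = ?t j"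
    then have "(j, g j, t i) \<in> D" using gt[of j] by simp
    then show "i = j" using D'(5)[OF gt[OF ij(1)]] by blast
  qed
  have "?t i \<in> {1..n}" if "i \<in> {1..n}" for i using D'(3)[OF gt[OF that]] that by simp
  then have "?t ` {1..n} = {1..n}" by (intro endo_inj_surj[OF finite_atLeastAtMost _ inj] image_subsetI)
  with inj have "bij_betw ?t {1..n} {1..n}" unfolding bij_betw_def by (rule conjI)
  then have p: "?t permutes {1..n}" by (rule bij_imp_permutes) (rule if_not_P)
  \<comment> \<open>The inverse compensates for the one in \<open>permutation_diagram\<close>, which
    joins \<open>i\<close> to its preimage.\<close>
  let ?x = "(\<lambda>i\<in>{1..n}. g i, inv_into UNIV ?t)"
  have "(\<lambda>i\<in>{1..n}. g i) \<in> (\<Pi>\<^sub>E i\<in>{1..n}. carrier G)"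
    using D'(2)[OF gt] by (intro restrict_PiE_iff[THEN iffD2] ballI)
  then have "?x \<in> carrier (\<Gamma> n)"
    using permutes_inv[OF p] unfolding power_semidirect_simps by blast
  moreover have "D = permutation_diagram n ?x"
    unfolding permutation_diagram_def DE permutes_inv_inv[OF p] case_prod_conv
      setcompr_eq_image by (intro image_cong refl) simp
  ultimately show "D \<in> permutation_diagram n ` carrier (\<Gamma> n)" by blast
qed (auto simp: card_permutation_diagram)

end

section \<open>Annihilators of the diagrams with missing edges\<close>

definition idempotent_diagram :: "('g, 'y) monoid_scheme \<Rightarrow> nat \<Rightarrow> nat \<Rightarrow> 'g diagram" where
  "idempotent_diagram G n i = {(j, \<one>\<^bsub>G\<^esub>, j) | j. j \<in> {1..n} - {i}}"

locale rook_setting = G: group G + k: cring k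
  for G :: "('g, 'y) monoid_scheme" and k :: "('k, 'z) ring_scheme" +
  fixes n :: nat and \<epsilon> :: 'k
  assumes \<epsilon>: "\<epsilon> \<in> Units k"
begin

abbreviation "twist_factor D E \<equiv> \<epsilon> [^]\<^bsub>k\<^esub> middle_components n D E"
abbreviation "rook_chi D \<equiv> (if no_missing_edges n D then \<one>\<^bsub>k\<^esub> else \<zero>\<^bsub>k\<^esub>)"

lemma \<epsilon>_closed: "\<epsilon> \<in> carrier k"
  using \<epsilon> by (rule k.Units_closed)

text \<open>By \<open>middle_components_card\<close> both sides of the cocycle identity have as
  exponent 2n plus the rank of the triple product minus the ranks of the three factors. With the
  identity diagram, which has rank \<open>n\<close>, the exponent is 0.\<close>

lemma twisted_monoid_rook: "twisted_monoid k (rook_monoid G n) twist_factor"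
proof (intro twisted_monoid.intro twisted_monoid_axioms.intro G.rook_monoid k.is_cring; unfold rook_simps(1))
  show "twist_factor D E \<in> carrier k" for D E using \<epsilon>_closed by simp
  have one: "\<one>\<^bsub>rook_monoid G n\<^esub> \<in> rook_diagrams G n"
    using monoid.one_closed[OF G.rook_monoid] by (simp add: rook_simps(1))
  fix D assume D: "D \<in> rook_diagrams G n"
  interpret S: monoid "rook_monoid G n" by (rule G.rook_monoid)
  have "middle_components n \<one>\<^bsub>rook_monoid G n\<^esub> D = 0"
    using G.middle_components_card[OF one D] D by (simp add: G.card_rook_one S.l_one rook_simps(1))
  then show "twist_factor \<one>\<^bsub>rook_monoid G n\<^esub> D = \<one>\<^bsub>k\<^esub>" by simp
  have "middle_components n D \<one>\<^bsub>rook_monoid G n\<^esub> = 0"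
    using G.middle_components_card[OF D one] D by (simp add: G.card_rook_one S.r_one rook_simps(1))
  then show "twist_factor D \<one>\<^bsub>rook_monoid G n\<^esub> = \<one>\<^bsub>k\<^esub>" by simp
  fix E F assume E: "E \<in> rook_diagrams G n" and F: "F \<in> rook_diagrams G n"
  have "middle_components n D E + middle_components n (D \<otimes>\<^bsub>rook_monoid G n\<^esub> E) F =
      middle_components n E F + middle_components n D (E \<otimes>\<^bsub>rook_monoid G n\<^esub> F)"
    using G.middle_components_card[OF D E] G.middle_components_card[OF G.rook_closed[OF D E] F]
      G.middle_components_card[OF E F] G.middle_components_card[OF D G.rook_closed[OF E F]] S.m_assoc[of D E F] D E F
    by (simp add: rook_simps(1))
  then show "twist_factor D E \<otimes>\<^bsub>k\<^esub> twist_factor (D \<otimes>\<^bsub>rook_monoid G n\<^esub> E) F =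
      twist_factor E F \<otimes>\<^bsub>k\<^esub> twist_factor D (E \<otimes>\<^bsub>rook_monoid G n\<^esub> F)"
    using \<epsilon>_closed by (simp add: k.nat_pow_mult)
qed

text \<open>The rank decides: the image of the group consists of the diagrams of rank
  \<open>n\<close>, a product has at most the rank of each factor, and two diagrams of the image
  leave no middle node isolated, since their product has rank \<open>n\<close> again.\<close>

sublocale R: monoid_retract k "rook_monoid G n" twist_factor "power_semidirect_sym G n" "permutation_diagram n" rook_chi
proof (intro monoid_retract.intro monoid_retract_axioms.intro twisted_monoid_rook G.semidirect_mult_closed
    G.inj_permutation_diagram G.permutation_diagram_mult G.permutation_diagram_one; (unfold rook_simps(1))?)
  show "\<one>\<^bsub>power_semidirect_sym G n\<^esub> \<in> carrier (power_semidirect_sym G n)"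
    by (simp add: power_semidirect_simps permutes_id)
  show "permutation_diagram n x \<in> rook_diagrams G n" if "x \<in> carrier (power_semidirect_sym G n)" for x
    using that by (rule G.permutation_diagram_closed)
  show "twist_factor (permutation_diagram n x) (permutation_diagram n y) = \<one>\<^bsub>k\<^esub>"
    if x: "x \<in> carrier (power_semidirect_sym G n)" and y: "y \<in> carrier (power_semidirect_sym G n)" for x y
  proof -
    have "middle_components n (permutation_diagram n x) (permutation_diagram n y) = 0"
      using G.middle_components_card[OF G.permutation_diagram_closed[OF x] G.permutation_diagram_closed[OF y]]
        G.card_permutation_diagram[of n "x \<otimes>\<^bsub>power_semidirect_sym G n\<^esub> y"]
      by (simp add: G.card_permutation_diagram G.permutation_diagram_mult[OF x y])
    then show ?thesis by simp
  qed
  show "D \<in> permutation_diagram n ` carrier (power_semidirect_sym G n) \<and>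
      E \<in> permutation_diagram n ` carrier (power_semidirect_sym G n)"
    if D: "D \<in> rook_diagrams G n" and E: "E \<in> rook_diagrams G n"
      and DE: "D \<otimes>\<^bsub>rook_monoid G n\<^esub> E \<in> permutation_diagram n ` carrier (power_semidirect_sym G n)" for D E
  proof -
    have "card (D \<otimes>\<^bsub>rook_monoid G n\<^esub> E) = n"
      using DE G.permutation_diagram_image[OF G.rook_closed[OF D E]] by simp
    then have "card D = n" "card E = n"
      using G.card_rook_mult_le[OF D E] rook_card(6)[OF D] rook_card(6)[OF E] by auto
    then show ?thesis unfolding G.permutation_diagram_image[OF D] G.permutation_diagram_image[OF E] by blast
  qed
  show "rook_chi D = (if D \<in> permutation_diagram n ` carrier (power_semidirect_sym G n) then \<one>\<^bsub>k\<^esub> else \<zero>\<^bsub>k\<^esub>)"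
    if "D \<in> rook_diagrams G n" for D
    using that by (simp add: G.permutation_diagram_image rook_full_iff(1))
qed

abbreviation "A \<equiv> R.W"
abbreviation "E i \<equiv> idempotent_diagram G n i"

lemma E_closed: "E i \<in> rook_diagrams G n"
  by (auto simp: rook_diagrams_iff idempotent_diagram_def)

lemma E_mult:
  assumes "D \<in> rook_diagrams G n"
  shows "E i \<otimes>\<^bsub>rook_monoid G n\<^esub> D = {(j, g, l) \<in> D. j \<noteq> i}"
    and "D \<otimes>\<^bsub>rook_monoid G n\<^esub> E i = {(j, g, l) \<in> D. l \<noteq> i}"
proof -
  note D = rook_diagramsD[OF assms]
  have "E i \<otimes>\<^bsub>rook_monoid G n\<^esub> D = {(j, \<one>\<^bsub>G\<^esub> \<otimes>\<^bsub>G\<^esub> g, l) | j g l. (j, g, l) \<in> D \<and> j \<in> {1..n} - {i}}"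
    unfolding rook_simps idempotent_diagram_def by blast
  also have "\<dots> = {(j, g, l) | j g l. (j, g, l) \<in> D \<and> j \<in> {1..n} - {i}}"
    using D(2) G.l_one by (metis (no_types, opaque_lifting))
  also have "\<dots> = {(j, g, l) \<in> D. j \<noteq> i}" using D(1) by blast
  finally show "E i \<otimes>\<^bsub>rook_monoid G n\<^esub> D = {(j, g, l) \<in> D. j \<noteq> i}" .
  have "D \<otimes>\<^bsub>rook_monoid G n\<^esub> E i = {(j, g \<otimes>\<^bsub>G\<^esub> \<one>\<^bsub>G\<^esub>, l) | j g l. (j, g, l) \<in> D \<and> l \<in> {1..n} - {i}}"
    unfolding rook_simps idempotent_diagram_def by blast
  also have "\<dots> = {(j, g, l) | j g l. (j, g, l) \<in> D \<and> l \<in> {1..n} - {i}}"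
    using D(2) G.r_one by (metis (no_types, opaque_lifting))
  also have "\<dots> = {(j, g, l) \<in> D. l \<noteq> i}" using D(3) by blast
  finally show "D \<otimes>\<^bsub>rook_monoid G n\<^esub> E i = {(j, g, l) \<in> D. l \<noteq> i}" .
qed

lemma card_E: "i \<in> {1..n} \<Longrightarrow> card (E i) + 1 = n"
proof -
  assume i: "i \<in> {1..n}"
  have "E i = (\<lambda>j. (j, \<one>\<^bsub>G\<^esub>, j)) ` ({1..n} - {i})" by (auto simp: idempotent_diagram_def)
  then have "card (E i) = n - 1" using i by (simp add: card_image inj_on_def card_Diff_subset)
  then show ?thesis using i by auto
qed

text \<open>The origin of the inverse of \<epsilon>: if \<open>D\<close> misses node
  \<open>i\<close>, then \<open>E i\<close> deletes no edge of \<open>D\<close>, and the rank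
  formula leaves exactly one isolated middle node, so in the algebra \<open>E i\<close> multiplies
  \<open>D\<close> by \<epsilon>.\<close>

lemma E_absorb:
  assumes D: "D \<in> rook_diagrams G n" and i: "i \<in> {1..n}"
  shows "\<not> left_attached D i \<Longrightarrow> E i \<otimes>\<^bsub>rook_monoid G n\<^esub> D = D \<and> middle_components n (E i) D = 1"
    and "\<not> right_attached D i \<Longrightarrow> D \<otimes>\<^bsub>rook_monoid G n\<^esub> E i = D \<and> middle_components n D (E i) = 1"
proof -
  assume "\<not> left_attached D i"
  then have "E i \<otimes>\<^bsub>rook_monoid G n\<^esub> D = D" unfolding E_mult[OF D] by (auto simp: left_attached_def)
  then show "E i \<otimes>\<^bsub>rook_monoid G n\<^esub> D = D \<and> middle_components n (E i) D = 1"
    using G.middle_components_card[OF E_closed D, of i] card_E[OF i] by simp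
next
  assume "\<not> right_attached D i"
  then have "D \<otimes>\<^bsub>rook_monoid G n\<^esub> E i = D" unfolding E_mult[OF D] by (auto simp: right_attached_def)
  then show "D \<otimes>\<^bsub>rook_monoid G n\<^esub> E i = D \<and> middle_components n D (E i) = 1"
    using G.middle_components_card[OF D E_closed, of i] card_E[OF i] by simp
qed

text \<open>Multiplication by \<open>E i\<close> only deletes edges. Missing nodes stay missing,
  which keeps the induction for the annihilators going.\<close>

lemma E_attached:
  assumes D: "D \<in> rook_diagrams G n"
  shows "\<not> left_attached D l \<Longrightarrow> \<not> left_attached (E i \<otimes>\<^bsub>rook_monoid G n\<^esub> D) l"
    and "\<not> right_attached D l \<Longrightarrow> \<not> right_attached (D \<otimes>\<^bsub>rook_monoid G n\<^esub> E i) l"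
  unfolding E_mult[OF D] by (auto simp: left_attached_def right_attached_def)

definition u :: "nat \<Rightarrow> 'g diagram \<Rightarrow> 'k" where
  "u i = \<one>\<^bsub>A\<^esub> \<ominus>\<^bsub>A\<^esub> (inv\<^bsub>k\<^esub> \<epsilon>) \<odot>\<^bsub>A\<^esub> basis_vec k (E i)"

lemma bas_closed: "D \<in> rook_diagrams G n \<Longrightarrow> basis_vec k D \<in> carrier A"
  unfolding R.W_simps(1) by (rule k.basis_closed) (simp add: rook_simps)

lemma inv_\<epsilon>: "inv\<^bsub>k\<^esub> \<epsilon> \<in> carrier k" "inv\<^bsub>k\<^esub> \<epsilon> \<otimes>\<^bsub>k\<^esub> \<epsilon> = \<one>\<^bsub>k\<^esub>"
  using \<epsilon> by simp_all

lemma e_closed: "(inv\<^bsub>k\<^esub> \<epsilon>) \<odot>\<^bsub>A\<^esub> basis_vec k (E i) \<in> carrier A"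
  by (intro R.W.L.smult_closed inv_\<epsilon> bas_closed E_closed)

lemma u_closed: "u i \<in> carrier A"
  unfolding u_def by (intro R.W.L.M.minus_closed R.W.A.one_closed e_closed)

text \<open>The diagram \<open>E i\<close> has rank \<open>n - 1\<close>, so \<open>proj\<close>
  kills it and the unit remains.\<close>

lemma proj_u:
  assumes "i \<in> {1..n}"
  shows "R.proj (u i) = \<one>\<^bsub>R.B.W\<^esub>"
proof -
  have "card (E i) \<noteq> n" using card_E[OF assms] by simp
  then have "E i \<notin> permutation_diagram n ` carrier (power_semidirect_sym G n)"
    using G.permutation_diagram_image[OF E_closed] by simp
  then have "R.proj (basis_vec k (E i)) = \<zero>\<^bsub>R.B.W\<^esub>"
    using E_closed[of i] by (simp add: R.proj_bas R.proj_basis_other rook_simps(1))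
  then have "R.proj ((inv\<^bsub>k\<^esub> \<epsilon>) \<odot>\<^bsub>A\<^esub> basis_vec k (E i)) = \<zero>\<^bsub>R.B.W\<^esub>"
    using semilinearD(3)[OF R.linear_proj inv_\<epsilon>(1) bas_closed[OF E_closed]] inv_\<epsilon>(1)
    by (simp add: R.B.W.L.smult_r_null)
  then show ?thesis
    using semilinear_zero(3)[OF R.linear_proj R.W.L.M.abelian_group_axioms R.B.W.L.M.abelian_group_axioms
        R.W.A.one_closed e_closed] ring_hom_one[OF R.proj_hom] R.B.W.A.minus_zero
      R.B.W.L.M.r_zero[OF R.B.W.A.one_closed]
    unfolding u_def a_minus_def by metis
qed

lemma u_mult:
  assumes "D \<in> rook_diagrams G n"
  shows "u i \<otimes>\<^bsub>A\<^esub> basis_vec k D = basis_vec k D \<ominus>\<^bsub>A\<^esub>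
      (inv\<^bsub>k\<^esub> \<epsilon> \<otimes>\<^bsub>k\<^esub> twist_factor (E i) D) \<odot>\<^bsub>A\<^esub> basis_vec k (E i \<otimes>\<^bsub>rook_monoid G n\<^esub> D)"
    and "basis_vec k D \<otimes>\<^bsub>A\<^esub> u i = basis_vec k D \<ominus>\<^bsub>A\<^esub>
      (inv\<^bsub>k\<^esub> \<epsilon> \<otimes>\<^bsub>k\<^esub> twist_factor D (E i)) \<odot>\<^bsub>A\<^esub> basis_vec k (D \<otimes>\<^bsub>rook_monoid G n\<^esub> E i)"
proof -
  note b = bas_closed[OF assms] and bE = bas_closed[OF E_closed[of i]]
  have tf: "twist_factor X Y \<in> carrier k" for X Y using \<epsilon>_closed by simp
  have "((inv\<^bsub>k\<^esub> \<epsilon>) \<odot>\<^bsub>A\<^esub> basis_vec k (E i)) \<otimes>\<^bsub>A\<^esub> basis_vec k D =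
      (inv\<^bsub>k\<^esub> \<epsilon>) \<odot>\<^bsub>A\<^esub> (twist_factor (E i) D \<odot>\<^bsub>A\<^esub> basis_vec k (E i \<otimes>\<^bsub>rook_monoid G n\<^esub> D))"
    unfolding R.W.smult_mult_l[OF inv_\<epsilon>(1) bE b]
    using R.basis_mult[of "E i" D] E_closed[of i] assms by (simp only: R.W_simps(5) rook_simps(1))
  also have "\<dots> = (inv\<^bsub>k\<^esub> \<epsilon> \<otimes>\<^bsub>k\<^esub> twist_factor (E i) D) \<odot>\<^bsub>A\<^esub> basis_vec k (E i \<otimes>\<^bsub>rook_monoid G n\<^esub> D)"
    by (intro R.W.L.smult_assoc1[symmetric] inv_\<epsilon> tf bas_closed G.rook_closed E_closed assms)
  finally show "u i \<otimes>\<^bsub>A\<^esub> basis_vec k D = basis_vec k D \<ominus>\<^bsub>A\<^esub>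
      (inv\<^bsub>k\<^esub> \<epsilon> \<otimes>\<^bsub>k\<^esub> twist_factor (E i) D) \<odot>\<^bsub>A\<^esub> basis_vec k (E i \<otimes>\<^bsub>rook_monoid G n\<^esub> D)"
    using semilinear_zero(3)[OF R.W.linear_mult_left[OF b] R.W.L.M.abelian_group_axioms R.W.L.M.abelian_group_axioms
        R.W.A.one_closed e_closed] R.W.A.l_one[OF b] unfolding u_def by simp
  have "basis_vec k D \<otimes>\<^bsub>A\<^esub> ((inv\<^bsub>k\<^esub> \<epsilon>) \<odot>\<^bsub>A\<^esub> basis_vec k (E i)) =
      (inv\<^bsub>k\<^esub> \<epsilon>) \<odot>\<^bsub>A\<^esub> (twist_factor D (E i) \<odot>\<^bsub>A\<^esub> basis_vec k (D \<otimes>\<^bsub>rook_monoid G n\<^esub> E i))"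
    unfolding R.W.smult_mult_r[OF inv_\<epsilon>(1) b bE]
    using R.basis_mult[of D "E i"] E_closed[of i] assms by (simp only: R.W_simps(5) rook_simps(1))
  also have "\<dots> = (inv\<^bsub>k\<^esub> \<epsilon> \<otimes>\<^bsub>k\<^esub> twist_factor D (E i)) \<odot>\<^bsub>A\<^esub> basis_vec k (D \<otimes>\<^bsub>rook_monoid G n\<^esub> E i)"
    by (intro R.W.L.smult_assoc1[symmetric] inv_\<epsilon> tf bas_closed G.rook_closed E_closed assms)
  finally show "basis_vec k D \<otimes>\<^bsub>A\<^esub> u i = basis_vec k D \<ominus>\<^bsub>A\<^esub>
      (inv\<^bsub>k\<^esub> \<epsilon> \<otimes>\<^bsub>k\<^esub> twist_factor D (E i)) \<odot>\<^bsub>A\<^esub> basis_vec k (D \<otimes>\<^bsub>rook_monoid G n\<^esub> E i)"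
    using semilinear_zero(3)[OF R.W.linear_mult_right[OF b] R.W.L.M.abelian_group_axioms R.W.L.M.abelian_group_axioms
        R.W.A.one_closed e_closed] R.W.A.r_one[OF b] unfolding u_def by simp
qed

lemma u_annihilates:
  assumes D: "D \<in> rook_diagrams G n" and i: "i \<in> {1..n}"
  shows "\<not> left_attached D i \<Longrightarrow> u i \<otimes>\<^bsub>A\<^esub> basis_vec k D = \<zero>\<^bsub>A\<^esub>"
    and "\<not> right_attached D i \<Longrightarrow> basis_vec k D \<otimes>\<^bsub>A\<^esub> u i = \<zero>\<^bsub>A\<^esub>"
proof -
  note b = bas_closed[OF D]
  have *: "inv\<^bsub>k\<^esub> \<epsilon> \<otimes>\<^bsub>k\<^esub> (\<epsilon> [^]\<^bsub>k\<^esub> (1::nat)) = \<one>\<^bsub>k\<^esub>" using inv_\<epsilon> \<epsilon>_closed by simp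
  show "u i \<otimes>\<^bsub>A\<^esub> basis_vec k D = \<zero>\<^bsub>A\<^esub>" if "\<not> left_attached D i"
    using E_absorb(1)[OF D i that] u_mult(1)[OF D, of i] * R.W.L.smult_one[OF b] R.W.L.M.r_neg[OF b]
    by (simp only: a_minus_def)
  show "basis_vec k D \<otimes>\<^bsub>A\<^esub> u i = \<zero>\<^bsub>A\<^esub>" if "\<not> right_attached D i"
    using E_absorb(2)[OF D i that] u_mult(2)[OF D, of i] * R.W.L.smult_one[OF b] R.W.L.M.r_neg[OF b]
    by (simp only: a_minus_def)
qed

text \<open>The inductive step of both annihilators, with \<open>f\<close> the multiplication by the
  element built so far.\<close>

lemma annihilate_diff:
  assumes "linear k A A f" "a \<in> carrier A" "b \<in> carrier A" "c \<in> carrier k" "f a = \<zero>\<^bsub>A\<^esub>" "f b = \<zero>\<^bsub>A\<^esub>"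
  shows "f (a \<ominus>\<^bsub>A\<^esub> c \<odot>\<^bsub>A\<^esub> b) = \<zero>\<^bsub>A\<^esub>"
proof -
  note ag = R.W.L.M.abelian_group_axioms
  have "f (a \<ominus>\<^bsub>A\<^esub> c \<odot>\<^bsub>A\<^esub> b) = \<zero>\<^bsub>A\<^esub> \<ominus>\<^bsub>A\<^esub> c \<odot>\<^bsub>A\<^esub> \<zero>\<^bsub>A\<^esub>"
    using semilinear_zero(3)[OF assms(1) ag ag assms(2) R.W.L.smult_closed[OF assms(4,3)]]
      semilinearD(3)[OF assms(1,4,3)] assms(5,6) by simp
  also have "\<dots> = \<zero>\<^bsub>A\<^esub>"
    using R.W.L.smult_r_null[OF assms(4)] R.W.L.M.r_neg[OF R.W.L.M.zero_closed] by (simp only: a_minus_def)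
  finally show ?thesis .
qed

text \<open>The new factor is put on the right, next to \<open>D\<close>. If the missing node is
  \<open>Suc m\<close>, this factor kills \<open>D\<close>. If it is an earlier one,
  \<open>D\<close> becomes \<open>D\<close> minus a multiple of its product with
  \<open>E (Suc m)\<close>; both diagrams still miss that node, so \<open>v\<close> kills both
  terms.\<close>

lemma left_annihilator:
  assumes "m \<le> n"
  shows "\<exists>v\<in>carrier A. R.proj v = \<one>\<^bsub>R.B.W\<^esub> \<and>
    (\<forall>D\<in>rook_diagrams G n. (\<exists>i\<in>{1..m}. \<not> left_attached D i) \<longrightarrow> v \<otimes>\<^bsub>A\<^esub> basis_vec k D = \<zero>\<^bsub>A\<^esub>)"
  using assms
proof (induct m)
  case 0
  then show ?case using ring_hom_one[OF R.proj_hom] by (intro bexI[of _ "\<one>\<^bsub>A\<^esub>"]) simp_all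
next
  case (Suc m)
  then obtain v where v: "v \<in> carrier A" "R.proj v = \<one>\<^bsub>R.B.W\<^esub>"
    "\<And>D i. \<lbrakk>D \<in> rook_diagrams G n; i \<in> {1..m}; \<not> left_attached D i\<rbrakk> \<Longrightarrow> v \<otimes>\<^bsub>A\<^esub> basis_vec k D = \<zero>\<^bsub>A\<^esub>"
    by (meson Suc_leD)
  have m: "Suc m \<in> {1..n}" using Suc by simp
  show ?case
  proof (intro bexI[of _ "v \<otimes>\<^bsub>A\<^esub> u (Suc m)"] conjI ballI impI)
    show "R.proj (v \<otimes>\<^bsub>A\<^esub> u (Suc m)) = \<one>\<^bsub>R.B.W\<^esub>"
      using ring_hom_mult[OF R.proj_hom v(1) u_closed] v(2) proj_u[OF m] R.B.W.A.l_one[OF R.B.W.A.one_closed] by simp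
    show "v \<otimes>\<^bsub>A\<^esub> u (Suc m) \<in> carrier A" by (intro R.W.A.m_closed v u_closed)
    fix D assume D: "D \<in> rook_diagrams G n" and "\<exists>i\<in>{1..Suc m}. \<not> left_attached D i"
    then obtain i where i: "i \<in> {1..Suc m}" "\<not> left_attached D i" by blast
    note b = bas_closed[OF D]
    have "v \<otimes>\<^bsub>A\<^esub> (u (Suc m) \<otimes>\<^bsub>A\<^esub> basis_vec k D) = \<zero>\<^bsub>A\<^esub>"
    proof (cases "i = Suc m")
      case True
      then show ?thesis using u_annihilates(1)[OF D m] i R.W.A.r_null[OF v(1)] by simp
    next
      case False
      then have im: "i \<in> {1..m}" using i by auto
      note ED = G.rook_closed[OF E_closed[of "Suc m"] D]
      show ?thesis
        unfolding u_mult(1)[OF D]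
        by (rule annihilate_diff[OF R.W.linear_mult_right[OF v(1)] b bas_closed[OF ED] _
              v(3)[OF D im i(2)] v(3)[OF ED im E_attached(1)[OF D i(2)]]])
          (simp add: inv_\<epsilon> \<epsilon>_closed)
    qed
    then show "(v \<otimes>\<^bsub>A\<^esub> u (Suc m)) \<otimes>\<^bsub>A\<^esub> basis_vec k D = \<zero>\<^bsub>A\<^esub>"
      using R.W.A.m_assoc[OF v(1) u_closed b] by simp
  qed
qed

text \<open>The factors are collected in the opposite order, so that the newest one again meets
  \<open>D\<close> first.\<close>

lemma right_annihilator:
  assumes "m \<le> n"
  shows "\<exists>v\<in>carrier A. R.proj v = \<one>\<^bsub>R.B.W\<^esub> \<and>
    (\<forall>D\<in>rook_diagrams G n. (\<exists>i\<in>{1..m}. \<not> right_attached D i) \<longrightarrow> basis_vec k D \<otimes>\<^bsub>A\<^esub> v = \<zero>\<^bsub>A\<^esub>)"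
  using assms
proof (induct m)
  case 0
  then show ?case using ring_hom_one[OF R.proj_hom] by (intro bexI[of _ "\<one>\<^bsub>A\<^esub>"]) simp_all
next
  case (Suc m)
  then obtain v where v: "v \<in> carrier A" "R.proj v = \<one>\<^bsub>R.B.W\<^esub>"
    "\<And>D i. \<lbrakk>D \<in> rook_diagrams G n; i \<in> {1..m}; \<not> right_attached D i\<rbrakk> \<Longrightarrow> basis_vec k D \<otimes>\<^bsub>A\<^esub> v = \<zero>\<^bsub>A\<^esub>"
    by (meson Suc_leD)
  have m: "Suc m \<in> {1..n}" using Suc by simp
  show ?case
  proof (intro bexI[of _ "u (Suc m) \<otimes>\<^bsub>A\<^esub> v"] conjI ballI impI)
    show "R.proj (u (Suc m) \<otimes>\<^bsub>A\<^esub> v) = \<one>\<^bsub>R.B.W\<^esub>"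
      using ring_hom_mult[OF R.proj_hom u_closed v(1)] v(2) proj_u[OF m] R.B.W.A.l_one[OF R.B.W.A.one_closed] by simp
    show "u (Suc m) \<otimes>\<^bsub>A\<^esub> v \<in> carrier A" by (intro R.W.A.m_closed v u_closed)
    fix D assume D: "D \<in> rook_diagrams G n" and "\<exists>i\<in>{1..Suc m}. \<not> right_attached D i"
    then obtain i where i: "i \<in> {1..Suc m}" "\<not> right_attached D i" by blast
    note b = bas_closed[OF D]
    have "(basis_vec k D \<otimes>\<^bsub>A\<^esub> u (Suc m)) \<otimes>\<^bsub>A\<^esub> v = \<zero>\<^bsub>A\<^esub>"
    proof (cases "i = Suc m")
      case True
      then show ?thesis using u_annihilates(2)[OF D m] i R.W.A.l_null[OF v(1)] by simp
    next
      case False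
      then have im: "i \<in> {1..m}" using i by auto
      note DE = G.rook_closed[OF D E_closed[of "Suc m"]]
      show ?thesis
        unfolding u_mult(2)[OF D]
        by (rule annihilate_diff[OF R.W.linear_mult_left[OF v(1)] b bas_closed[OF DE] _
              v(3)[OF D im i(2)] v(3)[OF DE im E_attached(2)[OF D i(2)]]])
          (simp add: inv_\<epsilon> \<epsilon>_closed)
    qed
    then show "basis_vec k D \<otimes>\<^bsub>A\<^esub> (u (Suc m) \<otimes>\<^bsub>A\<^esub> v) = \<zero>\<^bsub>A\<^esub>"
      using R.W.A.m_assoc[OF b u_closed v(1)] by simp
  qed
qed

lemma Tor_rook_iso:
  "graded_module_iso k
     (Tor k (rook_algebra k G n \<epsilon>) (rook_trivial_module k n) (rook_trivial_module k n))
     (Tor k (group_algebra k (power_semidirect_sym G n)) (group_trivial_module k) (group_trivial_module k))"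
proof -
  \<comment> \<open>Equal numbers of attached nodes in the two columns make each remaining diagram
    defective on both sides, so \<open>eL\<close> and \<open>eR\<close> both annihilate it.\<close>
  have missing: "(\<exists>i\<in>{1..n}. \<not> left_attached D i) \<and> (\<exists>i\<in>{1..n}. \<not> right_attached D i)"
    if D: "D \<in> rook_diagrams G n" "D \<notin> permutation_diagram n ` carrier (power_semidirect_sym G n)" for D
    using rook_full_iff(2,3)[OF D(1)] rook_card(1,2)[OF D(1)] D(2) G.permutation_diagram_image[OF D(1)] by blast
  obtain eL where eL: "eL \<in> carrier A" "R.proj eL = \<one>\<^bsub>R.B.W\<^esub>"
    "\<forall>D\<in>rook_diagrams G n. (\<exists>i\<in>{1..n}. \<not> left_attached D i) \<longrightarrow> eL \<otimes>\<^bsub>A\<^esub> basis_vec k D = \<zero>\<^bsub>A\<^esub>"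
    using left_annihilator[OF order_refl] by blast
  obtain eR where eR: "eR \<in> carrier A" "R.proj eR = \<one>\<^bsub>R.B.W\<^esub>"
    "\<forall>D\<in>rook_diagrams G n. (\<exists>i\<in>{1..n}. \<not> right_attached D i) \<longrightarrow> basis_vec k D \<otimes>\<^bsub>A\<^esub> eR = \<zero>\<^bsub>A\<^esub>"
    using right_annihilator[OF order_refl] by blast
  have "\<forall>D\<in>carrier (rook_monoid G n) - permutation_diagram n ` carrier (power_semidirect_sym G n).
      eL \<otimes>\<^bsub>A\<^esub> basis_vec k D = \<zero>\<^bsub>A\<^esub>"
    using eL(3) missing unfolding rook_simps(1) by blast
  moreover have "\<forall>D\<in>carrier (rook_monoid G n) - permutation_diagram n ` carrier (power_semidirect_sym G n).
      basis_vec k D \<otimes>\<^bsub>A\<^esub> eR = \<zero>\<^bsub>A\<^esub>"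
    using eR(3) missing unfolding rook_simps(1) by blast
  ultimately show ?thesis
    using R.Tor_character_iso[OF eL(1,2) _ eR(1,2)]
    unfolding rook_algebra_def rook_trivial_module_def by blast
qed

end

theorem theorem7p5:
  fixes G :: "('g, 'y) monoid_scheme" and k :: "('k, 'z) ring_scheme"
    and \<phi> :: "'g \<Rightarrow> 'k \<Rightarrow> 'k" and n :: nat and \<epsilon> :: 'k
  assumes "group G" and "commutative_G_ring G k \<phi>" and "\<epsilon> \<in> Units k"
  shows "graded_module_iso k
           (Tor k (rook_algebra k G n \<epsilon>) (rook_trivial_module k n) (rook_trivial_module k n))
           (Tor k (group_algebra k (power_semidirect_sym G n))
              (group_trivial_module k) (group_trivial_module k)) \<and>
         Tor k (group_algebra k (power_semidirect_sym G n))
              (group_trivial_module k) (group_trivial_module k) =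
         group_homology k (power_semidirect_sym G n) (group_trivial_module k)"
proof -
  have "cring k" using assms(2) by (simp add: commutative_G_ring_def)
  then interpret rook_setting G k n \<epsilon>
    by (intro rook_setting.intro rook_setting_axioms.intro assms)
  \<comment> \<open>The second conjunct is the definition of group homology with trivial
    coefficients.\<close>
  show ?thesis using Tor_rook_iso by (simp add: group_homology_def)
qed


end
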